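(* Let $k$ be a field containing the rational numbers and let $(\mathcal{A},\mu,\alpha)$ be a multiplicative Hom-associative algebra over $k$. Then $HC^{Hom}_n(\mathcal{A})\cong HC^{Hom,\lambda}_n(\mathcal{A})$ for all $n\geq 0$, i.e. the total homology of the cyclic bicomplex $CC^{Hom}_{\ast,\ast}(\mathcal{A})$ agrees with the homology of the quotient complex $(C^{Hom,\lambda}_\ast(\mathcal{A}),b)$.
   Context: A Hom-associative algebra $(\mathcal{A},\mu,\alpha)$ over a field $k$ is a $k$-vector space $\mathcal{A}$ with linear maps $\mu:\mathcal{A}\otimes\mathcal{A}\to\mathcal{A}$, written $ab$, and $\alpha:\mathcal{A}\to\mathcal{A}$ such that $\alpha(a)(bc)=(ab)\alpha(c)$. It is multiplicative if $\alpha(ab)=\alpha(a)\alpha(b)$. No unit is assumed. Let $C_n^{Hom}(\mathcal{A})=\mathcal{A}^{\otimes (n+1)}$, $n\ge 0$. Define linear maps $b,b':C_n^{Hom}(\mathcal{A})\to C_{n-1}^{Hom}(\mathcal{A})$ ($n\ge 1$) by $$b'(a_0\otimes\cdots\otimes a_n)=\sum_{i=0}^{n-1}(-1)^i\alpha(a_0)\otimes\cdots\otimes a_ia_{i+1}\otimes\cdots\otimes\alpha(a_n),$$ $$b(a_0\otimes\cdots\otimes a_n)=b'(a_0\otimes\cdots\otimes a_n)+(-1)^na_na_0\otimes\alpha(a_1)\otimes\cdots\otimes\alpha(a_{n-1}),$$ and $t_n,N:C_n^{Hom}(\mathcal{A})\to C_n^{Hom}(\mathcal{A})$ by $t_n(a_0\otimes\cdots\otimes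 a_n)=(-1)^na_n\otimes a_0\otimes\cdots\otimes a_{n-1}$ and $N=\mathrm{Id}+t_n+t_n^2+\cdots+t_n^n$. $C_n^{Hom,\lambda}(\mathcal{A})=C_n^{Hom}(\mathcal{A})/\mathrm{Im}(\mathrm{Id}-t_n)$; the map $b$ descends to it, and $HC^{Hom,\lambda}_\ast(\mathcal{A})$ is the homology of $(C_\ast^{Hom,\lambda}(\mathcal{A}),b)$. The cyclic bicomplex has $CC^{Hom}_{p,q}(\mathcal{A})=\mathcal{A}^{\otimes (q+1)}$ for $p,q\ge 0$; the vertical differential $CC_{p,q}\to CC_{p,q-1}$ is $b$ for $p$ even and $-b'$ for $p$ odd; the horizontal differential $CC_{p,q}\to CC_{p-1,q}$ is $\mathrm{Id}-t_q$ for $p$ odd and $N$ for $p$ even, $p\geq 2$. $HC^{Hom}_\ast(\mathcal{A})$ is the homology of its total complex, $\mathrm{Tot}_n=\bigoplus_{p+q=n}CC_{p,q}$ with differential the sum of the horizontal and vertical ones. *)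

theory Defs
  imports Complex_Main "HOL-Algebra.Module" "HOL-Algebra.QuotRing"
begin

section \<open>Linear algebra\<close>

text \<open>
  Vector spaces over a field \<open>K\<close> are the modules of the locale \<^locale>\<open>module\<close>. The
  record type \<^typ>\<open>('k, 'v) module\<close> extends \<^typ>\<open>'v ring\<close>; the multiplicative
  components are irrelevant for modules and are left unspecified below.
\<close>

definition linear_maps ::
  "('k, 'r) ring_scheme \<Rightarrow> ('k, 'v, 'm) module_scheme \<Rightarrow> ('k, 'w, 'n) module_scheme \<Rightarrow> ('v \<Rightarrow> 'w) set"
  where "linear_maps K V W =
    {f \<in> carrier V \<rightarrow> carrier W.
       (\<forall>x\<in>carrier V. \<forall>y\<in>carrier V. f (x \<oplus>\<^bsub>V\<^esub> y) = f x \<oplus>\<^bsub>W\<^esub> f y) \<and>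
       (\<forall>c\<in>carrier K. \<forall>x\<in>carrier V. f (c \<odot>\<^bsub>V\<^esub> x) = c \<odot>\<^bsub>W\<^esub> f x)}"

definition linearly_isomorphic ::
  "('k, 'r) ring_scheme \<Rightarrow> ('k, 'v, 'm) module_scheme \<Rightarrow> ('k, 'w, 'n) module_scheme \<Rightarrow> bool"
  where "linearly_isomorphic K V W \<longleftrightarrow>
    (\<exists>f \<in> linear_maps K V W. bij_betw f (carrier V) (carrier W))"

definition submodule_generated ::
  "('k, 'r) ring_scheme \<Rightarrow> ('k, 'v, 'm) module_scheme \<Rightarrow> 'v set \<Rightarrow> 'v set"
  where "submodule_generated K V S = \<Inter>{H. submodule H K V \<and> S \<subseteq> H}"

text \<open>Elements of \<open>V / H\<close> are the cosets of \<open>H\<close>, as for \<^const>\<open>FactRing\<close>.\<close>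

definition quot_module :: "('k, 'v, 'm) module_scheme \<Rightarrow> 'v set \<Rightarrow> ('k, 'v set) module"
  where "quot_module V H =
    \<lparr>carrier = a_rcosets\<^bsub>V\<^esub> H, mult = undefined, one = undefined,
     zero = H, add = set_add V, smult = (\<lambda>c U. \<Union>x\<in>U. H +>\<^bsub>V\<^esub> (c \<odot>\<^bsub>V\<^esub> x))\<rparr>"

text \<open>
  The map \<open>V / G \<rightarrow> W / H\<close> induced by a linear map \<open>f : V \<rightarrow> W\<close> with \<open>f(G) \<subseteq> H\<close>: all
  cosets in the union are then the same.
\<close>

definition quot_map :: "('k, 'w, 'm) module_scheme \<Rightarrow> 'w set \<Rightarrow> ('v \<Rightarrow> 'w) \<Rightarrow> 'v set \<Rightarrow> 'w set"
  where "quot_map W H f U = (\<Union>x\<in>U. H +>\<^bsub>W\<^esub> f x)"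

definition direct_sum_module :: "'i set \<Rightarrow> ('i \<Rightarrow> ('k, 'v, 'm) module_scheme) \<Rightarrow> ('k, 'i \<Rightarrow> 'v) module"
  where "direct_sum_module I V =
    \<lparr>carrier = {x \<in> \<Pi>\<^sub>E i\<in>I. carrier (V i). finite {i \<in> I. x i \<noteq> \<zero>\<^bsub>V i\<^esub>}},
     mult = undefined, one = undefined,
     zero = (\<lambda>i\<in>I. \<zero>\<^bsub>V i\<^esub>),
     add = (\<lambda>x y. \<lambda>i\<in>I. x i \<oplus>\<^bsub>V i\<^esub> y i),
     smult = (\<lambda>c x. \<lambda>i\<in>I. c \<odot>\<^bsub>V i\<^esub> x i)\<rparr>"

definition self_module :: "('k, 'r) ring_scheme \<Rightarrow> ('k, 'k) module"
  where "self_module K =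
    \<lparr>carrier = carrier K, mult = undefined, one = undefined,
     zero = \<zero>\<^bsub>K\<^esub>, add = add K, smult = mult K\<rparr>"

definition free_module :: "('k, 'r) ring_scheme \<Rightarrow> 's set \<Rightarrow> ('k, 's \<Rightarrow> 'k) module"
  where "free_module K S = direct_sum_module S (\<lambda>_. self_module K)"

definition free_gen :: "('k, 'r) ring_scheme \<Rightarrow> 's set \<Rightarrow> 's \<Rightarrow> 's \<Rightarrow> 'k"
  where "free_gen K S s = (\<lambda>s'\<in>S. if s' = s then \<one>\<^bsub>K\<^esub> else \<zero>\<^bsub>K\<^esub>)"

definition alt_sign :: "('k, 'r) ring_scheme \<Rightarrow> nat \<Rightarrow> 'k"
  where "alt_sign K i = (\<ominus>\<^bsub>K\<^esub> \<one>\<^bsub>K\<^esub>) [^]\<^bsub>K\<^esub> i"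

definition rat_field :: "rat ring"
  where "rat_field = \<lparr>carrier = UNIV, mult = (*), one = 1, zero = 0, add = (+)\<rparr>"

definition contains_rationals :: "('k, 'r) ring_scheme \<Rightarrow> bool"
  where "contains_rationals K \<longleftrightarrow> (\<exists>h \<in> ring_hom rat_field K. inj_on h (carrier rat_field))"

section \<open>Tensor powers\<close>

text \<open>
  The \<open>m\<close>-th tensor power of \<open>A\<close> is the free vector space on the \<open>m\<close>-tuples of elements of \<open>A\<close>
  (lists of length \<open>m\<close>) modulo the relations expressing additivity and homogeneity in each entry.
\<close>

definition tuples :: "('k, 'a, 'm) module_scheme \<Rightarrow> nat \<Rightarrow> 'a list set"
  where "tuples A m = {xs. set xs \<subseteq> carrier A \<and> length xs = m}"

definition tensor_rels ::
  "('k, 'r) ring_scheme \<Rightarrow> ('k, 'a, 'm) module_scheme \<Rightarrow> nat \<Rightarrow> ('a list \<Rightarrow> 'k) set"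
  where "tensor_rels K A m =
    (let F = free_module K (tuples A m); \<delta> = free_gen K (tuples A m) in
      {\<delta> (xs[i := a \<oplus>\<^bsub>A\<^esub> b]) \<ominus>\<^bsub>F\<^esub> (\<delta> (xs[i := a]) \<oplus>\<^bsub>F\<^esub> \<delta> (xs[i := b])) | xs i a b.
         xs \<in> tuples A m \<and> i < m \<and> a \<in> carrier A \<and> b \<in> carrier A} \<union>
      {\<delta> (xs[i := c \<odot>\<^bsub>A\<^esub> a]) \<ominus>\<^bsub>F\<^esub> (c \<odot>\<^bsub>F\<^esub> \<delta> (xs[i := a])) | xs i c a.
         xs \<in> tuples A m \<and> i < m \<and> c \<in> carrier K \<and> a \<in> carrier A})"

definition tensor_null ::
  "('k, 'r) ring_scheme \<Rightarrow> ('k, 'a, 'm) module_scheme \<Rightarrow> nat \<Rightarrow> ('a list \<Rightarrow> 'k) set"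
  where "tensor_null K A m = submodule_generated K (free_module K (tuples A m)) (tensor_rels K A m)"

definition tensor_power ::
  "('k, 'r) ring_scheme \<Rightarrow> ('k, 'a, 'm) module_scheme \<Rightarrow> nat \<Rightarrow> ('k, ('a list \<Rightarrow> 'k) set) module"
  where "tensor_power K A m = quot_module (free_module K (tuples A m)) (tensor_null K A m)"

text \<open>The class of \<open>a\<^sub>1 \<otimes> \<dots> \<otimes> a\<^sub>m\<close>, where \<open>xs = [a\<^sub>1, \<dots>, a\<^sub>m]\<close>.\<close>

definition pure_tensor ::
  "('k, 'r) ring_scheme \<Rightarrow> ('k, 'a, 'm) module_scheme \<Rightarrow> 'a list \<Rightarrow> ('a list \<Rightarrow> 'k) set"
  where "pure_tensor K A xs =
    tensor_null K A (length xs) +>\<^bsub>free_module K (tuples A (length xs))\<^esub>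
      free_gen K (tuples A (length xs)) xs"

text \<open>
  The linear map on the \<open>m\<close>-th tensor power with prescribed values \<open>f xs\<close> on the pure tensors. It
  exists and is unique whenever \<open>f\<close> is multilinear, which is the case in all uses below.
\<close>

definition tensor_lift ::
  "('k, 'r) ring_scheme \<Rightarrow> ('k, 'a, 'm) module_scheme \<Rightarrow> nat \<Rightarrow> ('k, 'w, 'n) module_scheme \<Rightarrow>
   ('a list \<Rightarrow> 'w) \<Rightarrow> ('a list \<Rightarrow> 'k) set \<Rightarrow> 'w"
  where "tensor_lift K A m W f =
    (THE g. g \<in> linear_maps K (tensor_power K A m) W \<and>
            g \<in> extensional (carrier (tensor_power K A m)) \<and>
            (\<forall>xs\<in>tuples A m. g (pure_tensor K A xs) = f xs))"

section \<open>Homology\<close>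

text \<open>
  A chain complex is given by modules \<open>C n\<close> and maps \<open>d n : C n \<rightarrow> C (n - 1)\<close> for \<open>n \<ge> 1\<close>, with
  \<open>C\<close> vanishing in negative degrees; \<open>d 0\<close> is ignored.
\<close>

definition cycles :: "(nat \<Rightarrow> ('k, 'v, 'm) module_scheme) \<Rightarrow> (nat \<Rightarrow> 'v \<Rightarrow> 'v) \<Rightarrow> nat \<Rightarrow> 'v set"
  where "cycles C d n = {x \<in> carrier (C n). n \<ge> 1 \<longrightarrow> d n x = \<zero>\<^bsub>C (n - 1)\<^esub>}"

definition boundaries :: "(nat \<Rightarrow> ('k, 'v, 'm) module_scheme) \<Rightarrow> (nat \<Rightarrow> 'v \<Rightarrow> 'v) \<Rightarrow> nat \<Rightarrow> 'v set"
  where "boundaries C d n = d (Suc n) ` carrier (C (Suc n))"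

definition homology ::
  "(nat \<Rightarrow> ('k, 'v, 'm) module_scheme) \<Rightarrow> (nat \<Rightarrow> 'v \<Rightarrow> 'v) \<Rightarrow> nat \<Rightarrow> ('k, 'v set) module"
  where "homology C d n = quot_module ((C n)\<lparr>carrier := cycles C d n\<rparr>) (boundaries C d n)"

section \<open>Hom-associative algebras and their cyclic homology\<close>

locale hom_assoc_algebra = field K + module K A
  for K :: "('k, 'r) ring_scheme" and A :: "('k, 'a, 'm) module_scheme" +
  fixes \<mu> :: "'a \<Rightarrow> 'a \<Rightarrow> 'a" and \<alpha> :: "'a \<Rightarrow> 'a"
  assumes mu_linear_right: "a \<in> carrier A \<Longrightarrow> (\<lambda>b. \<mu> a b) \<in> linear_maps K A A"
    and mu_linear_left: "b \<in> carrier A \<Longrightarrow> (\<lambda>a. \<mu> a b) \<in> linear_maps K A A"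
    and alpha_linear: "\<alpha> \<in> linear_maps K A A"
    and hom_assoc: "\<lbrakk>a \<in> carrier A; b \<in> carrier A; c \<in> carrier A\<rbrakk> \<Longrightarrow>
      \<mu> (\<alpha> a) (\<mu> b c) = \<mu> (\<mu> a b) (\<alpha> c)"

locale multiplicative_hom_assoc_algebra = hom_assoc_algebra +
  assumes alpha_mult: "\<lbrakk>a \<in> carrier A; b \<in> carrier A\<rbrakk> \<Longrightarrow> \<alpha> (\<mu> a b) = \<mu> (\<alpha> a) (\<alpha> b)"

definition hom_chains ::
  "('k, 'r) ring_scheme \<Rightarrow> ('k, 'a, 'm) module_scheme \<Rightarrow> nat \<Rightarrow> ('k, ('a list \<Rightarrow> 'k) set) module"
  where "hom_chains K A n = tensor_power K A (n + 1)"

text \<open>The tuple \<open>[\<alpha> a\<^sub>0, \<dots>, \<mu> a\<^sub>i a\<^sub>i\<^sub>+\<^sub>1, \<dots>, \<alpha> a\<^sub>n]\<close>.\<close>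

definition inner_face :: "('a \<Rightarrow> 'a \<Rightarrow> 'a) \<Rightarrow> ('a \<Rightarrow> 'a) \<Rightarrow> nat \<Rightarrow> 'a list \<Rightarrow> 'a list"
  where "inner_face \<mu> \<alpha> i xs =
    map \<alpha> (take i xs) @ [\<mu> (xs ! i) (xs ! (i + 1))] @ map \<alpha> (drop (i + 2) xs)"

text \<open>The tuple \<open>[\<mu> a\<^sub>n a\<^sub>0, \<alpha> a\<^sub>1, \<dots>, \<alpha> a\<^sub>n\<^sub>-\<^sub>1]\<close>.\<close>

definition last_face :: "('a \<Rightarrow> 'a \<Rightarrow> 'a) \<Rightarrow> ('a \<Rightarrow> 'a) \<Rightarrow> 'a list \<Rightarrow> 'a list"
  where "last_face \<mu> \<alpha> xs = \<mu> (last xs) (hd xs) # map \<alpha> (butlast (tl xs))"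

text \<open>\<open>hom_b'\<close> and \<open>hom_b\<close> are meant for \<open>n \<ge> 1\<close>.\<close>

definition hom_b' ::
  "('k, 'r) ring_scheme \<Rightarrow> ('k, 'a, 'm) module_scheme \<Rightarrow> ('a \<Rightarrow> 'a \<Rightarrow> 'a) \<Rightarrow> ('a \<Rightarrow> 'a) \<Rightarrow> nat \<Rightarrow>
   ('a list \<Rightarrow> 'k) set \<Rightarrow> ('a list \<Rightarrow> 'k) set"
  where "hom_b' K A \<mu> \<alpha> n =
    (let C' = hom_chains K A (n - 1) in
      tensor_lift K A (n + 1) C'
        (\<lambda>xs. \<Oplus>\<^bsub>C'\<^esub>i\<in>{..<n}. alt_sign K i \<odot>\<^bsub>C'\<^esub> pure_tensor K A (inner_face \<mu> \<alpha> i xs)))"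

definition hom_b ::
  "('k, 'r) ring_scheme \<Rightarrow> ('k, 'a, 'm) module_scheme \<Rightarrow> ('a \<Rightarrow> 'a \<Rightarrow> 'a) \<Rightarrow> ('a \<Rightarrow> 'a) \<Rightarrow> nat \<Rightarrow>
   ('a list \<Rightarrow> 'k) set \<Rightarrow> ('a list \<Rightarrow> 'k) set"
  where "hom_b K A \<mu> \<alpha> n =
    (let C' = hom_chains K A (n - 1) in
      tensor_lift K A (n + 1) C'
        (\<lambda>xs. hom_b' K A \<mu> \<alpha> n (pure_tensor K A xs) \<oplus>\<^bsub>C'\<^esub>
              alt_sign K n \<odot>\<^bsub>C'\<^esub> pure_tensor K A (last_face \<mu> \<alpha> xs)))"

definition hom_t ::
  "('k, 'r) ring_scheme \<Rightarrow> ('k, 'a, 'm) module_scheme \<Rightarrow> nat \<Rightarrow>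
   ('a list \<Rightarrow> 'k) set \<Rightarrow> ('a list \<Rightarrow> 'k) set"
  where "hom_t K A n =
    (let C = hom_chains K A n in
      tensor_lift K A (n + 1) C
        (\<lambda>xs. alt_sign K n \<odot>\<^bsub>C\<^esub> pure_tensor K A (last xs # butlast xs)))"

definition hom_id_minus_t ::
  "('k, 'r) ring_scheme \<Rightarrow> ('k, 'a, 'm) module_scheme \<Rightarrow> nat \<Rightarrow>
   ('a list \<Rightarrow> 'k) set \<Rightarrow> ('a list \<Rightarrow> 'k) set"
  where "hom_id_minus_t K A n x = x \<ominus>\<^bsub>hom_chains K A n\<^esub> hom_t K A n x"

definition hom_N ::
  "('k, 'r) ring_scheme \<Rightarrow> ('k, 'a, 'm) module_scheme \<Rightarrow> nat \<Rightarrow>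
   ('a list \<Rightarrow> 'k) set \<Rightarrow> ('a list \<Rightarrow> 'k) set"
  where "hom_N K A n x = (\<Oplus>\<^bsub>hom_chains K A n\<^esub>j\<in>{..n}. (hom_t K A n ^^ j) x)"

subsection \<open>The quotient complex\<close>

definition cyclic_null ::
  "('k, 'r) ring_scheme \<Rightarrow> ('k, 'a, 'm) module_scheme \<Rightarrow> nat \<Rightarrow> ('a list \<Rightarrow> 'k) set set"
  where "cyclic_null K A n = hom_id_minus_t K A n ` carrier (hom_chains K A n)"

definition lambda_chains ::
  "('k, 'r) ring_scheme \<Rightarrow> ('k, 'a, 'm) module_scheme \<Rightarrow> nat \<Rightarrow> ('k, ('a list \<Rightarrow> 'k) set set) module"
  where "lambda_chains K A n = quot_module (hom_chains K A n) (cyclic_null K A n)"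

definition lambda_b ::
  "('k, 'r) ring_scheme \<Rightarrow> ('k, 'a, 'm) module_scheme \<Rightarrow> ('a \<Rightarrow> 'a \<Rightarrow> 'a) \<Rightarrow> ('a \<Rightarrow> 'a) \<Rightarrow> nat \<Rightarrow>
   ('a list \<Rightarrow> 'k) set set \<Rightarrow> ('a list \<Rightarrow> 'k) set set"
  where "lambda_b K A \<mu> \<alpha> n =
    quot_map (hom_chains K A (n - 1)) (cyclic_null K A (n - 1)) (hom_b K A \<mu> \<alpha> n)"

definition HC_lambda ::
  "('k, 'r) ring_scheme \<Rightarrow> ('k, 'a, 'm) module_scheme \<Rightarrow> ('a \<Rightarrow> 'a \<Rightarrow> 'a) \<Rightarrow> ('a \<Rightarrow> 'a) \<Rightarrow> nat \<Rightarrow>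
   ('k, ('a list \<Rightarrow> 'k) set set set) module"
  where "HC_lambda K A \<mu> \<alpha> n = homology (lambda_chains K A) (lambda_b K A \<mu> \<alpha>) n"

subsection \<open>The cyclic bicomplex\<close>

definition CC ::
  "('k, 'r) ring_scheme \<Rightarrow> ('k, 'a, 'm) module_scheme \<Rightarrow> nat \<times> nat \<Rightarrow> ('k, ('a list \<Rightarrow> 'k) set) module"
  where "CC K A = (\<lambda>(p, q). tensor_power K A (q + 1))"

text \<open>The differential out of position \<open>(p, q)\<close> into \<open>(p, q - 1)\<close>, for \<open>q \<ge> 1\<close>.\<close>

definition CC_vert ::
  "('k, 'r) ring_scheme \<Rightarrow> ('k, 'a, 'm) module_scheme \<Rightarrow> ('a \<Rightarrow> 'a \<Rightarrow> 'a) \<Rightarrow> ('a \<Rightarrow> 'a) \<Rightarrow> nat \<Rightarrow> nat \<Rightarrow>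
   ('a list \<Rightarrow> 'k) set \<Rightarrow> ('a list \<Rightarrow> 'k) set"
  where "CC_vert K A \<mu> \<alpha> p q x =
    (if even p then hom_b K A \<mu> \<alpha> q x else \<ominus>\<^bsub>CC K A (p, q - 1)\<^esub> hom_b' K A \<mu> \<alpha> q x)"

text \<open>The differential out of position \<open>(p, q)\<close> into \<open>(p - 1, q)\<close>, for \<open>p \<ge> 1\<close>.\<close>

definition CC_horiz ::
  "('k, 'r) ring_scheme \<Rightarrow> ('k, 'a, 'm) module_scheme \<Rightarrow> nat \<Rightarrow> nat \<Rightarrow>
   ('a list \<Rightarrow> 'k) set \<Rightarrow> ('a list \<Rightarrow> 'k) set"
  where "CC_horiz K A p q x = (if odd p then hom_id_minus_t K A q x else hom_N K A q x)"

definition Tot ::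
  "('k, 'r) ring_scheme \<Rightarrow> ('k, 'a, 'm) module_scheme \<Rightarrow> nat \<Rightarrow>
   ('k, nat \<times> nat \<Rightarrow> ('a list \<Rightarrow> 'k) set) module"
  where "Tot K A n = direct_sum_module {(p, q). p + q = n} (CC K A)"

text \<open>
  The component of the total differential at \<open>(p, q)\<close> collects the contributions of the two
  positions mapping to \<open>(p, q)\<close>.
\<close>

definition Tot_d ::
  "('k, 'r) ring_scheme \<Rightarrow> ('k, 'a, 'm) module_scheme \<Rightarrow> ('a \<Rightarrow> 'a \<Rightarrow> 'a) \<Rightarrow> ('a \<Rightarrow> 'a) \<Rightarrow> nat \<Rightarrow>
   (nat \<times> nat \<Rightarrow> ('a list \<Rightarrow> 'k) set) \<Rightarrow> (nat \<times> nat \<Rightarrow> ('a list \<Rightarrow> 'k) set)"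
  where "Tot_d K A \<mu> \<alpha> n x =
    restrict
      (\<lambda>(p, q). CC_horiz K A (p + 1) q (x (p + 1, q)) \<oplus>\<^bsub>CC K A (p, q)\<^esub>
                CC_vert K A \<mu> \<alpha> p (q + 1) (x (p, q + 1)))
      {(p, q). p + q = n - 1}"

definition HC ::
  "('k, 'r) ring_scheme \<Rightarrow> ('k, 'a, 'm) module_scheme \<Rightarrow> ('a \<Rightarrow> 'a \<Rightarrow> 'a) \<Rightarrow> ('a \<Rightarrow> 'a) \<Rightarrow> nat \<Rightarrow>
   ('k, (nat \<times> nat \<Rightarrow> ('a list \<Rightarrow> 'k) set) set) module"
  where "HC K A \<mu> \<alpha> n = homology (Tot K A) (Tot_d K A \<mu> \<alpha>) n"

end

theory Submission
  imports Defs
begin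

text \<open>
  The total differential is chased from the column \<open>p = 0\<close> to the left-hand columns: since the
  rows of the bicomplex are exact for \<open>p \<ge> 1\<close>, a chain in \<open>CC\<^sub>0\<^sub>,\<^sub>n\<close> whose boundary lies in
  \<open>Im (Id - t)\<close> extends to a cycle of the total complex, and a total cycle whose entry in the column
  \<open>p = 0\<close> represents a boundary of the quotient complex is a total boundary. So the projection to
  the column \<open>p = 0\<close> induces the isomorphism. Exactness of the rows follows from \<open>t\<^sup>n\<^sup>+\<^sup>1 = Id\<close> and
  the invertibility of \<open>n + 1\<close>. The identities \<open>b (Id - t) = (Id - t) b'\<close> and \<open>b' N = N b\<close> only
  use that conjugation by \<open>t\<close> shifts the signed face maps cyclically.
\<close>

section \<open>Linear maps and quotients\<close>

text \<open>Hom-associativity and multiplicativity enter at one point only, the relations between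
  inner faces: adjacent faces agree by Hom-associativity, distant ones because
  \<open>\<alpha>\<close> respects products. Relations with the last face are obtained from these by
  rotation. The rest therefore runs in two abstract settings, \<open>bicomplex\<close> and
  \<open>cyclic_operators\<close>, of which the tensor powers supply one instance. Signs are
  absorbed into the face maps, so \<open>b\<close> and \<open>b'\<close> become plain sums. What
  ties the instance to the abstract setting is the universal property of tensor powers:
  \<open>hom_b\<close>, \<open>hom_b'\<close> and \<open>hom_t\<close> are definite descriptions,
  meaningful only once the prescribed values are known to be multilinear, and identities between
  them are checked on pure tensors. In the chase, a total chain of degree n has n + 1 entries, which
  are chosen one column at a time; the equation to be met in one column involves the entries of two
  neighbouring columns.\<close>

lemma linear_mapsI:
  assumes "\<And>x. x \<in> carrier V \<Longrightarrow> f x \<in> carrier W"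
    and "\<And>x y. \<lbrakk>x \<in> carrier V; y \<in> carrier V\<rbrakk> \<Longrightarrow> f (x \<oplus>\<^bsub>V\<^esub> y) = f x \<oplus>\<^bsub>W\<^esub> f y"
    and "\<And>c x. \<lbrakk>c \<in> carrier K; x \<in> carrier V\<rbrakk> \<Longrightarrow> f (c \<odot>\<^bsub>V\<^esub> x) = c \<odot>\<^bsub>W\<^esub> f x"
  shows "f \<in> linear_maps K V W"
  using assms by (auto simp: linear_maps_def)

lemma linear_maps_closed: "\<lbrakk>f \<in> linear_maps K V W; x \<in> carrier V\<rbrakk> \<Longrightarrow> f x \<in> carrier W"
  and linear_maps_add:
    "\<lbrakk>f \<in> linear_maps K V W; x \<in> carrier V; y \<in> carrier V\<rbrakk> \<Longrightarrow> f (x \<oplus>\<^bsub>V\<^esub> y) = f x \<oplus>\<^bsub>W\<^esub> f y"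
  and linear_maps_smult:
    "\<lbrakk>f \<in> linear_maps K V W; c \<in> carrier K; x \<in> carrier V\<rbrakk> \<Longrightarrow> f (c \<odot>\<^bsub>V\<^esub> x) = c \<odot>\<^bsub>W\<^esub> f x"
  by (auto simp: linear_maps_def)

lemma linear_maps_id: "(\<lambda>x. x) \<in> linear_maps K V V"
  by (auto simp: linear_maps_def)

lemma linear_maps_comp:
  assumes "f \<in> linear_maps K U V" "g \<in> linear_maps K V W"
  shows "(\<lambda>x. g (f x)) \<in> linear_maps K U W"
  by (rule linear_mapsI)
    (use assms in \<open>auto simp: linear_maps_closed linear_maps_add linear_maps_smult\<close>)

lemma linear_maps_cong:
  assumes "f \<in> linear_maps K V W" "\<And>x. x \<in> carrier V \<Longrightarrow> g x = f x" "module K V"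
  shows "g \<in> linear_maps K V W"
proof -
  interpret module K V by fact
  show ?thesis
    by (rule linear_mapsI)
      (use assms in \<open>auto simp: linear_maps_closed linear_maps_add linear_maps_smult\<close>)
qed

text \<open>Scalar multiplication on \<open>quot_module\<close> and the map \<open>quot_map\<close>
  are unions over the representatives of a coset; such a union collapses once all representatives
  contribute the same coset.\<close>

lemma UN_eq_const: "\<lbrakk>x \<in> U; \<And>y. y \<in> U \<Longrightarrow> f y = a\<rbrakk> \<Longrightarrow> (\<Union>y\<in>U. f y) = a"
  by blast

locale linear_map = V: module K V + W: module K W
  for K (structure) and V :: "('k, 'v, 'm) module_scheme" and W :: "('k, 'w, 'n) module_scheme" +
  fixes f
  assumes linear: "f \<in> linear_maps K V W"
begin

lemmas closed [simp, intro] = linear_maps_closed[OF linear]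
  and add = linear_maps_add[OF linear]
  and smult = linear_maps_smult[OF linear]

lemma zero: "f \<zero>\<^bsub>V\<^esub> = \<zero>\<^bsub>W\<^esub>"
  using smult[of "\<zero>" "\<zero>\<^bsub>V\<^esub>"] by simp

lemma neg: "x \<in> carrier V \<Longrightarrow> f (\<ominus>\<^bsub>V\<^esub> x) = \<ominus>\<^bsub>W\<^esub> f x"
  by (metis W.M.minus_equality V.M.a_inv_closed V.M.l_neg add closed zero)

lemma minus: "\<lbrakk>x \<in> carrier V; y \<in> carrier V\<rbrakk> \<Longrightarrow> f (x \<ominus>\<^bsub>V\<^esub> y) = f x \<ominus>\<^bsub>W\<^esub> f y"
  by (simp add: a_minus_def add neg)

lemma finsum:
  assumes "g \<in> I \<rightarrow> carrier V"
  shows "f (finsum V g I) = finsum W (\<lambda>i. f (g i)) I"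
  using assms
proof (induction I rule: infinite_finite_induct)
  case (insert i I)
  then show ?case
    by (subst V.M.finsum_insert, auto simp: add Pi_def intro!: V.M.finsum_closed W.M.finsum_insert[symmetric])
qed (simp_all add: zero)

lemma image_submodule:
  assumes "submodule H K V"
  shows "submodule (f ` H) K W"
proof (rule W.submoduleI)
  note H = V.submoduleE[OF assms]
  then have sub: "\<And>x. x \<in> H \<Longrightarrow> x \<in> carrier V" by blast
  show "f ` H \<subseteq> carrier W" using sub by auto
  have "\<zero>\<^bsub>V\<^esub> \<in> H"
    using assms unfolding submodule_def by (metis subgroup.one_closed monoid.simps(2))
  then show "\<zero>\<^bsub>W\<^esub> \<in> f ` H" using zero by force
  show "\<And>a. a \<in> f ` H \<Longrightarrow> \<ominus>\<^bsub>W\<^esub> a \<in> f ` H"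
    using H(3) sub by (auto simp: neg[symmetric])
  show "\<And>a b. \<lbrakk>a \<in> f ` H; b \<in> f ` H\<rbrakk> \<Longrightarrow> a \<oplus>\<^bsub>W\<^esub> b \<in> f ` H"
    using H(5) sub by (auto simp: add[symmetric])
  show "\<And>c x. \<lbrakk>c \<in> carrier K; x \<in> f ` H\<rbrakk> \<Longrightarrow> c \<odot>\<^bsub>W\<^esub> x \<in> f ` H"
    using H(4) sub by (auto simp: smult[symmetric])
qed

lemma preimage_submodule:
  assumes "submodule H K W"
  shows "submodule {x \<in> carrier V. f x \<in> H} K V"
proof (rule V.submoduleI)
  note H = W.submoduleE[OF assms]
  have "\<zero>\<^bsub>W\<^esub> \<in> H"
    using assms unfolding submodule_def by (metis subgroup.one_closed monoid.simps(2))
  then show "\<zero>\<^bsub>V\<^esub> \<in> {x \<in> carrier V. f x \<in> H}" by (simp add: zero)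
qed (use W.submoduleE[OF assms] in \<open>auto simp: neg add smult\<close>)

end

lemma (in module) zero_submodule: "submodule {\<zero>\<^bsub>M\<^esub>} R M"
  by (rule submoduleI) auto

lemma (in module) submodule_zero: "submodule H R M \<Longrightarrow> \<zero>\<^bsub>M\<^esub> \<in> H"
  unfolding submodule_def by (metis subgroup.one_closed monoid.simps(2))

text \<open>\<open>homology\<close> is a quotient of the cycles, so the boundaries are needed as a
  submodule of the chain module with its carrier shrunk to the cycles.\<close>

lemma (in module) subset_submodule:
  assumes "submodule H R M" "submodule H' R M" "H \<subseteq> H'"
  shows "submodule H R (M\<lparr>carrier := H'\<rparr>)"
proof -
  interpret S: module R "M\<lparr>carrier := H'\<rparr>"
    using submodule.submodule_is_module[OF assms(2)] module_axioms by blast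
  show ?thesis
    using submodule.submodule_is_module[OF assms(1) module_axioms] assms(3)
    by (intro S.module_incl_imp_submodule) auto
qed

text \<open>\<open>linear_maps\<close> asks for no structure on the target, so every module law can
  be transported from \<open>V\<close>. The zero of \<open>W\<close> is an arbitrary record field
  until \<open>W\<close> is known to be a group, hence the separate assumption on it.\<close>

lemma module_of_surjection:
  fixes W :: "('k, 'w, 'n) module_scheme"
  assumes "module K V" and f: "f \<in> linear_maps K V W" and surj: "f ` carrier V = carrier W"
    and zero: "f \<zero>\<^bsub>V\<^esub> = \<zero>\<^bsub>W\<^esub>"
  shows "module K W"
proof -
  interpret V: module K V by fact
  note lin = linear_maps_closed[OF f] linear_maps_add[OF f, symmetric] linear_maps_smult[OF f, symmetric]
  have E: "\<exists>y\<in>carrier V. x = f y" if "x \<in> carrier W" for x using surj that by auto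
  show ?thesis
  proof (rule moduleI)
    show "abelian_group W"
    proof (rule abelian_groupI)
      fix x y assume "x \<in> carrier W" "y \<in> carrier W"
      with E obtain x' y' where xy: "x' \<in> carrier V" "y' \<in> carrier V" "x = f x'" "y = f y'" by blast
      show "x \<oplus>\<^bsub>W\<^esub> y \<in> carrier W" "x \<oplus>\<^bsub>W\<^esub> y = y \<oplus>\<^bsub>W\<^esub> x"
        using xy by (simp_all add: lin V.M.a_comm)
      fix z assume "z \<in> carrier W"
      with E obtain z' where "z' \<in> carrier V" "z = f z'" by blast
      with xy show "x \<oplus>\<^bsub>W\<^esub> y \<oplus>\<^bsub>W\<^esub> z = x \<oplus>\<^bsub>W\<^esub> (y \<oplus>\<^bsub>W\<^esub> z)"
        by (simp add: lin V.M.a_assoc)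
    next
      show "\<zero>\<^bsub>W\<^esub> \<in> carrier W" using zero lin(1) by (metis V.M.zero_closed)
      fix x assume "x \<in> carrier W"
      with E obtain x' where x: "x' \<in> carrier V" "x = f x'" by blast
      show "\<zero>\<^bsub>W\<^esub> \<oplus>\<^bsub>W\<^esub> x = x" using x by (simp add: lin zero[symmetric])
      have "f (\<ominus>\<^bsub>V\<^esub> x') \<oplus>\<^bsub>W\<^esub> x = \<zero>\<^bsub>W\<^esub>" using x by (simp add: lin V.M.l_neg zero)
      then show "\<exists>y\<in>carrier W. y \<oplus>\<^bsub>W\<^esub> x = \<zero>\<^bsub>W\<^esub>" using x lin(1) by blast
    qed
    fix c d x y assume c: "c \<in> carrier K" "d \<in> carrier K" and "x \<in> carrier W" "y \<in> carrier W"
    with E obtain x' y' where xy: "x' \<in> carrier V" "y' \<in> carrier V" "x = f x'" "y = f y'" by blast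
    show "c \<odot>\<^bsub>W\<^esub> x \<in> carrier W" "(c \<oplus>\<^bsub>K\<^esub> d) \<odot>\<^bsub>W\<^esub> x = c \<odot>\<^bsub>W\<^esub> x \<oplus>\<^bsub>W\<^esub> d \<odot>\<^bsub>W\<^esub> x"
      "c \<odot>\<^bsub>W\<^esub> (x \<oplus>\<^bsub>W\<^esub> y) = c \<odot>\<^bsub>W\<^esub> x \<oplus>\<^bsub>W\<^esub> c \<odot>\<^bsub>W\<^esub> y"
      "(c \<otimes>\<^bsub>K\<^esub> d) \<odot>\<^bsub>W\<^esub> x = c \<odot>\<^bsub>W\<^esub> (d \<odot>\<^bsub>W\<^esub> x)"
      using c xy by (simp_all add: lin V.smult_l_distr V.smult_r_distr V.smult_assoc1)
  next
    fix x assume "x \<in> carrier W"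
    with E obtain x' where "x' \<in> carrier V" "x = f x'" by blast
    then show "\<one>\<^bsub>K\<^esub> \<odot>\<^bsub>W\<^esub> x = x" by (simp add: lin)
  qed (rule V.is_cring)
qed

section \<open>Cosets and quotient modules\<close>

context module
begin

lemma submodule_abelian_subgroup: "submodule H R M \<Longrightarrow> abelian_subgroup H M"
  by (intro abelian_subgroupI3 additive_subgroup.intro submodule.axioms M.abelian_group_axioms)

lemma coset_add:
  assumes "submodule H R M" "x \<in> carrier M" "y \<in> carrier M"
  shows "(H +>\<^bsub>M\<^esub> x) <+>\<^bsub>M\<^esub> (H +>\<^bsub>M\<^esub> y) = H +>\<^bsub>M\<^esub> (x \<oplus>\<^bsub>M\<^esub> y)"
  using abelian_subgroup.a_rcos_sum[OF submodule_abelian_subgroup] assms by blast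

lemma coset_self: "\<lbrakk>submodule H R M; x \<in> carrier M\<rbrakk> \<Longrightarrow> x \<in> H +>\<^bsub>M\<^esub> x"
  using abelian_subgroup.a_rcos_self[OF submodule_abelian_subgroup] by blast

lemma coset_eq_iff:
  assumes H: "submodule H R M" and xy: "x \<in> carrier M" "y \<in> carrier M"
  shows "H +>\<^bsub>M\<^esub> x = H +>\<^bsub>M\<^esub> y \<longleftrightarrow> x \<ominus>\<^bsub>M\<^esub> y \<in> H"
  using abelian_subgroup.a_rcos_module[OF submodule_abelian_subgroup[OF H] xy(2,1)]
    abelian_subgroup.a_repr_independence'[OF submodule_abelian_subgroup[OF H]]
    coset_self[OF H] xy
  unfolding a_minus_def by metis

lemma coset_eq_self_iff:
  assumes H: "submodule H R M" and "x \<in> carrier M"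
  shows "H +>\<^bsub>M\<^esub> x = H \<longleftrightarrow> x \<in> H"
  using coset_eq_iff[OF H assms(2) M.zero_closed] assms(2)
    M.a_coset_add_zero[of H] submoduleE(1)[OF H] M.minus_equality[of "\<zero>\<^bsub>M\<^esub>" "\<zero>\<^bsub>M\<^esub>"]
  by (simp add: a_minus_def)

lemma coset_memD:
  assumes H: "submodule H R M" and "y \<in> carrier M" "x \<in> H +>\<^bsub>M\<^esub> y"
  shows "x \<in> carrier M" "H +>\<^bsub>M\<^esub> x = H +>\<^bsub>M\<^esub> y"
proof -
  show "x \<in> carrier M" using assms submoduleE(1)[OF H] unfolding a_r_coset_def' by auto
  show "H +>\<^bsub>M\<^esub> x = H +>\<^bsub>M\<^esub> y"
    using abelian_subgroup.a_repr_independence'[OF submodule_abelian_subgroup[OF H] assms(3,2)] by simp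
qed

lemma quot_proj_linear: "submodule H R M \<Longrightarrow> (\<lambda>x. H +>\<^bsub>M\<^esub> x) \<in> linear_maps R M (quot_module M H)"
proof (rule linear_mapsI)
  assume H: "submodule H R M"
  fix x assume x: "x \<in> carrier M"
  show "H +>\<^bsub>M\<^esub> x \<in> carrier (quot_module M H)"
    using x by (auto simp: quot_module_def A_RCOSETS_def')
  show "H +>\<^bsub>M\<^esub> (x \<oplus>\<^bsub>M\<^esub> y) = (H +>\<^bsub>M\<^esub> x) \<oplus>\<^bsub>quot_module M H\<^esub> (H +>\<^bsub>M\<^esub> y)" if "y \<in> carrier M" for y
    using coset_add[OF H x that] by (simp add: quot_module_def)
  fix c assume c: "c \<in> carrier R"
  \<comment> \<open>Independence of the representative: representatives differ by an element of
    \<open>H\<close>, and so do their multiples.\<close>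
  have "H +>\<^bsub>M\<^esub> (c \<odot>\<^bsub>M\<^esub> y) = H +>\<^bsub>M\<^esub> (c \<odot>\<^bsub>M\<^esub> x)" if "y \<in> H +>\<^bsub>M\<^esub> x" for y
  proof -
    note y = coset_memD[OF H x that]
    then have "y \<ominus>\<^bsub>M\<^esub> x \<in> H" using coset_eq_iff[OF H] x by blast
    then have "c \<odot>\<^bsub>M\<^esub> (y \<ominus>\<^bsub>M\<^esub> x) \<in> H" using c submoduleE(4)[OF H] by blast
    then show ?thesis
      using x y c coset_eq_iff[OF H] by (simp add: a_minus_def smult_r_distr smult_r_minus)
  qed
  from UN_eq_const[OF coset_self[OF H x] this]
  show "H +>\<^bsub>M\<^esub> (c \<odot>\<^bsub>M\<^esub> x) = c \<odot>\<^bsub>quot_module M H\<^esub> (H +>\<^bsub>M\<^esub> x)"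
    by (simp add: quot_module_def)
qed

lemma carrier_quot_module: "carrier (quot_module M H) = (\<lambda>x. H +>\<^bsub>M\<^esub> x) ` carrier M"
  by (auto simp: quot_module_def A_RCOSETS_def')

lemma zero_quot_module: "\<zero>\<^bsub>quot_module M H\<^esub> = H"
  by (simp add: quot_module_def)

lemma quot_module_is_module:
  assumes "submodule H R M"
  shows "module R (quot_module M H)"
  using quot_proj_linear[OF assms] submodule_zero[OF assms]
  by (intro module_of_surjection[OF module_axioms, where f = "\<lambda>x. H +>\<^bsub>M\<^esub> x"])
    (auto simp: carrier_quot_module zero_quot_module coset_eq_self_iff[OF assms])

end

context linear_map
begin

lemma quot_map_coset:
  assumes G: "submodule G K V" and H: "submodule H K W" and GH: "\<And>x. x \<in> G \<Longrightarrow> f x \<in> H"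
    and x: "x \<in> carrier V"
  shows "quot_map W H f (G +>\<^bsub>V\<^esub> x) = H +>\<^bsub>W\<^esub> f x"
proof -
  have "H +>\<^bsub>W\<^esub> f y = H +>\<^bsub>W\<^esub> f x" if "y \<in> G +>\<^bsub>V\<^esub> x" for y
  proof -
    note y = V.coset_memD[OF G x that]
    then have "f (y \<ominus>\<^bsub>V\<^esub> x) \<in> H" using V.coset_eq_iff[OF G] x GH by blast
    then show ?thesis using x y W.coset_eq_iff[OF H] by (simp add: minus)
  qed
  from UN_eq_const[OF V.coset_self[OF G x] this] show ?thesis by (simp add: quot_map_def)
qed

lemma quot_map_linear:
  assumes G: "submodule G K V" and H: "submodule H K W" and GH: "\<And>x. x \<in> G \<Longrightarrow> f x \<in> H"
  shows "quot_map W H f \<in> linear_maps K (quot_module V G) (quot_module W H)"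
proof -
  note qm = quot_map_coset[OF assms]
  note VG = V.quot_proj_linear[OF G] and WH = W.quot_proj_linear[OF H]
  show ?thesis
    by (rule linear_mapsI)
      (auto simp: V.carrier_quot_module qm linear_maps_closed[OF WH] add smult
        linear_maps_add[OF VG, symmetric] linear_maps_add[OF WH, symmetric]
        linear_maps_smult[OF VG, symmetric] linear_maps_smult[OF WH, symmetric])
qed

text \<open>The equivalence \<open>iff\<close> does double duty: read from right to left it makes
  the induced map well defined, read from left to right it makes it injective.\<close>

lemma quot_linearly_isomorphic:
  assumes surj: "f ` carrier V = carrier W"
    and G: "submodule G K V" and H: "submodule H K W"
    and iff: "\<And>x. x \<in> carrier V \<Longrightarrow> f x \<in> H \<longleftrightarrow> x \<in> G"
  shows "linearly_isomorphic K (quot_module V G) (quot_module W H)"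
proof -
  have GH: "\<And>x. x \<in> G \<Longrightarrow> f x \<in> H" using iff V.submoduleE(1)[OF G] by blast
  note qm = quot_map_coset[OF G H GH]
  have "bij_betw (quot_map W H f) (carrier (quot_module V G)) (carrier (quot_module W H))"
    unfolding bij_betw_def
  proof
    show "inj_on (quot_map W H f) (carrier (quot_module V G))"
    proof (rule inj_onI)
      fix X Y assume "X \<in> carrier (quot_module V G)" "Y \<in> carrier (quot_module V G)"
        and eq: "quot_map W H f X = quot_map W H f Y"
      then obtain x y where xy: "x \<in> carrier V" "y \<in> carrier V" "X = G +>\<^bsub>V\<^esub> x" "Y = G +>\<^bsub>V\<^esub> y"
        by (auto simp: V.carrier_quot_module)
      with eq have "f (x \<ominus>\<^bsub>V\<^esub> y) \<in> H" by (simp add: qm W.coset_eq_iff[OF H] minus)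
      with xy show "X = Y" by (simp add: iff V.coset_eq_iff[OF G])
    qed
    have "quot_map W H f ` carrier (quot_module V G) = (\<lambda>x. H +>\<^bsub>W\<^esub> f x) ` carrier V"
      unfolding V.carrier_quot_module image_image by (rule image_cong) (simp_all add: qm)
    also have "\<dots> = carrier (quot_module W H)"
      unfolding W.carrier_quot_module surj[symmetric] image_image ..
    finally show "quot_map W H f ` carrier (quot_module V G) = carrier (quot_module W H)" .
  qed
  then show ?thesis using quot_map_linear[OF G H GH] unfolding linearly_isomorphic_def by blast
qed

end

text \<open>Serves two purposes: free modules, where the index set may be infinite and finite
  support has to be tracked, and total complexes, where it is a finite antidiagonal. All laws hold
  entrywise.\<close>

lemma direct_sum_module_is_module:
  assumes "cring K" and V: "\<And>i. i \<in> I \<Longrightarrow> module K (V i)"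
  shows "module K (direct_sum_module I V)"
proof -
  let ?D = "direct_sum_module I V"
  note ab = V[THEN module.axioms(2)]
  note mon = ab[THEN abelian_group.axioms(1)]
  \<comment> \<open>The support of a multiple or a negative lies in that of the argument, the
    support of a sum (\<open>sub2\<close>) in the union of the two.\<close>
  have sub: "finite {i \<in> I. h i \<noteq> \<zero>\<^bsub>V i\<^esub>}"
    if "finite {i \<in> I. x i \<noteq> \<zero>\<^bsub>V i\<^esub>}" "\<And>i. i \<in> I \<Longrightarrow> x i = \<zero>\<^bsub>V i\<^esub> \<Longrightarrow> h i = \<zero>\<^bsub>V i\<^esub>" for x h
    by (rule finite_subset[OF _ that(1)]) (use that(2) in auto)
  have sub2: "finite {i \<in> I. h i \<noteq> \<zero>\<^bsub>V i\<^esub>}"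
    if "finite {i \<in> I. x i \<noteq> \<zero>\<^bsub>V i\<^esub>}" "finite {i \<in> I. y i \<noteq> \<zero>\<^bsub>V i\<^esub>}"
      "\<And>i. i \<in> I \<Longrightarrow> x i = \<zero>\<^bsub>V i\<^esub> \<Longrightarrow> y i = \<zero>\<^bsub>V i\<^esub> \<Longrightarrow> h i = \<zero>\<^bsub>V i\<^esub>" for x y h
    by (rule finite_subset[OF _ finite_UnI[OF that(1,2)]]) (use that(3) in auto)
  have car: "carrier ?D = {x \<in> \<Pi>\<^sub>E i\<in>I. carrier (V i). finite {i \<in> I. x i \<noteq> \<zero>\<^bsub>V i\<^esub>}}"
    and ops: "add ?D = (\<lambda>x y. \<lambda>i\<in>I. x i \<oplus>\<^bsub>V i\<^esub> y i)" "\<zero>\<^bsub>?D\<^esub> = (\<lambda>i\<in>I. \<zero>\<^bsub>V i\<^esub>)"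
      "smult ?D = (\<lambda>c x. \<lambda>i\<in>I. c \<odot>\<^bsub>V i\<^esub> x i)"
    by (simp_all add: direct_sum_module_def)
  have memI: "x \<in> carrier ?D" if "x \<in> (\<Pi>\<^sub>E i\<in>I. carrier (V i))" "finite {i \<in> I. x i \<noteq> \<zero>\<^bsub>V i\<^esub>}" for x
    using that by (simp add: car)
  have ext: "x = y" if "x \<in> extensional I" "y \<in> extensional I" "\<And>i. i \<in> I \<Longrightarrow> x i = y i" for x y :: "_ \<Rightarrow> 'd"
    by (rule extensionalityI[OF that(1,2)]) (rule that(3))
  show ?thesis
  proof (rule moduleI)
    show "abelian_group ?D"
    proof (rule abelian_groupI)
      fix x y assume xy: "x \<in> carrier ?D" "y \<in> carrier ?D"
      show "x \<oplus>\<^bsub>?D\<^esub> y \<in> carrier ?D"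
      proof (rule memI)
        show "finite {i \<in> I. (x \<oplus>\<^bsub>?D\<^esub> y) i \<noteq> \<zero>\<^bsub>V i\<^esub>}"
          by (rule sub2[of x y])
            (use xy in \<open>auto simp: car ops abelian_monoid.l_zero[OF mon] abelian_monoid.zero_closed[OF mon]\<close>)
      qed (use xy in \<open>auto simp: car ops PiE_iff abelian_monoid.a_closed[OF mon]\<close>)
      show "x \<oplus>\<^bsub>?D\<^esub> y = y \<oplus>\<^bsub>?D\<^esub> x"
        using xy unfolding car ops by (intro ext) (auto simp: PiE_iff abelian_monoid.a_comm[OF mon])
      fix z assume "z \<in> carrier ?D"
      with xy show "x \<oplus>\<^bsub>?D\<^esub> y \<oplus>\<^bsub>?D\<^esub> z = x \<oplus>\<^bsub>?D\<^esub> (y \<oplus>\<^bsub>?D\<^esub> z)"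
        unfolding car ops by (intro ext) (auto simp: PiE_iff abelian_monoid.a_assoc[OF mon])
    next
      show "\<zero>\<^bsub>?D\<^esub> \<in> carrier ?D" unfolding car ops by (auto simp: abelian_monoid.zero_closed[OF mon])
      fix x assume x: "x \<in> carrier ?D"
      then show "\<zero>\<^bsub>?D\<^esub> \<oplus>\<^bsub>?D\<^esub> x = x"
        unfolding car ops by (intro ext) (auto simp: PiE_iff abelian_monoid.l_zero[OF mon])
      let ?y = "\<lambda>i\<in>I. \<ominus>\<^bsub>V i\<^esub> x i"
      have "finite {i \<in> I. ?y i \<noteq> \<zero>\<^bsub>V i\<^esub>}"
        by (rule sub[of x])
          (use x in \<open>auto simp: car abelian_group.minus_equality[OF ab] abelian_monoid.l_zero[OF mon]
            abelian_monoid.zero_closed[OF mon]\<close>)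
      then have "?y \<in> carrier ?D"
        using x unfolding car by (auto simp: PiE_iff abelian_group.a_inv_closed[OF ab])
      moreover have "?y \<oplus>\<^bsub>?D\<^esub> x = \<zero>\<^bsub>?D\<^esub>"
        using x unfolding car ops by (intro ext) (auto simp: PiE_iff abelian_group.l_neg[OF ab])
      ultimately show "\<exists>y\<in>carrier ?D. y \<oplus>\<^bsub>?D\<^esub> x = \<zero>\<^bsub>?D\<^esub>" by blast
    qed
    fix c d x y assume c: "c \<in> carrier K" "d \<in> carrier K" and xy: "x \<in> carrier ?D" "y \<in> carrier ?D"
    show "c \<odot>\<^bsub>?D\<^esub> x \<in> carrier ?D"
    proof (rule memI)
      show "finite {i \<in> I. (c \<odot>\<^bsub>?D\<^esub> x) i \<noteq> \<zero>\<^bsub>V i\<^esub>}"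
        by (rule sub[of x]) (use c xy in \<open>auto simp: car ops module.smult_r_null[OF V]\<close>)
    qed (use c xy in \<open>auto simp: car ops PiE_iff module.smult_closed[OF V]\<close>)
    show "(c \<oplus>\<^bsub>K\<^esub> d) \<odot>\<^bsub>?D\<^esub> x = c \<odot>\<^bsub>?D\<^esub> x \<oplus>\<^bsub>?D\<^esub> d \<odot>\<^bsub>?D\<^esub> x"
      using c xy unfolding car ops by (intro ext) (auto simp: PiE_iff module.smult_l_distr[OF V])
    show
      "c \<odot>\<^bsub>?D\<^esub> (x \<oplus>\<^bsub>?D\<^esub> y) = c \<odot>\<^bsub>?D\<^esub> x \<oplus>\<^bsub>?D\<^esub> c \<odot>\<^bsub>?D\<^esub> y"
      using c xy unfolding car ops by (intro ext) (auto simp: PiE_iff module.smult_r_distr[OF V])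
    show "(c \<otimes>\<^bsub>K\<^esub> d) \<odot>\<^bsub>?D\<^esub> x = c \<odot>\<^bsub>?D\<^esub> (d \<odot>\<^bsub>?D\<^esub> x)"
      using c xy unfolding car ops by (intro ext) (auto simp: PiE_iff module.smult_assoc1[OF V])
  next
    fix x assume "x \<in> carrier ?D"
    then show "\<one>\<^bsub>K\<^esub> \<odot>\<^bsub>?D\<^esub> x = x"
      unfolding car ops by (intro ext) (auto simp: PiE_iff module.smult_one[OF V])
  qed fact
qed

section \<open>Homology and bicomplexes with exact rows\<close>

locale chain_complex = cring K for K (structure) +
  fixes C :: "nat \<Rightarrow> ('k, 'v, 'm) module_scheme" and d :: "nat \<Rightarrow> 'v \<Rightarrow> 'v"
  assumes C: "module K (C n)"
    and d: "d (Suc n) \<in> linear_maps K (C (Suc n)) (C n)"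
    and dd: "x \<in> carrier (C (Suc (Suc n))) \<Longrightarrow> d (Suc n) (d (Suc (Suc n)) x) = \<zero>\<^bsub>C n\<^esub>"
begin

lemma d_map: "linear_map K (C (Suc n)) (C n) (d (Suc n))"
  by (intro linear_map.intro linear_map_axioms.intro C d)

lemma cycles_submodule: "submodule (cycles C d n) K (C n)"
proof (cases n)
  case 0
  then show ?thesis using module.carrier_is_submodule[OF C] by (simp add: cycles_def)
next
  case (Suc m)
  have "{x \<in> carrier (C (Suc m)). d (Suc m) x \<in> {\<zero>\<^bsub>C m\<^esub>}} = cycles C d n"
    by (auto simp: cycles_def Suc)
  then show ?thesis
    using linear_map.preimage_submodule[OF d_map module.zero_submodule[OF C], of m] by (simp add: Suc)
qed

lemma boundaries_submodule: "submodule (boundaries C d n) K ((C n)\<lparr>carrier := cycles C d n\<rparr>)"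
proof (rule module.subset_submodule[OF C _ cycles_submodule])
  show "submodule (boundaries C d n) K (C n)"
    using linear_map.image_submodule[OF d_map module.carrier_is_submodule[OF C]]
    by (simp add: boundaries_def)
  show "boundaries C d n \<subseteq> cycles C d n"
    using dd linear_maps_closed[OF d] by (cases n) (auto simp: boundaries_def cycles_def)
qed

lemma cycles_module: "module K ((C n)\<lparr>carrier := cycles C d n\<rparr>)"
  using submodule.submodule_is_module[OF cycles_submodule C] .

end

text \<open>Only the single degree \<open>n\<close> is looked at: the conditions on cycles and
  boundaries replace commutation with the differentials in the neighbouring degrees.\<close>

lemma homology_linearly_isomorphic:
  assumes "chain_complex K C d" "chain_complex K D e"
    and f: "f \<in> linear_maps K (C n) (D n)"
    and cyc: "f ` cycles C d n = cycles D e n"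
    and bd: "\<And>x. x \<in> cycles C d n \<Longrightarrow> f x \<in> boundaries D e n \<longleftrightarrow> x \<in> boundaries C d n"
  shows "linearly_isomorphic K (homology C d n) (homology D e n)"
proof -
  interpret C: chain_complex K C d by fact
  interpret D: chain_complex K D e by fact
  interpret f: linear_map K "(C n)\<lparr>carrier := cycles C d n\<rparr>" "(D n)\<lparr>carrier := cycles D e n\<rparr>" f
  proof (intro linear_map.intro linear_map_axioms.intro C.cycles_module D.cycles_module linear_mapsI)
    have sub: "cycles C d n \<subseteq> carrier (C n)" by (auto simp: cycles_def)
    fix x assume x: "x \<in> carrier ((C n)\<lparr>carrier := cycles C d n\<rparr>)"
    then show "f x \<in> carrier ((D n)\<lparr>carrier := cycles D e n\<rparr>)" using cyc by auto
    show "f (c \<odot>\<^bsub>(C n)\<lparr>carrier := cycles C d n\<rparr>\<^esub> x) = c \<odot>\<^bsub>(D n)\<lparr>carrier := cycles D e n\<rparr>\<^esub> f x"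
      if "c \<in> carrier K" for c
      using x sub that by (auto simp: linear_maps_smult[OF f])
    fix y assume "y \<in> carrier ((C n)\<lparr>carrier := cycles C d n\<rparr>)"
    with x sub have "x \<in> carrier (C n)" "y \<in> carrier (C n)" by auto
    then show "f (x \<oplus>\<^bsub>(C n)\<lparr>carrier := cycles C d n\<rparr>\<^esub> y) =
        f x \<oplus>\<^bsub>(D n)\<lparr>carrier := cycles D e n\<rparr>\<^esub> f y"
      by (simp add: linear_maps_add[OF f])
  qed
  show ?thesis
    unfolding homology_def
    by (rule f.quot_linearly_isomorphic[OF _ C.boundaries_submodule D.boundaries_submodule])
      (use cyc bd in auto)
qed

text \<open>
  \<open>dh p q\<close> and \<open>dv p q\<close> are the horizontal and vertical differentials out of position \<open>(p, q)\<close>.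
\<close>

locale bicomplex = cring K for K (structure) +
  fixes D :: "nat \<times> nat \<Rightarrow> ('k, 'v, 'm) module_scheme"
    and dh dv :: "nat \<Rightarrow> nat \<Rightarrow> 'v \<Rightarrow> 'v"
  assumes D: "module K (D pq)"
    and dh: "dh (Suc p) q \<in> linear_maps K (D (Suc p, q)) (D (p, q))"
    and dv: "dv p (Suc q) \<in> linear_maps K (D (p, Suc q)) (D (p, q))"
    and dh_dh: "x \<in> carrier (D (Suc (Suc p), q)) \<Longrightarrow> dh (Suc p) q (dh (Suc (Suc p)) q x) = \<zero>\<^bsub>D (p, q)\<^esub>"
    and dv_dv: "x \<in> carrier (D (p, Suc (Suc q))) \<Longrightarrow> dv p (Suc q) (dv p (Suc (Suc q)) x) = \<zero>\<^bsub>D (p, q)\<^esub>"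
    and dh_dv: "x \<in> carrier (D (Suc p, Suc q)) \<Longrightarrow>
      dh (Suc p) q (dv (Suc p) (Suc q) x) \<oplus>\<^bsub>D (p, q)\<^esub> dv p (Suc q) (dh (Suc p) (Suc q) x) = \<zero>\<^bsub>D (p, q)\<^esub>"
    and exact: "\<lbrakk>x \<in> carrier (D (Suc p, q)); dh (Suc p) q x = \<zero>\<^bsub>D (p, q)\<^esub>\<rbrakk> \<Longrightarrow>
      \<exists>y\<in>carrier (D (Suc (Suc p), q)). dh (Suc (Suc p)) q y = x"
begin

section \<open>The total complex and the cokernel of the first row map\<close>

definition total :: "nat \<Rightarrow> ('k, nat \<times> nat \<Rightarrow> 'v) module"
  where "total n = direct_sum_module {(p, q). p + q = n} D"

text \<open>Uses \<open>p + 1\<close>, \<open>q + 1\<close> and \<open>n - 1\<close> just as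
  \<open>Tot_d\<close> does, so that the two are identified by unfolding at the end; the lemma
  \<open>total_d\<close> gives the form with \<open>Suc\<close> used in between.\<close>

definition total_d :: "nat \<Rightarrow> (nat \<times> nat \<Rightarrow> 'v) \<Rightarrow> nat \<times> nat \<Rightarrow> 'v"
  where "total_d n x =
    restrict (\<lambda>(p, q). dh (p + 1) q (x (p + 1, q)) \<oplus>\<^bsub>D (p, q)\<^esub> dv p (q + 1) (x (p, q + 1)))
      {(p, q). p + q = n - 1}"

text \<open>For the cyclic bicomplex \<open>dh 1 q\<close> is Id - t, so this becomes
  \<open>cyclic_null\<close>, and \<open>coker\<close> with \<open>coker_d\<close> becomes the
  quotient complex.\<close>

definition null :: "nat \<Rightarrow> 'v set"
  where "null q = dh 1 q ` carrier (D (1, q))"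

definition coker :: "nat \<Rightarrow> ('k, 'v set) module"
  where "coker q = quot_module (D (0, q)) (null q)"

definition coker_d :: "nat \<Rightarrow> 'v set \<Rightarrow> 'v set"
  where "coker_d q = quot_map (D (0, q - 1)) (null (q - 1)) (dv 0 q)"

text \<open>The modules \<open>D (p, q)\<close> change with the position, so no single
  interpretation covers them; the closure and unit laws enter the simplifier with the module as a
  parameter.\<close>

lemmas [simp] = module.axioms(2)[OF D] abelian_group.axioms(1)[OF module.axioms(2)[OF D]]
  linear_maps_closed[OF dh] linear_maps_closed[OF dv] dh_dh dv_dv
  linear_maps_add[OF dh] linear_maps_add[OF dv]
  linear_maps_smult[OF dh] linear_maps_smult[OF dv]
  abelian_monoid.a_closed abelian_monoid.zero_closed module.smult_closed[OF D]
  abelian_monoid.l_zero abelian_monoid.r_zero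

lemma dh_map: "linear_map K (D (Suc p, q)) (D (p, q)) (dh (Suc p) q)"
  and dv_map: "linear_map K (D (p, Suc q)) (D (p, q)) (dv p (Suc q))"
  by (intro linear_map.intro linear_map_axioms.intro D dh dv)+

lemmas [simp] = linear_map.zero[OF dh_map] linear_map.zero[OF dv_map]

lemma finite_antidiagonal: "finite {(p :: nat, q). p + q = n}"
  by (rule finite_subset[of _ "{..n} \<times> {..n}"]) auto

text \<open>An antidiagonal is finite, so the finite support condition of
  \<open>direct_sum_module\<close> is automatic.\<close>

lemma total_carrier: "x \<in> carrier (total n) \<longleftrightarrow>
    x \<in> extensional {(p, q). p + q = n} \<and> (\<forall>p q. p + q = n \<longrightarrow> x (p, q) \<in> carrier (D (p, q)))"
proof -
  have "finite {i \<in> {(p, q). p + q = n}. x i \<noteq> \<zero>\<^bsub>D i\<^esub>}"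
    by (rule finite_subset[OF _ finite_antidiagonal[of n]]) auto
  then show ?thesis by (auto simp: total_def direct_sum_module_def PiE_iff)
qed

lemma total_add: "p + q = n \<Longrightarrow> (x \<oplus>\<^bsub>total n\<^esub> y) (p, q) = x (p, q) \<oplus>\<^bsub>D (p, q)\<^esub> y (p, q)"
  and total_smult: "p + q = n \<Longrightarrow> (c \<odot>\<^bsub>total n\<^esub> x) (p, q) = c \<odot>\<^bsub>D (p, q)\<^esub> x (p, q)"
  and total_zero: "\<zero>\<^bsub>total n\<^esub> = (\<lambda>i\<in>{(p, q). p + q = n}. \<zero>\<^bsub>D i\<^esub>)"
  by (simp_all add: total_def direct_sum_module_def)

lemma total_d: "p + q = n \<Longrightarrow> total_d (Suc n) x (p, q) =
    dh (Suc p) q (x (Suc p, q)) \<oplus>\<^bsub>D (p, q)\<^esub> dv p (Suc q) (x (p, Suc q))"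
  by (simp add: total_d_def)

lemma total_eqI:
  assumes "x \<in> extensional {(p, q). p + q = n}" "y \<in> extensional {(p, q). p + q = n}"
    "\<And>p q. p + q = n \<Longrightarrow> x (p, q) = y (p, q)"
  shows "x = y"
  using assms by (auto intro: extensionalityI)

lemma total_module: "module K (total n)"
  unfolding total_def by (rule direct_sum_module_is_module[OF is_cring D])

lemma total_d_ext: "total_d (Suc n) x \<in> extensional {(p, q). p + q = n}"
  by (simp add: total_d_def)

lemma total_complex: "chain_complex K total total_d"
proof (intro chain_complex.intro chain_complex_axioms.intro is_cring)
  show "module K (total n)" for n by (rule total_module)
  have closed: "total_d (Suc n) x \<in> carrier (total n)" if "x \<in> carrier (total (Suc n))" for n x
    using that by (auto simp: total_carrier total_d total_d_ext)
  show "total_d (Suc n) \<in> linear_maps K (total (Suc n)) (total n)" for n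
  proof (rule linear_mapsI)
    interpret T: module K "total n" by (rule total_module)
    interpret T': module K "total (Suc n)" by (rule total_module)
    fix x assume x: "x \<in> carrier (total (Suc n))"
    then show 1: "total_d (Suc n) x \<in> carrier (total n)" by (rule closed)
    show "total_d (Suc n) (c \<odot>\<^bsub>total (Suc n)\<^esub> x) = c \<odot>\<^bsub>total n\<^esub> total_d (Suc n) x" if c: "c \<in> carrier K" for c
    proof (rule total_eqI[where n = n])
      show "total_d (Suc n) (c \<odot>\<^bsub>total (Suc n)\<^esub> x) \<in> extensional {(p, q). p + q = n}" by (rule total_d_ext)
      show "c \<odot>\<^bsub>total n\<^esub> total_d (Suc n) x \<in> extensional {(p, q). p + q = n}"
        using c 1 T.smult_closed total_carrier by blast
    qed (use x c in \<open>simp add: total_d total_smult total_carrier module.smult_r_distr[OF D]\<close>)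
    fix y assume y: "y \<in> carrier (total (Suc n))"
    then have 2: "total_d (Suc n) y \<in> carrier (total n)" by (rule closed)
    show "total_d (Suc n) (x \<oplus>\<^bsub>total (Suc n)\<^esub> y) = total_d (Suc n) x \<oplus>\<^bsub>total n\<^esub> total_d (Suc n) y"
    proof (rule total_eqI[where n = n])
      show "total_d (Suc n) (x \<oplus>\<^bsub>total (Suc n)\<^esub> y) \<in> extensional {(p, q). p + q = n}" by (rule total_d_ext)
      show "total_d (Suc n) x \<oplus>\<^bsub>total n\<^esub> total_d (Suc n) y \<in> extensional {(p, q). p + q = n}"
        using T.M.a_closed[OF 1 2] total_carrier by blast
    qed (use x y in \<open>simp add: total_d total_add total_carrier abelian_monoid.a_ac\<close>)
  qed
  show "total_d (Suc n) (total_d (Suc (Suc n)) x) = \<zero>\<^bsub>total n\<^esub>"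
    if x: "x \<in> carrier (total (Suc (Suc n)))" for x n
  proof (rule total_eqI[where n = n])
    show "\<zero>\<^bsub>total n\<^esub> \<in> extensional {(p, q). p + q = n}" by (simp add: total_zero)
    fix p q assume pq: "p + q = n"
    \<comment> \<open>Four paths end in \<open>(p, q)\<close>. The two straight ones give zero by
      \<open>dh_dh\<close> and \<open>dv_dv\<close>; the two bent ones start at
      \<open>(Suc p, Suc q)\<close> and cancel by \<open>dh_dv\<close>.\<close>
    have c: "x (Suc p, Suc q) \<in> carrier (D (Suc p, Suc q))"
      "x (Suc (Suc p), q) \<in> carrier (D (Suc (Suc p), q))"
      "x (p, Suc (Suc q)) \<in> carrier (D (p, Suc (Suc q)))"
      using x pq by (auto simp: total_carrier)
    then show "total_d (Suc n) (total_d (Suc (Suc n)) x) (p, q) = \<zero>\<^bsub>total n\<^esub> (p, q)"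
      using pq dh_dv[OF c(1)] by (simp add: total_d total_zero)
  qed (rule total_d_ext)
qed

lemma null_submodule: "submodule (null q) K (D (0, q))"
  using linear_map.image_submodule[OF dh_map module.carrier_is_submodule[OF D], of 0 q]
  by (simp add: null_def)

lemma dv_null: "x \<in> null (Suc q) \<Longrightarrow> dv 0 (Suc q) x \<in> null q"
proof -
  interpret module K "D (0, q)" by (rule D)
  assume "x \<in> null (Suc q)"
  then obtain y where y: "y \<in> carrier (D (Suc 0, Suc q))" "x = dh (Suc 0) (Suc q) y"
    by (auto simp: null_def)
  \<comment> \<open>The squares anticommute, so the vertical image of \<open>dh y\<close> is
    \<open>dh\<close> of the negative of \<open>dv y\<close>.\<close>
  then have "dh (Suc 0) q (\<ominus>\<^bsub>D (Suc 0, q)\<^esub> dv (Suc 0) (Suc q) y) = dv 0 (Suc q) x"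
    using dh_dv[OF y(1)] M.minus_equality[of "dv 0 (Suc q) x" "dh (Suc 0) q (dv (Suc 0) (Suc q) y)"]
    by (simp add: linear_map.neg[OF dh_map] a_comm)
  then show ?thesis
    using y(1) by (auto simp: null_def image_iff intro!: bexI[of _ "\<ominus>\<^bsub>D (Suc 0, q)\<^esub> dv (Suc 0) (Suc q) y"]
      abelian_group.a_inv_closed)
qed

lemma coker_d_coset:
  assumes "x \<in> carrier (D (0, Suc q))"
  shows "coker_d (Suc q) (null (Suc q) +>\<^bsub>D (0, Suc q)\<^esub> x) = null q +>\<^bsub>D (0, q)\<^esub> dv 0 (Suc q) x"
  using linear_map.quot_map_coset[OF dv_map null_submodule null_submodule dv_null assms]
  by (simp add: coker_d_def)

lemma coker_carrier: "carrier (coker q) = (\<lambda>x. null q +>\<^bsub>D (0, q)\<^esub> x) ` carrier (D (0, q))"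
  by (simp add: coker_def module.carrier_quot_module[OF D])

lemma coker_zero: "\<zero>\<^bsub>coker q\<^esub> = null q"
  by (simp add: coker_def module.zero_quot_module[OF D])

lemma coker_complex: "chain_complex K coker coker_d"
proof (intro chain_complex.intro chain_complex_axioms.intro is_cring)
  show "module K (coker n)" for n
    unfolding coker_def by (rule module.quot_module_is_module[OF D null_submodule])
  show "coker_d (Suc n) \<in> linear_maps K (coker (Suc n)) (coker n)" for n
    using linear_map.quot_map_linear[OF dv_map null_submodule null_submodule dv_null]
    by (simp add: coker_def coker_d_def)
  show "coker_d (Suc n) (coker_d (Suc (Suc n)) x) = \<zero>\<^bsub>coker n\<^esub>" if "x \<in> carrier (coker (Suc (Suc n)))" for x n
    using that
      iffD2[OF module.coset_eq_self_iff[OF D null_submodule] module.submodule_zero[OF D null_submodule]]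
    by (auto simp: coker_carrier coker_d_coset coker_zero)
qed

lemma coker_proj_linear: "(\<lambda>x. null q +>\<^bsub>D (0, q)\<^esub> x) \<in> linear_maps K (D (0, q)) (coker q)"
  unfolding coker_def by (rule module.quot_proj_linear[OF D null_submodule])

text \<open>The entries of the cycle are chosen column by column from \<open>y\<close> on: the
  equation already met in column \<open>p\<close> puts the next obstruction into the kernel of
  \<open>dh\<close>, and exactness of the row removes it.\<close>

lemma extend_cycle:
  assumes y: "y \<in> carrier (D (0, n))" and bd: "\<And>m. n = Suc m \<Longrightarrow> dv 0 n y \<in> null m"
  obtains x where "x \<in> cycles total total_d n" "x (0, n) = y"
proof -
  \<comment> \<open>The state is a pair of neighbouring entries, in columns \<open>p\<close> and
    \<open>Suc p\<close>, because the equation at \<open>(p, n - Suc p)\<close> involves both.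
    Beyond the last column the conditions are vacuous, so the choices can be indexed by all natural
    numbers.\<close>
  define P where "P p z \<longleftrightarrow> (p \<le> n \<longrightarrow> fst z \<in> carrier (D (p, n - p))) \<and> (p = 0 \<longrightarrow> fst z = y) \<and>
    (p < n \<longrightarrow> snd z \<in> carrier (D (Suc p, n - Suc p)) \<and>
      dh (Suc p) (n - Suc p) (snd z) \<oplus>\<^bsub>D (p, n - Suc p)\<^esub> dv p (n - p) (fst z) = \<zero>\<^bsub>D (p, n - Suc p)\<^esub>)"
    for p z
  have "\<exists>z. P 0 z"
  proof (cases n)
    case 0
    \<comment> \<open>There is no column 1 in degree 0; the second component is a dummy.\<close>
    then show ?thesis using y by (intro exI[of _ "(y, y)"]) (simp add: P_def)
  next
    case (Suc m)
    interpret module K "D (0, m)" by (rule D)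
    have "dv 0 (Suc m) y \<in> null m" using bd Suc by blast
    then obtain w where w: "w \<in> carrier (D (Suc 0, m))" "dv 0 (Suc m) y = dh (Suc 0) m w"
      by (auto simp: null_def)
    let ?w = "\<ominus>\<^bsub>D (Suc 0, m)\<^esub> w"
    have "?w \<in> carrier (D (Suc 0, m))" using w by (simp add: abelian_group.a_inv_closed)
    moreover have "dh (Suc 0) m ?w \<oplus>\<^bsub>D (0, m)\<^esub> dv 0 (Suc m) y = \<zero>\<^bsub>D (0, m)\<^esub>"
      using w by (simp add: linear_map.neg[OF dh_map] M.l_neg)
    ultimately show ?thesis using y Suc by (intro exI[of _ "(y, ?w)"]) (simp add: P_def)
  qed
  moreover have "\<exists>z'. P (Suc p) z' \<and> fst z' = snd z" if P: "P p z" for p z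
  proof (cases "Suc p < n")
    case False
    \<comment> \<open>From column \<open>n\<close> on there is no equation left, and the second
      component may be anything.\<close>
    then show ?thesis using P by (intro exI[of _ "(snd z, snd z)"]) (auto simp: P_def)
  next
    case True
    then obtain m where m: "n = Suc (Suc p) + m" using less_iff_Suc_add by auto
    interpret E: module K "D (p, m)" by (rule D)
    interpret F: module K "D (Suc p, m)" by (rule D)
    have z: "fst z \<in> carrier (D (p, Suc (Suc m)))" "snd z \<in> carrier (D (Suc p, Suc m))"
      "dh (Suc p) (Suc m) (snd z) \<oplus>\<^bsub>D (p, Suc m)\<^esub> dv p (Suc (Suc m)) (fst z) = \<zero>\<^bsub>D (p, Suc m)\<^esub>"
      using P m by (simp_all add: P_def Suc_diff_le)
    \<comment> \<open>Applying \<open>dv\<close> to the equation in column \<open>p\<close> kills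
      the term from \<open>fst z\<close>. By anticommutation \<open>dh\<close> then kills
      \<open>dv (snd z)\<close>, and exactness gives the preimage \<open>w\<close>; the next entry
      is its negative.\<close>
    have "dv p (Suc m) (dh (Suc p) (Suc m) (snd z) \<oplus>\<^bsub>D (p, Suc m)\<^esub> dv p (Suc (Suc m)) (fst z)) = \<zero>\<^bsub>D (p, m)\<^esub>"
      by (simp add: z(3))
    then have "dv p (Suc m) (dh (Suc p) (Suc m) (snd z)) = \<zero>\<^bsub>D (p, m)\<^esub>" using z(1,2) by simp
    then have "dh (Suc p) m (dv (Suc p) (Suc m) (snd z)) = \<zero>\<^bsub>D (p, m)\<^esub>" using dh_dv[OF z(2)] z(2) by simp
    then obtain w where w: "w \<in> carrier (D (Suc (Suc p), m))"
      "dh (Suc (Suc p)) m w = dv (Suc p) (Suc m) (snd z)"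
      using exact[of "dv (Suc p) (Suc m) (snd z)" p m] z(2) by auto
    let ?w = "\<ominus>\<^bsub>D (Suc (Suc p), m)\<^esub> w"
    have "?w \<in> carrier (D (Suc (Suc p), m))" using w by (simp add: abelian_group.a_inv_closed)
    moreover have "dh (Suc (Suc p)) m ?w \<oplus>\<^bsub>D (Suc p, m)\<^esub> dv (Suc p) (Suc m) (snd z) = \<zero>\<^bsub>D (Suc p, m)\<^esub>"
      using w z(2) by (simp add: linear_map.neg[OF dh_map] F.M.l_neg)
    ultimately show ?thesis using z(2) m by (intro exI[of _ "(snd z, ?w)"]) (simp add: P_def Suc_diff_le)
  qed
  \<comment> \<open>Consecutive pairs overlap in one entry, so their first components form one
    sequence that satisfies all equations.\<close>
  ultimately obtain f where f: "\<And>p. P p (f p)" "\<And>p. fst (f (Suc p)) = snd (f p)"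
    using dependent_nat_choice[of P "\<lambda>p z z'. fst z' = snd z"] by blast
  define x where "x = restrict (\<lambda>(p, q). fst (f p)) {(p, q). p + q = n}"
  have x: "x (p, q) = fst (f p)" if "p + q = n" for p q using that by (simp add: x_def)
  have "fst (f p) \<in> carrier (D (p, q))" if "p + q = n" for p q
  proof -
    have "q = n - p" "p \<le> n" using that by auto
    then show ?thesis using f(1)[of p] by (simp add: P_def)
  qed
  then have "x \<in> carrier (total n)" by (simp add: total_carrier x) (simp add: x_def)
  moreover have "total_d n x = \<zero>\<^bsub>total m\<^esub>" if m: "n = Suc m" for m
    unfolding m
  proof (rule total_eqI[OF total_d_ext])
    fix p q assume pq: "p + q = m"
    then have "P p (f p)" "n - p = Suc q" "n - Suc p = q" "p < n" using f(1) m by auto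
    then show "total_d (Suc m) x (p, q) = \<zero>\<^bsub>total m\<^esub> (p, q)"
      using pq m by (simp add: total_d total_zero x P_def f(2))
  qed (simp add: total_zero)
  ultimately have "x \<in> cycles total total_d n" by (cases n) (auto simp: cycles_def)
  moreover have "x (0, n) = y" using f(1)[of 0] by (simp add: x P_def)
  ultimately show ?thesis using that by blast
qed

text \<open>The same chase with right-hand side \<open>x\<close> in place of zero, one degree
  higher; \<open>y0\<close> and \<open>y1\<close> solve the equation in column 0, and the cycle
  condition on \<open>x\<close> makes each later equation solvable.\<close>

lemma extend_boundary:
  assumes x: "x \<in> cycles total total_d n"
    and y: "y0 \<in> carrier (D (0, Suc n))" "y1 \<in> carrier (D (1, n))"
      "dh 1 n y1 \<oplus>\<^bsub>D (0, n)\<^esub> dv 0 (Suc n) y0 = x (0, n)"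
  shows "x \<in> boundaries total total_d n"
proof -
  \<comment> \<open>The chain sought has degree \<open>Suc n\<close>, so column \<open>p\<close>
    sits at height \<open>Suc n - p\<close> and equations run up to \<open>p = n\<close>, where they
    hold at \<open>(n, 0)\<close>.\<close>
  define P where "P p z \<longleftrightarrow> (p \<le> Suc n \<longrightarrow> fst z \<in> carrier (D (p, Suc n - p))) \<and>
    (p \<le> n \<longrightarrow> snd z \<in> carrier (D (Suc p, n - p)) \<and>
      dh (Suc p) (n - p) (snd z) \<oplus>\<^bsub>D (p, n - p)\<^esub> dv p (Suc n - p) (fst z) = x (p, n - p))"
    for p z
  have xc: "x (p, q) \<in> carrier (D (p, q))" if "p + q = n" for p q
    using x that by (auto simp: cycles_def total_carrier)
  have xd: "dh (Suc p) q (x (Suc p, q)) \<oplus>\<^bsub>D (p, q)\<^esub> dv p (Suc q) (x (p, Suc q)) = \<zero>\<^bsub>D (p, q)\<^esub>"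
    if "n = Suc (p + q)" for p q
  proof -
    have "total_d n x = \<zero>\<^bsub>total (n - 1)\<^esub>" using x that by (auto simp: cycles_def)
    then have "total_d (Suc (p + q)) x (p, q) = \<zero>\<^bsub>total (p + q)\<^esub> (p, q)" using that by simp
    then show ?thesis by (simp add: total_d total_zero)
  qed
  have "\<exists>z. P 0 z" using y by (intro exI[of _ "(y0, y1)"]) (simp add: P_def)
  moreover have "\<exists>z'. P (Suc p) z' \<and> fst z' = snd z" if P: "P p z" for p z
  proof (cases "Suc p \<le> n")
    case False
    then show ?thesis using P by (intro exI[of _ "(snd z, snd z)"]) (simp add: P_def)
  next
    case True
    then obtain m where m: "n = Suc p + m" using nat_le_iff_add by auto
    interpret E: module K "D (p, m)" by (rule D)
    interpret E': module K "D (p, Suc m)" by (rule D)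
    interpret F: module K "D (Suc p, m)" by (rule D)
    have z: "fst z \<in> carrier (D (p, Suc (Suc m)))" "snd z \<in> carrier (D (Suc p, Suc m))"
      "dh (Suc p) (Suc m) (snd z) \<oplus>\<^bsub>D (p, Suc m)\<^esub> dv p (Suc (Suc m)) (fst z) = x (p, Suc m)"
      using P m by (simp_all add: P_def Suc_diff_le)
    have xs: "x (Suc p, m) \<in> carrier (D (Suc p, m))" "x (p, Suc m) \<in> carrier (D (p, Suc m))"
      using xc m by simp_all
    \<comment> \<open>The value that \<open>dh\<close> must take on the next entry.\<close>
    let ?w = "x (Suc p, m) \<ominus>\<^bsub>D (Suc p, m)\<^esub> dv (Suc p) (Suc m) (snd z)"
    have wc: "?w \<in> carrier (D (Suc p, m))" using xs z by simp
    \<comment> \<open>Applying \<open>dv\<close> to the equation in column \<open>p\<close> and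
      anticommuting, \<open>dh (dv (snd z))\<close> is the negative of
      \<open>dv (x (p, Suc m))\<close>. By the cycle condition so is
      \<open>dh (x (Suc p, m))\<close>; hence \<open>dh\<close> kills \<open>?w\<close>.\<close>
    have "dv p (Suc m) (dh (Suc p) (Suc m) (snd z)) = dv p (Suc m) (x (p, Suc m))"
      using arg_cong[OF z(3), of "dv p (Suc m)"] z(1,2) by simp
    then have "dh (Suc p) m (dv (Suc p) (Suc m) (snd z)) \<oplus>\<^bsub>D (p, m)\<^esub> dv p (Suc m) (x (p, Suc m)) = \<zero>\<^bsub>D (p, m)\<^esub>"
      using dh_dv[OF z(2)] by simp
    moreover have "dh (Suc p) m (x (Suc p, m)) \<oplus>\<^bsub>D (p, m)\<^esub> dv p (Suc m) (x (p, Suc m)) = \<zero>\<^bsub>D (p, m)\<^esub>"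
      using xd m by simp
    ultimately have "dh (Suc p) m (x (Suc p, m)) = dh (Suc p) m (dv (Suc p) (Suc m) (snd z))"
      using xs z(2) by (metis E.M.add.inv_equality E.M.minus_minus linear_maps_closed[OF dh] linear_maps_closed[OF dv])
    then have "dh (Suc p) m ?w = \<zero>\<^bsub>D (p, m)\<^esub>"
      using xs z(2) by (simp add: linear_map.neg[OF dh_map] a_minus_def E.M.r_neg)
    with exact[OF wc] obtain w where w: "w \<in> carrier (D (Suc (Suc p), m))" "dh (Suc (Suc p)) m w = ?w"
      by blast
    then have "dh (Suc (Suc p)) m w \<oplus>\<^bsub>D (Suc p, m)\<^esub> dv (Suc p) (Suc m) (snd z) = x (Suc p, m)"
      using xs z(2) by (simp add: a_minus_def F.M.a_assoc F.M.l_neg)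
    then show ?thesis using z(2) m w(1) by (intro exI[of _ "(snd z, w)"]) (simp add: P_def Suc_diff_le)
  qed
  ultimately obtain f where f: "\<And>p. P p (f p)" "\<And>p. fst (f (Suc p)) = snd (f p)"
    using dependent_nat_choice[of P "\<lambda>p z z'. fst z' = snd z"] by blast
  define u where "u = restrict (\<lambda>(p, q). fst (f p)) {(p, q). p + q = Suc n}"
  have u: "u (p, q) = fst (f p)" if "p + q = Suc n" for p q using that by (simp add: u_def)
  have "fst (f p) \<in> carrier (D (p, q))" if "p + q = Suc n" for p q
  proof -
    have "q = Suc n - p" "p \<le> Suc n" using that by auto
    then show ?thesis using f(1)[of p] by (simp add: P_def)
  qed
  then have "u \<in> carrier (total (Suc n))" by (simp add: total_carrier u) (simp add: u_def)
  moreover have "total_d (Suc n) u = x"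
  proof (rule total_eqI[OF total_d_ext])
    show "x \<in> extensional {(p, q). p + q = n}" using x by (simp add: cycles_def total_carrier)
    fix p q assume pq: "p + q = n"
    then have "P p (f p)" "n - p = q" "Suc n - p = Suc q" "p \<le> n" using f(1) by auto
    then show "total_d (Suc n) u (p, q) = x (p, q)"
      using pq by (simp add: total_d u P_def f(2))
  qed
  ultimately show ?thesis by (auto simp: boundaries_def)
qed

theorem total_coker_isomorphic:
  "linearly_isomorphic K (homology total total_d n) (homology coker coker_d n)"
proof (rule homology_linearly_isomorphic[OF total_complex coker_complex])
  interpret M: module K "D (0, n)" by (rule D)
  note coset = M.coset_eq_self_iff[OF null_submodule]
  let ?f = "\<lambda>x. null n +>\<^bsub>D (0, n)\<^esub> x (0, n)"
  have "(\<lambda>x. x (0, n)) \<in> linear_maps K (total n) (D (0, n))"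
    by (rule linear_mapsI) (auto simp: total_carrier total_add total_smult)
  from linear_maps_comp[OF this coker_proj_linear]
  show "?f \<in> linear_maps K (total n) (coker n)" .
  \<comment> \<open>A coset is a cycle exactly if \<open>dv\<close> of a representative is a
    horizontal boundary, which is the hypothesis of \<open>extend_cycle\<close>; in degree 0 nothing
    is asked.\<close>
  have cyc: "null n +>\<^bsub>D (0, n)\<^esub> y \<in> cycles coker coker_d n \<longleftrightarrow> (\<forall>m. n = Suc m \<longrightarrow> dv 0 n y \<in> null m)"
    if "y \<in> carrier (D (0, n))" for y
    using that module.coset_eq_self_iff[OF D null_submodule]
    by (cases n) (auto simp: cycles_def coker_carrier coker_d_coset coker_zero)
  show "?f ` cycles total total_d n = cycles coker coker_d n"
  proof (intro equalityI subsetI)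
    fix X assume "X \<in> cycles coker coker_d n"
    moreover from this obtain y where y: "y \<in> carrier (D (0, n))" "X = null n +>\<^bsub>D (0, n)\<^esub> y"
      by (auto simp: cycles_def coker_carrier)
    ultimately have "\<And>m. n = Suc m \<Longrightarrow> dv 0 n y \<in> null m" using cyc by blast
    from extend_cycle[OF y(1) this] obtain x where "x \<in> cycles total total_d n" "x (0, n) = y" .
    with y show "X \<in> ?f ` cycles total total_d n" by force
  next
    fix X assume "X \<in> ?f ` cycles total total_d n"
    then obtain x where x: "x \<in> cycles total total_d n" "X = ?f x" by blast
    have xc: "x (p, q) \<in> carrier (D (p, q))" if "p + q = n" for p q
      using x(1) that by (auto simp: cycles_def total_carrier)
    have "dv 0 n (x (0, n)) \<in> null m" if m: "n = Suc m" for m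
    proof -
      interpret module K "D (0, m)" by (rule D)
      have "total_d n x = \<zero>\<^bsub>total m\<^esub>" using x(1) m by (auto simp: cycles_def)
      then have "total_d (Suc m) x (0, m) = \<zero>\<^bsub>total m\<^esub> (0, m)" using m by simp
      then have eq: "dh (Suc 0) m (x (Suc 0, m)) \<oplus>\<^bsub>D (0, m)\<^esub> dv 0 (Suc m) (x (0, Suc m)) = \<zero>\<^bsub>D (0, m)\<^esub>"
        by (simp add: total_d total_zero)
      have xs: "x (Suc 0, m) \<in> carrier (D (Suc 0, m))" "x (0, Suc m) \<in> carrier (D (0, Suc m))"
        using xc m by simp_all
      \<comment> \<open>The component at \<open>(0, m)\<close> of the cycle equation shows that this
        vertical boundary is horizontal.\<close>
      have "dv 0 (Suc m) (x (0, Suc m)) = \<ominus>\<^bsub>D (0, m)\<^esub> dh (Suc 0) m (x (Suc 0, m))"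
        using eq xs M.minus_equality[of "dv 0 (Suc m) (x (0, Suc m))" "dh (Suc 0) m (x (Suc 0, m))"]
        by (simp add: a_comm)
      moreover have "dh (Suc 0) m (x (Suc 0, m)) \<in> null m" using xs by (simp add: null_def)
      ultimately show ?thesis using submoduleE(3)[OF null_submodule] m by simp
    qed
    with cyc xc x(2) show "X \<in> cycles coker coker_d n" by simp
  qed
  fix x assume x: "x \<in> cycles total total_d n"
  then have x0: "x (0, n) \<in> carrier (D (0, n))" by (auto simp: cycles_def total_carrier)
  show "?f x \<in> boundaries coker coker_d n \<longleftrightarrow> x \<in> boundaries total total_d n"
  proof
    assume "x \<in> boundaries total total_d n"
    then obtain u where u: "u \<in> carrier (total (Suc n))" "x = total_d (Suc n) u"
      by (auto simp: boundaries_def)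
    then have uc: "u (Suc 0, n) \<in> carrier (D (Suc 0, n))" "u (0, Suc n) \<in> carrier (D (0, Suc n))"
      by (auto simp: total_carrier)
    have "x (0, n) = dh (Suc 0) n (u (Suc 0, n)) \<oplus>\<^bsub>D (0, n)\<^esub> dv 0 (Suc n) (u (0, Suc n))"
      using u(2) by (simp add: total_d)
    then have "x (0, n) \<ominus>\<^bsub>D (0, n)\<^esub> dv 0 (Suc n) (u (0, Suc n)) = dh (Suc 0) n (u (Suc 0, n))"
      using uc by (simp add: a_minus_def M.a_assoc M.r_neg)
    moreover have "dh (Suc 0) n (u (Suc 0, n)) \<in> null n" using uc by (simp add: null_def)
    ultimately have "?f x = null n +>\<^bsub>D (0, n)\<^esub> dv 0 (Suc n) (u (0, Suc n))"
      using uc x0 by (simp add: M.coset_eq_iff[OF null_submodule])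
    also have "\<dots> = coker_d (Suc n) (null (Suc n) +>\<^bsub>D (0, Suc n)\<^esub> u (0, Suc n))"
      using uc by (simp add: coker_d_coset)
    finally show "?f x \<in> boundaries coker coker_d n"
      using uc by (auto simp: boundaries_def coker_carrier)
  next
    assume "?f x \<in> boundaries coker coker_d n"
    then obtain y where y: "y \<in> carrier (D (0, Suc n))"
      "?f x = coker_d (Suc n) (null (Suc n) +>\<^bsub>D (0, Suc n)\<^esub> y)"
      by (auto simp: boundaries_def coker_carrier)
    \<comment> \<open>Equality of cosets supplies \<open>w\<close> in column 1, and the pair
      \<open>y\<close>, \<open>w\<close> starts the chase in \<open>extend_boundary\<close>.\<close>
    then have "x (0, n) \<ominus>\<^bsub>D (0, n)\<^esub> dv 0 (Suc n) y \<in> null n"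
      using x0 by (simp add: coker_d_coset M.coset_eq_iff[OF null_submodule])
    then obtain w where w: "w \<in> carrier (D (1, n))" "x (0, n) \<ominus>\<^bsub>D (0, n)\<^esub> dv 0 (Suc n) y = dh 1 n w"
      by (auto simp: null_def)
    then have "dh 1 n w \<oplus>\<^bsub>D (0, n)\<^esub> dv 0 (Suc n) y = x (0, n)"
      unfolding w(2)[symmetric] using x0 y(1) by (simp add: a_minus_def M.a_assoc M.l_neg)
    with extend_boundary[OF x y(1) w(1)] show "x \<in> boundaries total total_d n" .
  qed
qed

end

section \<open>Cyclic operators\<close>

context
  fixes K :: "('k, 'r) ring_scheme" and V :: "('k, 'v, 'm) module_scheme"
    and W :: "('k, 'w, 'n) module_scheme"
  assumes W: "module K W"
begin

interpretation W: module K W by (rule W)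

lemma linear_maps_plus:
  assumes "f \<in> linear_maps K V W" "g \<in> linear_maps K V W"
  shows "(\<lambda>x. f x \<oplus>\<^bsub>W\<^esub> g x) \<in> linear_maps K V W"
  by (rule linear_mapsI)
    (use assms in \<open>simp_all add: linear_maps_closed linear_maps_add linear_maps_smult W.M.a_ac W.smult_r_distr\<close>)

lemma linear_maps_neg:
  assumes "f \<in> linear_maps K V W"
  shows "(\<lambda>x. \<ominus>\<^bsub>W\<^esub> f x) \<in> linear_maps K V W"
  by (rule linear_mapsI)
    (use assms in \<open>simp_all add: linear_maps_closed linear_maps_add linear_maps_smult W.M.minus_add W.smult_r_minus\<close>)

lemma linear_maps_scale:
  assumes "f \<in> linear_maps K V W" "c \<in> carrier K"
  shows "(\<lambda>x. c \<odot>\<^bsub>W\<^esub> f x) \<in> linear_maps K V W"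
  by (rule linear_mapsI)
    (use assms in \<open>simp_all add: linear_maps_closed linear_maps_add linear_maps_smult W.smult_r_distr
      W.smult_assoc1[symmetric] W.R.m_comm\<close>)

lemma linear_maps_zero: "(\<lambda>x. \<zero>\<^bsub>W\<^esub>) \<in> linear_maps K V W"
  by (rule linear_mapsI) simp_all

lemma linear_maps_finsum:
  assumes "\<And>i. i \<in> I \<Longrightarrow> f i \<in> linear_maps K V W"
  shows "(\<lambda>x. \<Oplus>\<^bsub>W\<^esub>i\<in>I. f i x) \<in> linear_maps K V W"
proof (cases "finite I")
  case True
  have closed: "f i x \<in> carrier W" if "i \<in> I" "x \<in> carrier V" for i x
    using assms that by (blast intro: linear_maps_closed)
  show ?thesis
  proof (rule linear_mapsI)
    fix x assume x: "x \<in> carrier V"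
    then show "(\<Oplus>\<^bsub>W\<^esub>i\<in>I. f i x) \<in> carrier W" using closed by (intro W.M.finsum_closed) auto
    show "(\<Oplus>\<^bsub>W\<^esub>i\<in>I. f i (c \<odot>\<^bsub>V\<^esub> x)) = c \<odot>\<^bsub>W\<^esub> (\<Oplus>\<^bsub>W\<^esub>i\<in>I. f i x)" if c: "c \<in> carrier K" for c
    proof -
      have "(\<Oplus>\<^bsub>W\<^esub>i\<in>I. f i (c \<odot>\<^bsub>V\<^esub> x)) = (\<Oplus>\<^bsub>W\<^esub>i\<in>I. c \<odot>\<^bsub>W\<^esub> f i x)"
        using closed x c by (intro W.M.finsum_cong' refl linear_maps_smult[OF assms]) auto
      also have "\<dots> = c \<odot>\<^bsub>W\<^esub> (\<Oplus>\<^bsub>W\<^esub>i\<in>I. f i x)"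
        using closed x c True by (intro W.finsum_smult_ldistr[symmetric]) auto
      finally show ?thesis .
    qed
    fix y assume y: "y \<in> carrier V"
    have "(\<Oplus>\<^bsub>W\<^esub>i\<in>I. f i (x \<oplus>\<^bsub>V\<^esub> y)) = (\<Oplus>\<^bsub>W\<^esub>i\<in>I. f i x \<oplus>\<^bsub>W\<^esub> f i y)"
      using closed x y by (intro W.M.finsum_cong' refl linear_maps_add[OF assms]) auto
    also have "\<dots> = (\<Oplus>\<^bsub>W\<^esub>i\<in>I. f i x) \<oplus>\<^bsub>W\<^esub> (\<Oplus>\<^bsub>W\<^esub>i\<in>I. f i y)"
      using closed x y by (intro W.M.finsum_addf) auto
    finally show "(\<Oplus>\<^bsub>W\<^esub>i\<in>I. f i (x \<oplus>\<^bsub>V\<^esub> y)) = (\<Oplus>\<^bsub>W\<^esub>i\<in>I. f i x) \<oplus>\<^bsub>W\<^esub> (\<Oplus>\<^bsub>W\<^esub>i\<in>I. f i y)" .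
  qed
qed (simp add: linear_maps_zero)

end

lemma linear_maps_funpow:
  assumes "f \<in> linear_maps K V V"
  shows "f ^^ j \<in> linear_maps K V V"
proof (induction j)
  case 0
  then show ?case by (simp add: id_def linear_maps_id)
next
  case (Suc j)
  from linear_maps_comp[OF Suc assms] show ?case by (simp add: comp_def)
qed

section \<open>Double sums and cancellation in pairs\<close>

lemma (in abelian_monoid) finsum_Sigma:
  assumes "finite A" "finite B" "\<And>i j. \<lbrakk>i \<in> A; j \<in> B\<rbrakk> \<Longrightarrow> g i j \<in> carrier G"
  shows "(\<Oplus>p\<in>A \<times> B. g (fst p) (snd p)) = (\<Oplus>i\<in>A. \<Oplus>j\<in>B. g i j)"
  using assms(1,3)
proof (induction A)
  case (insert a A)
  have "(\<Oplus>p\<in>insert a A \<times> B. g (fst p) (snd p)) = (\<Oplus>p\<in>(Pair a ` B) \<union> A \<times> B. g (fst p) (snd p))"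
    by (rule arg_cong[of _ _ "finsum G _"]) auto
  also have "\<dots> = (\<Oplus>p\<in>Pair a ` B. g (fst p) (snd p)) \<oplus> (\<Oplus>p\<in>A \<times> B. g (fst p) (snd p))"
    using insert assms(2) by (intro finsum_Un_disjoint) auto
  also have "(\<Oplus>p\<in>Pair a ` B. g (fst p) (snd p)) = (\<Oplus>j\<in>B. g a j)"
    using insert.prems by (subst finsum_reindex) (auto simp: inj_on_def)
  also have "(\<Oplus>p\<in>A \<times> B. g (fst p) (snd p)) = (\<Oplus>i\<in>A. \<Oplus>j\<in>B. g i j)"
    using insert by blast
  also have "(\<Oplus>j\<in>B. g a j) \<oplus> (\<Oplus>i\<in>A. \<Oplus>j\<in>B. g i j) = (\<Oplus>i\<in>insert a A. \<Oplus>j\<in>B. g i j)"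
    using insert by (intro finsum_insert[symmetric]) auto
  finally show ?case .
qed simp

lemma (in abelian_group) simplicial_finsum_cancel:
  assumes g: "\<And>i j. \<lbrakk>i \<le> m; j \<le> Suc m\<rbrakk> \<Longrightarrow> g i j \<in> carrier G"
    and anti: "\<And>i j. \<lbrakk>i < j; j \<le> Suc m\<rbrakk> \<Longrightarrow> g i j = \<ominus> g (j - 1) i"
  shows "(\<Oplus>i\<in>{..m}. \<Oplus>j\<in>{..Suc m}. g i j) = \<zero>"
proof -
  let ?g = "\<lambda>p. g (fst p) (snd p)"
  define S where "S = {(i, j). j \<le> i \<and> i \<le> m}"
  \<comment> \<open>Matches the pairs \<open>(i, j)\<close> with \<open>j \<le> i\<close>
    bijectively with those with \<open>i < j\<close>; by \<open>anti\<close> the term at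
    \<open>h p\<close> is the negative of the term at \<open>p\<close>.\<close>
  define h where "h p = (snd p, Suc (fst p))" for p :: "nat \<times> nat"
  have fin: "finite S" by (rule finite_subset[of _ "{..m} \<times> {..m}"]) (auto simp: S_def)
  have gS: "?g \<in> S \<rightarrow> carrier G" and gh: "?g \<in> h ` S \<rightarrow> carrier G"
    using g by (auto simp: S_def h_def)
  have inj: "inj_on h S" by (auto simp: inj_on_def h_def)
  have un: "{..m} \<times> {..Suc m} = S \<union> h ` S"
  proof (intro equalityI subsetI)
    fix p assume "p \<in> {..m} \<times> {..Suc m}"
    then obtain i j where p: "p = (i, j)" "i \<le> m" "j \<le> Suc m" by auto
    show "p \<in> S \<union> h ` S"
    proof (cases "i < j")
      case True
      have "p \<in> h ` S"
        by (rule image_eqI[of _ _ "(j - 1, i)"]) (use p True in \<open>auto simp: S_def h_def\<close>)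
      then show ?thesis by blast
    qed (use p in \<open>simp add: S_def\<close>)
  qed (auto simp: S_def h_def)
  have "(\<Oplus>i\<in>{..m}. \<Oplus>j\<in>{..Suc m}. g i j) = (\<Oplus>p\<in>S \<union> h ` S. ?g p)"
    unfolding un[symmetric] using g by (intro finsum_Sigma[symmetric]) auto
  also have "\<dots> = (\<Oplus>p\<in>S. ?g p) \<oplus> (\<Oplus>p\<in>h ` S. ?g p)"
    using fin gS gh by (intro finsum_Un_disjoint) (auto simp: S_def h_def)
  also have "(\<Oplus>p\<in>h ` S. ?g p) = (\<Oplus>p\<in>S. ?g (h p))"
    by (rule finsum_reindex[OF gh inj])
  also have "(\<Oplus>p\<in>S. ?g (h p)) = (\<Oplus>p\<in>S. \<ominus> ?g p)"
  proof (rule finsum_cong')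
    fix p assume "p \<in> S"
    then show "?g (h p) = \<ominus> ?g p"
      using anti[of "snd p" "Suc (fst p)"] by (auto simp: S_def h_def)
  qed (use gS in auto)
  also have "(\<Oplus>p\<in>S. ?g p) \<oplus> (\<Oplus>p\<in>S. \<ominus> ?g p) = (\<Oplus>p\<in>S. ?g p \<oplus> \<ominus> ?g p)"
    using gS by (intro finsum_addf[symmetric]) auto
  also have "\<dots> = (\<Oplus>p\<in>S. \<zero>)"
    by (intro finsum_cong' refl) (use r_neg[OF funcset_mem[OF gS]] in auto)
  finally show ?thesis by simp
qed

text \<open>Applied to a vector fixed by t, this makes \<open>N\<close> multiplication by n + 1. A
  sum of ones is the form in which \<open>inverse_Suc\<close> inverts that scalar.\<close>

lemma (in module) finsum_const_eq_smult:
  "x \<in> carrier M \<Longrightarrow> (\<Oplus>\<^bsub>M\<^esub>i\<in>I. x) = (\<Oplus>\<^bsub>R\<^esub>i\<in>I. \<one>) \<odot>\<^bsub>M\<^esub> x"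
  by (induction I rule: infinite_finite_induct) (auto simp: smult_l_distr)

text \<open>
  \<open>\<delta> n i\<close> is the \<open>i\<close>-th face map \<open>C (n + 1) \<rightarrow> C n\<close> multiplied by \<open>(-1)\<^sup>i\<close>. The relation
  \<open>face_face\<close> is only required of the faces other than the last one, whose relations follow
  from \<open>face_t\<close> and \<open>face_zero_t\<close>.
\<close>

locale cyclic_operators = cring K for K (structure) +
  fixes C :: "nat \<Rightarrow> ('k, 'v, 'm) module_scheme"
    and \<delta> :: "nat \<Rightarrow> nat \<Rightarrow> 'v \<Rightarrow> 'v" and t :: "nat \<Rightarrow> 'v \<Rightarrow> 'v"
  assumes C: "module K (C n)"
    and face: "i \<le> Suc n \<Longrightarrow> \<delta> n i \<in> linear_maps K (C (Suc n)) (C n)"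
    and t: "t n \<in> linear_maps K (C n) (C n)"
    and face_face: "\<lbrakk>i < j; j \<le> Suc n; x \<in> carrier (C (Suc (Suc n)))\<rbrakk> \<Longrightarrow>
      \<delta> n i (\<delta> (Suc n) j x) = \<ominus>\<^bsub>C n\<^esub> \<delta> n (j - 1) (\<delta> (Suc n) i x)"
    and face_t: "\<lbrakk>i \<le> n; x \<in> carrier (C (Suc n))\<rbrakk> \<Longrightarrow> \<delta> n (Suc i) (t (Suc n) x) = t n (\<delta> n i x)"
    and face_zero_t: "x \<in> carrier (C (Suc n)) \<Longrightarrow> \<delta> n 0 (t (Suc n) x) = \<delta> n (Suc n) x"
    and t_pow: "x \<in> carrier (C n) \<Longrightarrow> (t n ^^ Suc n) x = x"
    and inverse_Suc: "\<exists>c\<in>carrier K. c \<otimes>\<^bsub>K\<^esub> (\<Oplus>\<^bsub>K\<^esub>i\<in>{..n :: nat}. \<one>\<^bsub>K\<^esub>) = \<one>\<^bsub>K\<^esub>"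
begin

definition b' :: "nat \<Rightarrow> 'v \<Rightarrow> 'v"
  where "b' n x = (\<Oplus>\<^bsub>C (n - 1)\<^esub>i\<in>{..<n}. \<delta> (n - 1) i x)"

definition b :: "nat \<Rightarrow> 'v \<Rightarrow> 'v"
  where "b n x = b' n x \<oplus>\<^bsub>C (n - 1)\<^esub> \<delta> (n - 1) n x"

definition id_minus_t :: "nat \<Rightarrow> 'v \<Rightarrow> 'v"
  where "id_minus_t n x = x \<ominus>\<^bsub>C n\<^esub> t n x"

definition N :: "nat \<Rightarrow> 'v \<Rightarrow> 'v"
  where "N n x = (\<Oplus>\<^bsub>C n\<^esub>j\<in>{..n}. (t n ^^ j) x)"

lemmas C_group [simp] = module.axioms(2)[OF C]
lemmas C_monoid [simp] = abelian_group.axioms(1)[OF C_group]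

lemma face_closed [simp]: "\<lbrakk>i \<le> Suc n; x \<in> carrier (C (Suc n))\<rbrakk> \<Longrightarrow> \<delta> n i x \<in> carrier (C n)"
  by (rule linear_maps_closed[OF face])

lemma t_closed [simp]: "x \<in> carrier (C n) \<Longrightarrow> t n x \<in> carrier (C n)"
  by (rule linear_maps_closed[OF t])

lemma t_funpow_linear: "t n ^^ j \<in> linear_maps K (C n) (C n)"
  by (rule linear_maps_funpow[OF t])

lemma t_funpow_closed [simp]: "x \<in> carrier (C n) \<Longrightarrow> (t n ^^ j) x \<in> carrier (C n)"
  by (rule linear_maps_closed[OF t_funpow_linear])

lemma face_map: "i \<le> Suc n \<Longrightarrow> linear_map K (C (Suc n)) (C n) (\<delta> n i)"
  and t_map: "linear_map K (C n) (C n) (t n)"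
  and t_funpow_map: "linear_map K (C n) (C n) (t n ^^ j)"
  by (simp_all add: linear_map_def linear_map_axioms_def C face t t_funpow_linear)

lemma b'_Suc: "b' (Suc n) = (\<lambda>x. \<Oplus>\<^bsub>C n\<^esub>i\<in>{..n}. \<delta> n i x)"
  by (simp add: b'_def lessThan_Suc_atMost fun_eq_iff)

lemma b_Suc:
  assumes "x \<in> carrier (C (Suc n))"
  shows "b (Suc n) x = (\<Oplus>\<^bsub>C n\<^esub>i\<in>{..Suc n}. \<delta> n i x)"
proof -
  interpret module K "C n" by (rule C)
  have "(\<Oplus>\<^bsub>C n\<^esub>i\<in>{..Suc n}. \<delta> n i x) = \<delta> n (Suc n) x \<oplus>\<^bsub>C n\<^esub> (\<Oplus>\<^bsub>C n\<^esub>i\<in>{..n}. \<delta> n i x)"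
    using assms by (intro M.finsum_Suc) auto
  then show ?thesis
    using assms by (simp add: b_def b'_Suc M.a_comm)
qed

lemma b'_linear: "b' (Suc n) \<in> linear_maps K (C (Suc n)) (C n)"
  unfolding b'_Suc by (intro linear_maps_finsum C face) auto

lemma b_linear: "b (Suc n) \<in> linear_maps K (C (Suc n)) (C n)"
proof -
  have "b (Suc n) = (\<lambda>x. b' (Suc n) x \<oplus>\<^bsub>C n\<^esub> \<delta> n (Suc n) x)"
    by (simp add: b_def fun_eq_iff)
  then show ?thesis by (simp add: linear_maps_plus[OF C b'_linear face])
qed

lemma id_minus_t_linear: "id_minus_t n \<in> linear_maps K (C n) (C n)"
  unfolding id_minus_t_def a_minus_def
  by (intro linear_maps_plus linear_maps_neg linear_maps_id C t)

lemma N_linear: "N n \<in> linear_maps K (C n) (C n)"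
  unfolding N_def by (intro linear_maps_finsum C t_funpow_linear)

text \<open>The last face is the face 0 after t. So a relation with the last face at
  \<open>x\<close> is a relation between earlier faces at a rotation of \<open>x\<close>, and those
  are known.\<close>

lemma face_face_last:
  assumes ij: "i < j" "j \<le> Suc (Suc n)" and x: "x \<in> carrier (C (Suc (Suc n)))"
  shows "\<delta> n i (\<delta> (Suc n) j x) = \<ominus>\<^bsub>C n\<^esub> \<delta> n (j - 1) (\<delta> (Suc n) i x)"
proof -
  interpret module K "C n" by (rule C)
  consider "j \<le> Suc n" | "j = Suc (Suc n)" "i \<le> n" | "j = Suc (Suc n)" "i = Suc n"
    using ij by linarith
  then show ?thesis
  proof cases
    case 1
    then show ?thesis using face_face ij x by blast
  next
    case 2
    \<comment> \<open>One rotation suffices: it moves face \<open>i\<close> to face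
      \<open>Suc i\<close> and the last face to face 0, so the known relation is the one for
      \<open>0 < Suc i\<close>.\<close>
    let ?tx = "t (Suc (Suc n)) x"
    have "\<delta> n 0 (\<delta> (Suc n) (Suc i) ?tx) = \<ominus>\<^bsub>C n\<^esub> \<delta> n i (\<delta> (Suc n) 0 ?tx)"
      using face_face[of 0 "Suc i" n ?tx] 2 x by simp
    moreover have "\<delta> n 0 (\<delta> (Suc n) (Suc i) ?tx) = \<delta> n (Suc n) (\<delta> (Suc n) i x)"
      using 2 x by (simp add: face_t face_zero_t)
    ultimately show ?thesis
      using 2 x by (simp add: face_zero_t)
  next
    case 3
    \<comment> \<open>Both faces on the left are last faces, so two rotations are needed, and the
      known relation is the one for \<open>0 < 1\<close>.\<close>
    let ?ttx = "t (Suc (Suc n)) (t (Suc (Suc n)) x)"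
    have "\<delta> n (Suc n) (\<delta> (Suc n) j x) = \<delta> n 0 (\<delta> (Suc n) 1 ?ttx)"
      using 3 x by (simp add: face_zero_t[symmetric] face_t)
    also have "\<dots> = \<ominus>\<^bsub>C n\<^esub> \<delta> n 0 (\<delta> (Suc n) 0 ?ttx)"
      using face_face[of 0 1 n ?ttx] x by simp
    also have "\<delta> n 0 (\<delta> (Suc n) 0 ?ttx) = \<delta> n (Suc n) (\<delta> (Suc n) (Suc n) x)"
      using face_zero_t[of "\<delta> (Suc n) (Suc n) x" n] face_t[of "Suc n" "Suc n" x]
        face_zero_t[of "t (Suc (Suc n)) x" "Suc n"] x by simp
    finally show ?thesis using 3 by simp
  qed
qed

text \<open>The choice \<open>m = n\<close> squares \<open>b'\<close>, the choice
  \<open>m = Suc n\<close> squares \<open>b\<close>; in both the inner sum has one face more than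
  the outer one.\<close>

lemma double_face_sum:
  assumes "x \<in> carrier (C (Suc (Suc n)))" "m = n \<or> m = Suc n"
  shows "(\<Oplus>\<^bsub>C n\<^esub>i\<in>{..m}. \<delta> n i (\<Oplus>\<^bsub>C (Suc n)\<^esub>j\<in>{..Suc m}. \<delta> (Suc n) j x)) = \<zero>\<^bsub>C n\<^esub>"
proof -
  interpret module K "C n" by (rule C)
  have "(\<Oplus>\<^bsub>C n\<^esub>i\<in>{..m}. \<delta> n i (\<Oplus>\<^bsub>C (Suc n)\<^esub>j\<in>{..Suc m}. \<delta> (Suc n) j x)) =
    (\<Oplus>\<^bsub>C n\<^esub>i\<in>{..m}. \<Oplus>\<^bsub>C n\<^esub>j\<in>{..Suc m}. \<delta> n i (\<delta> (Suc n) j x))"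
    using assms
    by (intro M.finsum_cong' refl M.finsum_closed linear_map.finsum[OF face_map] Pi_I face_closed) auto
  also have "\<dots> = \<zero>\<^bsub>C n\<^esub>"
    using assms by (intro M.simplicial_finsum_cancel face_face_last face_closed) auto
  finally show ?thesis .
qed

lemma b'_b': "x \<in> carrier (C (Suc (Suc n))) \<Longrightarrow> b' (Suc n) (b' (Suc (Suc n)) x) = \<zero>\<^bsub>C n\<^esub>"
  using double_face_sum[of x n n] by (simp add: b'_Suc)

lemma b_b: "x \<in> carrier (C (Suc (Suc n))) \<Longrightarrow> b (Suc n) (b (Suc (Suc n)) x) = \<zero>\<^bsub>C n\<^esub>"
  using double_face_sum[of x n "Suc n"] linear_maps_closed[OF b_linear, of x "Suc n"]
  by (simp only: b_Suc) simp

text \<open>Faces 1 to n + 1 of the rotated element are the rotated faces 0 to n, which make up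
  \<open>b'\<close>; its face 0 is left over and equals the last face of \<open>x\<close>.\<close>

lemma b_t:
  assumes x: "x \<in> carrier (C (Suc n))"
  shows "b (Suc n) (t (Suc n) x) = t n (b' (Suc n) x) \<oplus>\<^bsub>C n\<^esub> \<delta> n (Suc n) x"
proof -
  interpret module K "C n" by (rule C)
  have "b (Suc n) (t (Suc n) x) =
      (\<Oplus>\<^bsub>C n\<^esub>i\<in>{..n}. \<delta> n (Suc i) (t (Suc n) x)) \<oplus>\<^bsub>C n\<^esub> \<delta> n 0 (t (Suc n) x)"
    unfolding b_Suc[OF t_closed[OF x]] using x by (intro M.finsum_Suc2) auto
  also have "(\<Oplus>\<^bsub>C n\<^esub>i\<in>{..n}. \<delta> n (Suc i) (t (Suc n) x)) = (\<Oplus>\<^bsub>C n\<^esub>i\<in>{..n}. t n (\<delta> n i x))"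
    using x by (intro M.finsum_cong') (auto simp: face_t)
  also have "\<dots> = t n (b' (Suc n) x)"
    unfolding b'_Suc using x by (intro linear_map.finsum[OF t_map, symmetric]) auto
  finally show ?thesis using x by (simp add: face_zero_t)
qed

text \<open>The last face of \<open>x\<close> occurs both in \<open>b x\<close> and in
  \<open>b (t x)\<close>, and cancels.\<close>

lemma b_id_minus_t:
  assumes x: "x \<in> carrier (C (Suc n))"
  shows "b (Suc n) (id_minus_t (Suc n) x) = id_minus_t n (b' (Suc n) x)"
proof -
  interpret module K "C n" by (rule C)
  interpret b: linear_map K "C (Suc n)" "C n" "b (Suc n)"
    by (intro linear_map.intro linear_map_axioms.intro C b_linear)
  have c: "b' (Suc n) x \<in> carrier (C n)" by (rule linear_maps_closed[OF b'_linear x])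
  have "b (Suc n) (id_minus_t (Suc n) x) =
      (b' (Suc n) x \<oplus>\<^bsub>C n\<^esub> \<delta> n (Suc n) x) \<ominus>\<^bsub>C n\<^esub> (t n (b' (Suc n) x) \<oplus>\<^bsub>C n\<^esub> \<delta> n (Suc n) x)"
    using x by (simp add: id_minus_t_def b.minus b_t) (simp add: b_def)
  also have "\<dots> = b' (Suc n) x \<ominus>\<^bsub>C n\<^esub> t n (b' (Suc n) x) \<oplus>\<^bsub>C n\<^esub> (\<delta> n (Suc n) x \<ominus>\<^bsub>C n\<^esub> \<delta> n (Suc n) x)"
    using c x by (simp add: a_minus_def M.minus_add M.a_ac)
  also have "\<dots> = id_minus_t n (b' (Suc n) x)"
    using c x by (simp add: id_minus_t_def a_minus_def M.r_neg)
  finally show ?thesis .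
qed

lemma face_t_funpow:
  "\<lbrakk>j \<le> i; i \<le> Suc n; x \<in> carrier (C (Suc n))\<rbrakk> \<Longrightarrow> \<delta> n i ((t (Suc n) ^^ j) x) = (t n ^^ j) (\<delta> n (i - j) x)"
proof (induction j arbitrary: i)
  case (Suc j)
  then obtain k where k: "i = Suc k" by (cases i) auto
  with Suc show ?case by (simp add: face_t)
qed simp

text \<open>After \<open>i\<close> rotations the face index has dropped to 0. The next rotation
  turns face 0 into the last face without leaving a factor t, whence the exponent
  \<open>j - 1\<close>; the remaining \<open>l\<close> rotations lower the index
  \<open>Suc n\<close> by \<open>l\<close>.\<close>

lemma face_t_funpow_wrap:
  assumes "i < j" "j \<le> Suc n" and x: "x \<in> carrier (C (Suc n))"
  shows "\<delta> n i ((t (Suc n) ^^ j) x) = (t n ^^ (j - 1)) (\<delta> n (Suc (Suc n) + i - j) x)"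
proof -
  define l where "l = j - 1 - i"
  have j: "j = i + Suc l" "l \<le> Suc n" using assms by (auto simp: l_def)
  have "\<delta> n i ((t (Suc n) ^^ j) x) = \<delta> n i ((t (Suc n) ^^ i) (t (Suc n) ((t (Suc n) ^^ l) x)))"
    unfolding j funpow_add by simp
  also have "\<dots> = (t n ^^ i) (\<delta> n (Suc n) ((t (Suc n) ^^ l) x))"
    using assms by (subst face_t_funpow) (auto simp: face_zero_t)
  also have "\<dots> = (t n ^^ (i + l)) (\<delta> n (Suc n - l) x)"
    using j x by (subst face_t_funpow) (auto simp: funpow_add)
  finally show ?thesis using j by simp
qed

text \<open>Moving all rotations to the outside, each side becomes the sum of all terms "power of t
  after a face"; only the order of the terms differs.\<close>

lemma b'_N:
  assumes x: "x \<in> carrier (C (Suc n))"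
  shows "b' (Suc n) (N (Suc n) x) = N n (b (Suc n) x)"
proof -
  interpret module K "C n" by (rule C)
  let ?S = "{..n} \<times> {..Suc n}"
  \<comment> \<open>New exponent and face index as given by \<open>face_t_funpow\<close> and
    \<open>face_t_funpow_wrap\<close>. For \<open>(i, j)\<close> the coordinates add up to
    \<open>i\<close> in the first branch and to \<open>n + 1 + i\<close> in the second, so the
    branches do not collide.\<close>
  define \<phi> where "\<phi> p = (if snd p \<le> fst p then (snd p, fst p - snd p)
    else (snd p - 1, Suc (Suc n) + fst p - snd p))" for p :: "nat \<times> nat"
  let ?h = "\<lambda>p. (t n ^^ fst p) (\<delta> n (snd p) x)"
  have inj: "inj_on \<phi> ?S" by (auto simp: inj_on_def \<phi>_def split: if_splits)
  moreover have "\<phi> ` ?S \<subseteq> ?S" by (auto simp: \<phi>_def split: if_splits)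
  ultimately have surj: "\<phi> ` ?S = ?S" by (intro endo_inj_surj) auto
  have h: "?h \<in> ?S \<rightarrow> carrier (C n)" using x by auto
  have "b' (Suc n) (N (Suc n) x) = (\<Oplus>\<^bsub>C n\<^esub>i\<in>{..n}. \<Oplus>\<^bsub>C n\<^esub>j\<in>{..Suc n}. \<delta> n i ((t (Suc n) ^^ j) x))"
    unfolding b'_Suc N_def using x
    by (intro M.finsum_cong' refl linear_map.finsum[OF face_map] M.finsum_closed Pi_I face_closed t_funpow_closed) auto
  also have "\<dots> = (\<Oplus>\<^bsub>C n\<^esub>p\<in>?S. \<delta> n (fst p) ((t (Suc n) ^^ snd p) x))"
    using x by (intro M.finsum_Sigma[symmetric]) auto
  also have "\<dots> = (\<Oplus>\<^bsub>C n\<^esub>p\<in>?S. ?h (\<phi> p))"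
  proof (rule M.finsum_cong'[OF refl])
    show "(\<lambda>p. ?h (\<phi> p)) \<in> ?S \<rightarrow> carrier (C n)" using h surj by blast
    fix p assume "p \<in> ?S"
    then show "\<delta> n (fst p) ((t (Suc n) ^^ snd p) x) = ?h (\<phi> p)"
      using x by (auto simp: \<phi>_def face_t_funpow face_t_funpow_wrap)
  qed
  also have "\<dots> = (\<Oplus>\<^bsub>C n\<^esub>p\<in>?S. ?h p)"
    using M.finsum_reindex[of ?h \<phi> ?S] h inj surj by simp
  also have "\<dots> = (\<Oplus>\<^bsub>C n\<^esub>j\<in>{..n}. \<Oplus>\<^bsub>C n\<^esub>i\<in>{..Suc n}. (t n ^^ j) (\<delta> n i x))"
    using x by (intro M.finsum_Sigma) auto
  also have "\<dots> = N n (b (Suc n) x)"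
    unfolding b_Suc[OF x] N_def using x
    by (intro M.finsum_cong' refl linear_map.finsum[OF t_funpow_map, symmetric] M.finsum_closed Pi_I
        face_closed t_funpow_closed) auto
  finally show ?thesis .
qed

lemma t_N:
  assumes x: "x \<in> carrier (C n)"
  shows "t n (N n x) = N n x"
proof -
  interpret module K "C n" by (rule C)
  have Nc: "N n x \<in> carrier (C n)" by (rule linear_maps_closed[OF N_linear x])
  have "t n (N n x) = (\<Oplus>\<^bsub>C n\<^esub>j\<in>{..n}. (t n ^^ Suc j) x)"
    unfolding N_def using x by (subst linear_map.finsum[OF t_map]) auto
  \<comment> \<open>Adding \<open>x\<close> at either end of the sum gives all powers up to n + 1,
    the top one being \<open>x\<close> itself; then \<open>x\<close> is cancelled.\<close>
  then have "t n (N n x) \<oplus>\<^bsub>C n\<^esub> x = (\<Oplus>\<^bsub>C n\<^esub>j\<in>{..Suc n}. (t n ^^ j) x)"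
    using x by (subst M.finsum_Suc2) auto
  also have "\<dots> = x \<oplus>\<^bsub>C n\<^esub> N n x"
    using x t_pow[OF x] by (subst M.finsum_Suc) (auto simp: N_def simp del: funpow.simps)
  also have "\<dots> = N n x \<oplus>\<^bsub>C n\<^esub> x" using x Nc by (simp add: M.a_comm)
  finally show ?thesis using x Nc by (meson M.add.right_cancel t_closed)
qed

lemma N_t:
  assumes x: "x \<in> carrier (C n)"
  shows "N n (t n x) = N n x"
proof -
  interpret module K "C n" by (rule C)
  have "N n (t n x) = t n (N n x)"
    unfolding N_def using x by (subst linear_map.finsum[OF t_map]) (auto simp: funpow_swap1)
  then show ?thesis using t_N[OF x] by simp
qed

lemma id_minus_t_N: "x \<in> carrier (C n) \<Longrightarrow> id_minus_t n (N n x) = \<zero>\<^bsub>C n\<^esub>"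
  using linear_maps_closed[OF N_linear, of x n]
  by (simp add: id_minus_t_def t_N a_minus_def abelian_group.r_neg)

lemma N_id_minus_t: "x \<in> carrier (C n) \<Longrightarrow> N n (id_minus_t n x) = \<zero>\<^bsub>C n\<^esub>"
  using linear_map.minus[of K "C n" "C n" "N n" x "t n x"] linear_maps_closed[OF N_linear, of x n]
  by (simp add: id_minus_t_def N_t linear_map_def linear_map_axioms_def C N_linear a_minus_def
      abelian_group.r_neg)

text \<open>A vector in the kernel is fixed by t, so \<open>N\<close> multiplies it by n + 1;
  dividing by n + 1 gives the preimage.\<close>

lemma exact_id_minus_t:
  assumes x: "x \<in> carrier (C n)" and "id_minus_t n x = \<zero>\<^bsub>C n\<^esub>"
  shows "\<exists>y\<in>carrier (C n). N n y = x"
proof -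
  interpret module K "C n" by (rule C)
  obtain c where c: "c \<in> carrier K" "c \<otimes>\<^bsub>K\<^esub> (\<Oplus>\<^bsub>K\<^esub>i\<in>{..n}. \<one>\<^bsub>K\<^esub>) = \<one>\<^bsub>K\<^esub>"
    using inverse_Suc by blast
  have "t n x = x"
    using assms M.r_neg2[of "t n x" x] by (simp add: id_minus_t_def a_minus_def M.a_comm)
  then have "(t n ^^ j) x = x" for j by (induction j) auto
  then have "N n x = (\<Oplus>\<^bsub>K\<^esub>i\<in>{..n}. \<one>\<^bsub>K\<^esub>) \<odot>\<^bsub>C n\<^esub> x"
    unfolding N_def using x by (simp add: finsum_const_eq_smult)
  then have "N n (c \<odot>\<^bsub>C n\<^esub> x) = x"
    using x c by (simp add: linear_maps_smult[OF N_linear] flip: smult_assoc1)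
  then show ?thesis using x c by blast
qed

text \<open>Modulo the image \<open>I\<close> of Id - t, the operator t is the identity and
  \<open>N\<close> is multiplication by n + 1. As that is invertible, \<open>N x = 0\<close> forces
  \<open>x\<close> into \<open>I\<close>. Passing to the quotient avoids an explicit polynomial in t
  as preimage.\<close>

lemma exact_N:
  assumes x: "x \<in> carrier (C n)" and N: "N n x = \<zero>\<^bsub>C n\<^esub>"
  shows "\<exists>y\<in>carrier (C n). id_minus_t n y = x"
proof -
  interpret module K "C n" by (rule C)
  interpret D: linear_map K "C n" "C n" "id_minus_t n"
    by (intro linear_map.intro linear_map_axioms.intro C id_minus_t_linear)
  define I where "I = id_minus_t n ` carrier (C n)"
  have I: "submodule I K (C n)"
    unfolding I_def by (intro D.image_submodule carrier_is_submodule)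
  interpret Q: module K "quot_module (C n) I" by (rule quot_module_is_module[OF I])
  define \<pi> where "\<pi> y = I +>\<^bsub>C n\<^esub> y" for y
  interpret \<pi>: linear_map K "C n" "quot_module (C n) I" \<pi>
    unfolding linear_map_def linear_map_axioms_def
    using C Q.module_axioms quot_proj_linear[OF I] by (simp add: \<pi>_def[abs_def])
  obtain c where c: "c \<in> carrier K" "c \<otimes>\<^bsub>K\<^esub> (\<Oplus>\<^bsub>K\<^esub>i\<in>{..n}. \<one>\<^bsub>K\<^esub>) = \<one>\<^bsub>K\<^esub>"
    using inverse_Suc by blast
  have "id_minus_t n y \<in> I" if "y \<in> carrier (C n)" for y
    using that by (simp add: I_def)
  then have "\<pi> (t n y) = \<pi> y" if "y \<in> carrier (C n)" for y
    using that coset_eq_iff[OF I, of y "t n y"] by (simp add: \<pi>_def id_minus_t_def)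
  then have pow: "\<pi> ((t n ^^ j) x) = \<pi> x" for j
    using x by (induction j) auto
  have "\<zero>\<^bsub>quot_module (C n) I\<^esub> = \<pi> (N n x)" by (simp add: N \<pi>.zero)
  also have "\<dots> = (\<Oplus>\<^bsub>quot_module (C n) I\<^esub>j\<in>{..n}. \<pi> ((t n ^^ j) x))"
    unfolding N_def using x by (intro \<pi>.finsum) auto
  also have "\<dots> = (\<Oplus>\<^bsub>K\<^esub>i\<in>{..n}. \<one>\<^bsub>K\<^esub>) \<odot>\<^bsub>quot_module (C n) I\<^esub> \<pi> x"
    using x by (simp add: pow Q.finsum_const_eq_smult)
  finally have "c \<odot>\<^bsub>quot_module (C n) I\<^esub> ((\<Oplus>\<^bsub>K\<^esub>i\<in>{..n}. \<one>\<^bsub>K\<^esub>) \<odot>\<^bsub>quot_module (C n) I\<^esub> \<pi> x) =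
      \<zero>\<^bsub>quot_module (C n) I\<^esub>"
    using c(1) by (metis Q.smult_r_null)
  then have "\<pi> x = I" using x c by (simp add: zero_quot_module flip: Q.smult_assoc1)
  then have "x \<in> I" using x coset_eq_self_iff[OF I] by (simp add: \<pi>_def)
  then show ?thesis by (auto simp: I_def)
qed

text \<open>The minus sign of \<open>b'\<close> in the odd columns turns the two commutation rules
  \<open>b_id_minus_t\<close> and \<open>b'_N\<close> into anticommuting squares.\<close>

lemma bicomplex:
  "bicomplex K (\<lambda>(p, q). C q) (\<lambda>p q x. if odd p then id_minus_t q x else N q x)
    (\<lambda>p q x. if even p then b q x else \<ominus>\<^bsub>C (q - 1)\<^esub> b' q x)"
proof (intro bicomplex.intro bicomplex_axioms.intro is_cring; (unfold prod.case)?)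
  show "module K (case pq of (p, q) \<Rightarrow> C q)" for pq :: "nat \<times> nat"
    using C by (cases pq) simp
  fix p q
  show "(\<lambda>x. if odd (Suc p) then id_minus_t q x else N q x) \<in> linear_maps K (C q) (C q)"
    by (cases "odd p") (simp_all add: id_minus_t_linear N_linear)
  show "(\<lambda>x. if even p then b (Suc q) x else \<ominus>\<^bsub>C (Suc q - 1)\<^esub> b' (Suc q) x) \<in> linear_maps K (C (Suc q)) (C q)"
    by (cases "odd p") (simp_all add: b_linear linear_maps_neg[OF C b'_linear])
  fix x
  {
    assume "x \<in> carrier (C q)"
    then show "(if odd (Suc p) then id_minus_t q (if odd (Suc (Suc p)) then id_minus_t q x else N q x)
        else N q (if odd (Suc (Suc p)) then id_minus_t q x else N q x)) = \<zero>\<^bsub>C q\<^esub>"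
      by (simp add: id_minus_t_N N_id_minus_t)
  next
    assume x: "x \<in> carrier (C (Suc (Suc q)))"
    interpret b': linear_map K "C (Suc q)" "C q" "b' (Suc q)"
      by (intro linear_map.intro linear_map_axioms.intro C b'_linear)
    show "(if even p then b (Suc q) (if even p then b (Suc (Suc q)) x else \<ominus>\<^bsub>C (Suc (Suc q) - 1)\<^esub> b' (Suc (Suc q)) x)
        else \<ominus>\<^bsub>C (Suc q - 1)\<^esub> b' (Suc q) (if even p then b (Suc (Suc q)) x
          else \<ominus>\<^bsub>C (Suc (Suc q) - 1)\<^esub> b' (Suc (Suc q)) x)) = \<zero>\<^bsub>C q\<^esub>"
      using x linear_maps_closed[OF b'_linear x] by (simp add: b_b b'_b' b'.neg)
  next
    assume x: "x \<in> carrier (C (Suc q))"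
    interpret module K "C q" by (rule C)
    interpret D: linear_map K "C q" "C q" "id_minus_t q"
      by (intro linear_map.intro linear_map_axioms.intro C id_minus_t_linear)
    show "(if odd (Suc p) then id_minus_t q (if even (Suc p) then b (Suc q) x else \<ominus>\<^bsub>C (Suc q - 1)\<^esub> b' (Suc q) x)
         else N q (if even (Suc p) then b (Suc q) x else \<ominus>\<^bsub>C (Suc q - 1)\<^esub> b' (Suc q) x)) \<oplus>\<^bsub>C q\<^esub>
        (if even p then b (Suc q) (if odd (Suc p) then id_minus_t (Suc q) x else N (Suc q) x)
         else \<ominus>\<^bsub>C (Suc q - 1)\<^esub> b' (Suc q) (if odd (Suc p) then id_minus_t (Suc q) x else N (Suc q) x)) = \<zero>\<^bsub>C q\<^esub>"
      using x linear_maps_closed[OF b'_linear x] linear_maps_closed[OF N_linear linear_maps_closed[OF b_linear x]]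
      by (simp add: b_id_minus_t b'_N D.neg M.l_neg M.r_neg)
  next
    assume "x \<in> carrier (C q)" "(if odd (Suc p) then id_minus_t q x else N q x) = \<zero>\<^bsub>C q\<^esub>"
    then show "\<exists>y\<in>carrier (C q). (if odd (Suc (Suc p)) then id_minus_t q y else N q y) = x"
      using exact_id_minus_t exact_N by (cases "odd p") simp_all
  }
qed

end

section \<open>Free modules and tensor powers\<close>

lemma (in cring) self_module_is_module: "module R (self_module R)"
proof (rule moduleI)
  show "abelian_group (self_module R)"
    by (rule abelian_groupI) (auto simp: self_module_def a_ac intro!: bexI[of _ "\<ominus> _"] l_neg)
qed (auto simp: self_module_def l_distr r_distr m_assoc is_cring)

context cring
begin

lemma free_module_is_module: "module R (free_module R S)"
  unfolding free_module_def by (intro direct_sum_module_is_module self_module_is_module is_cring)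

lemma free_module_carrier:
  "x \<in> carrier (free_module R S) \<longleftrightarrow> x \<in> (\<Pi>\<^sub>E s\<in>S. carrier R) \<and> finite {s \<in> S. x s \<noteq> \<zero>}"
  by (simp add: free_module_def direct_sum_module_def self_module_def)

lemma free_module_add: "s \<in> S \<Longrightarrow> (x \<oplus>\<^bsub>free_module R S\<^esub> y) s = x s \<oplus> y s"
  and free_module_smult: "s \<in> S \<Longrightarrow> (c \<odot>\<^bsub>free_module R S\<^esub> x) s = c \<otimes> x s"
  and free_module_zero: "\<zero>\<^bsub>free_module R S\<^esub> = (\<lambda>s\<in>S. \<zero>)"
  by (simp_all add: free_module_def direct_sum_module_def self_module_def)

lemma free_gen_closed: "s \<in> S \<Longrightarrow> free_gen R S s \<in> carrier (free_module R S)"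
  unfolding free_module_carrier free_gen_def
  by (auto intro: finite_subset[of _ "{s}"] split: if_splits)

lemma free_module_induct:
  assumes H: "submodule H R (free_module R S)" and gen: "\<And>s. s \<in> S \<Longrightarrow> free_gen R S s \<in> H"
    and x: "x \<in> carrier (free_module R S)"
  shows "x \<in> H"
proof -
  interpret F: module R "free_module R S" by (rule free_module_is_module)
  \<comment> \<open>The induction runs over a finite set containing the support. Erasing the entry
    at \<open>a\<close> removes \<open>a\<close> from the support, and the erased part is a multiple
    of a generator.\<close>
  have "x \<in> H" if "finite T" "x \<in> carrier (free_module R S)" "{s \<in> S. x s \<noteq> \<zero>} \<subseteq> T" for T x
    using that
  proof (induction T arbitrary: x)
    case empty
    then have "x = \<zero>\<^bsub>free_module R S\<^esub>"
      by (intro extensionalityI[of _ S]) (auto simp: free_module_zero free_module_carrier PiE_iff)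
    then show ?case using F.submodule_zero[OF H] by simp
  next
    case (insert a T)
    show ?case
    proof (cases "a \<in> S")
      case False
      then show ?thesis using insert by blast
    next
      case True
      let ?y = "x(a := \<zero>)"
      have xa: "x a \<in> carrier R" using True insert.prems(1) by (auto simp: free_module_carrier)
      have y: "?y \<in> carrier (free_module R S)"
        using insert.prems(1) True unfolding free_module_carrier
        by (auto simp: PiE_iff extensional_def elim: rev_finite_subset)
      have sum: "x = x a \<odot>\<^bsub>free_module R S\<^esub> free_gen R S a \<oplus>\<^bsub>free_module R S\<^esub> ?y" (is "_ = ?z")
      proof (rule extensionalityI[of _ S])
        have "?z \<in> carrier (free_module R S)" using xa y True by (simp add: free_gen_closed)
        then show "?z \<in> extensional S" by (auto simp: free_module_carrier PiE_iff)
        show "x \<in> extensional S" using insert.prems(1) by (auto simp: free_module_carrier PiE_iff)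
        fix s assume "s \<in> S"
        moreover from this have "x s \<in> carrier R" using insert.prems(1) by (auto simp: free_module_carrier)
        ultimately show "x s = ?z s"
          using xa by (simp add: free_module_add free_module_smult free_gen_def)
      qed
      have "?y \<in> H" using insert.prems by (intro insert.IH[OF y]) auto
      then show ?thesis
        using F.submoduleE(4,5)[OF H] xa gen[OF True] sum by metis
    qed
  qed
  then show ?thesis using x by (auto simp: free_module_carrier)
qed

lemma free_module_lift:
  assumes W: "module R W" and f: "f \<in> S \<rightarrow> carrier W"
  obtains g where "g \<in> linear_maps R (free_module R S) W" "\<And>s. s \<in> S \<Longrightarrow> g (free_gen R S s) = f s"
proof -
  interpret W: module R W by (rule W)
  interpret F: module R "free_module R S" by (rule free_module_is_module)
  define supp where "supp x = {s \<in> S. x s \<noteq> \<zero>}" for x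
  define g where "g x = (\<Oplus>\<^bsub>W\<^esub>s\<in>supp x. x s \<odot>\<^bsub>W\<^esub> f s)" for x
  have xc: "x s \<in> carrier R" if "x \<in> carrier (free_module R S)" "s \<in> S" for x s
    using that by (auto simp: free_module_carrier)
  have fs: "f s \<in> carrier W" if "s \<in> S" for s using f that by blast
  have fin: "finite (supp x)" "supp x \<subseteq> S" if "x \<in> carrier (free_module R S)" for x
    using that by (auto simp: supp_def free_module_carrier)
  \<comment> \<open>The support of a sum or a multiple may be smaller than expected; allowing any
    finite \<open>T\<close> around the support lets both sides be summed over the same set.\<close>
  have g: "g x = (\<Oplus>\<^bsub>W\<^esub>s\<in>T. x s \<odot>\<^bsub>W\<^esub> f s)"
    if "x \<in> carrier (free_module R S)" "finite T" "supp x \<subseteq> T" "T \<subseteq> S" for x T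
    unfolding g_def using that xc fs
    by (intro W.M.add.finprod_mono_neutral_cong_left) (auto simp: supp_def)
  have "g \<in> linear_maps R (free_module R S) W"
  proof (rule linear_mapsI)
    fix x assume x: "x \<in> carrier (free_module R S)"
    show "g x \<in> carrier W" unfolding g_def using x xc fs fin(2)[OF x] by (intro W.M.finsum_closed) (auto simp: subset_iff)
    show "g (c \<odot>\<^bsub>free_module R S\<^esub> x) = c \<odot>\<^bsub>W\<^esub> g x" if c: "c \<in> carrier R" for c
    proof -
      have "g (c \<odot>\<^bsub>free_module R S\<^esub> x) = (\<Oplus>\<^bsub>W\<^esub>s\<in>supp x. (c \<odot>\<^bsub>free_module R S\<^esub> x) s \<odot>\<^bsub>W\<^esub> f s)"
        using x c fin[OF x] by (intro g) (auto simp: supp_def free_module_smult)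
      also have "\<dots> = (\<Oplus>\<^bsub>W\<^esub>s\<in>supp x. c \<odot>\<^bsub>W\<^esub> (x s \<odot>\<^bsub>W\<^esub> f s))"
        using x xc fs fin(2)[OF x] c
        by (intro W.M.finsum_cong') (auto simp: free_module_smult W.smult_assoc1 subset_iff)
      also have "\<dots> = c \<odot>\<^bsub>W\<^esub> g x"
        unfolding g_def using x xc fs fin[OF x] c
        by (intro W.finsum_smult_ldistr[symmetric]) (auto simp: subset_iff)
      finally show ?thesis .
    qed
    fix y assume y: "y \<in> carrier (free_module R S)"
    let ?T = "supp x \<union> supp y"
    have T: "finite ?T" "?T \<subseteq> S" using fin x y by auto
    have "g (x \<oplus>\<^bsub>free_module R S\<^esub> y) = (\<Oplus>\<^bsub>W\<^esub>s\<in>?T. (x \<oplus>\<^bsub>free_module R S\<^esub> y) s \<odot>\<^bsub>W\<^esub> f s)"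
      using x y T by (intro g) (auto simp: supp_def free_module_add)
    also have "\<dots> = (\<Oplus>\<^bsub>W\<^esub>s\<in>?T. x s \<odot>\<^bsub>W\<^esub> f s \<oplus>\<^bsub>W\<^esub> y s \<odot>\<^bsub>W\<^esub> f s)"
      using x y xc fs T by (intro W.M.finsum_cong') (auto simp: free_module_add W.smult_l_distr subset_iff)
    also have "\<dots> = (\<Oplus>\<^bsub>W\<^esub>s\<in>?T. x s \<odot>\<^bsub>W\<^esub> f s) \<oplus>\<^bsub>W\<^esub> (\<Oplus>\<^bsub>W\<^esub>s\<in>?T. y s \<odot>\<^bsub>W\<^esub> f s)"
      using x y xc fs T by (intro W.M.finsum_addf) (auto simp: subset_iff)
    also have "\<dots> = g x \<oplus>\<^bsub>W\<^esub> g y"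
      using g[OF x T(1) _ T(2)] g[OF y T(1) _ T(2)] by simp
    finally show "g (x \<oplus>\<^bsub>free_module R S\<^esub> y) = g x \<oplus>\<^bsub>W\<^esub> g y" .
  qed
  moreover have "g (free_gen R S s) = f s" if "s \<in> S" for s
  proof -
    have "g (free_gen R S s) = (\<Oplus>\<^bsub>W\<^esub>s'\<in>{s}. free_gen R S s s' \<odot>\<^bsub>W\<^esub> f s')"
      using that free_gen_closed by (intro g) (auto simp: supp_def free_gen_def split: if_splits)
    also have "\<dots> = f s" using that fs by (simp add: free_gen_def)
    finally show ?thesis .
  qed
  ultimately show ?thesis using that by blast
qed

end

context module
begin

text \<open>The assumption puts \<open>carrier M\<close> into the intersected family; an empty
  family would intersect to \<open>UNIV\<close>.\<close>

lemma submodule_generated_submodule: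
  assumes "S \<subseteq> carrier M"
  shows "submodule (submodule_generated R M S) R M"
proof (rule submoduleI)
  show "submodule_generated R M S \<subseteq> carrier M"
    using carrier_is_submodule assms by (auto simp: submodule_generated_def)
qed (auto simp: submodule_generated_def submodule_zero submoduleE)

lemma quot_module_lift:
  assumes H: "submodule H R M" and W: "module R W" and f: "f \<in> linear_maps R M W"
    and zero: "\<And>x. x \<in> H \<Longrightarrow> f x = \<zero>\<^bsub>W\<^esub>"
  obtains g where "g \<in> linear_maps R (quot_module M H) W"
    "\<And>x. x \<in> carrier M \<Longrightarrow> g (H +>\<^bsub>M\<^esub> x) = f x"
proof -
  interpret f: linear_map R M W f
    by (intro linear_map.intro linear_map_axioms.intro module_axioms W f)
  \<comment> \<open>An arbitrary representative will do, since \<open>f\<close> vanishes on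
    \<open>H\<close>.\<close>
  define g where "g U = f (SOME x. x \<in> U)" for U
  have g: "g (H +>\<^bsub>M\<^esub> x) = f x" if x: "x \<in> carrier M" for x
  proof -
    have "(SOME y. y \<in> H +>\<^bsub>M\<^esub> x) \<in> H +>\<^bsub>M\<^esub> x" using coset_self[OF H x] by (rule someI)
    then obtain h where "h \<in> H" "(SOME y. y \<in> H +>\<^bsub>M\<^esub> x) = h \<oplus>\<^bsub>M\<^esub> x"
      by (auto simp: a_r_coset_def')
    then show ?thesis
      using x zero submoduleE(1)[OF H] by (auto simp: g_def f.add subset_iff)
  qed
  note proj = quot_proj_linear[OF H]
  have "g \<in> linear_maps R (quot_module M H) W"
    by (rule linear_mapsI)
      (auto simp: carrier_quot_module g f.add f.smult linear_maps_add[OF proj, symmetric]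
        linear_maps_smult[OF proj, symmetric])
  with g that show ?thesis by blast
qed

end

section \<open>Multilinear maps of tuples\<close>

definition multilinear ::
  "('k, 'r) ring_scheme \<Rightarrow> ('k, 'a, 'm) module_scheme \<Rightarrow> nat \<Rightarrow> ('k, 'w, 'n) module_scheme \<Rightarrow>
   ('a list \<Rightarrow> 'w) \<Rightarrow> bool"
  where "multilinear K A m W f \<longleftrightarrow> f \<in> tuples A m \<rightarrow> carrier W \<and>
    (\<forall>xs\<in>tuples A m. \<forall>i<m. (\<lambda>a. f (xs[i := a])) \<in> linear_maps K A W)"

text \<open>Shared by faces and rotation: a change of one entry changes one entry of the image,
  linearly. Here \<open>\<phi>\<close> may depend on the tuple, as for multiplication by a
  neighbouring entry. Multilinearity of the operators is thereby reduced to a check on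
  tuples.\<close>

definition slotwise_linear ::
  "('k, 'r) ring_scheme \<Rightarrow> ('k, 'a, 'm) module_scheme \<Rightarrow> nat \<Rightarrow> nat \<Rightarrow> ('a list \<Rightarrow> 'a list) \<Rightarrow> bool"
  where "slotwise_linear K A m m' F \<longleftrightarrow> F \<in> tuples A m \<rightarrow> tuples A m' \<and>
    (\<forall>xs\<in>tuples A m. \<forall>i<m. \<exists>j<m'. \<exists>\<phi>\<in>linear_maps K A A. \<forall>a\<in>carrier A.
      F (xs[i := a]) = (F xs)[j := \<phi> a])"

lemma tuples_update: "\<lbrakk>xs \<in> tuples A m; a \<in> carrier A\<rbrakk> \<Longrightarrow> xs[i := a] \<in> tuples A m"
  by (auto simp: tuples_def dest!: set_update_subset_insert[THEN subsetD])

lemma tuples_nth: "\<lbrakk>xs \<in> tuples A m; i < m\<rbrakk> \<Longrightarrow> xs ! i \<in> carrier A"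
  by (auto simp: tuples_def)

lemma tuples_length: "xs \<in> tuples A m \<Longrightarrow> length xs = m"
  by (simp add: tuples_def)

lemma tuplesI: "\<lbrakk>length xs = m; \<And>i. i < m \<Longrightarrow> xs ! i \<in> carrier A\<rbrakk> \<Longrightarrow> xs \<in> tuples A m"
  by (auto simp: tuples_def in_set_conv_nth)

lemma multilinear_closed: "\<lbrakk>multilinear K A m W f; xs \<in> tuples A m\<rbrakk> \<Longrightarrow> f xs \<in> carrier W"
  by (auto simp: multilinear_def)

lemma multilinear_comp:
  "\<lbrakk>multilinear K A m V f; g \<in> linear_maps K V W\<rbrakk> \<Longrightarrow> multilinear K A m W (\<lambda>xs. g (f xs))"
  unfolding multilinear_def using linear_maps_comp[of "\<lambda>a. f (_[_ := a])" K A V g W]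
  by (auto intro: linear_maps_closed)

lemma multilinear_slotwise:
  assumes "module K A" and f: "multilinear K A m' W f" and F: "slotwise_linear K A m m' F"
  shows "multilinear K A m W (\<lambda>xs. f (F xs))"
  unfolding multilinear_def
proof (intro conjI ballI allI impI)
  show "(\<lambda>xs. f (F xs)) \<in> tuples A m \<rightarrow> carrier W"
    using f F by (auto simp: multilinear_def slotwise_linear_def)
  fix xs i assume xs: "xs \<in> tuples A m" and "i < m"
  with F obtain j \<phi> where \<phi>: "j < m'" "\<phi> \<in> linear_maps K A A"
    "\<And>a. a \<in> carrier A \<Longrightarrow> F (xs[i := a]) = (F xs)[j := \<phi> a]"
    unfolding slotwise_linear_def by meson
  have "F xs \<in> tuples A m'" using F xs by (auto simp: slotwise_linear_def)
  then have "(\<lambda>a. f ((F xs)[j := a])) \<in> linear_maps K A W"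
    using f \<phi>(1) by (simp add: multilinear_def)
  from linear_maps_comp[OF \<phi>(2) this] \<phi>(3) \<open>module K A\<close>
  show "(\<lambda>a. f (F (xs[i := a]))) \<in> linear_maps K A W"
    by (auto intro: linear_maps_cong)
qed

lemma multilinear_plus:
  assumes "module K W" "multilinear K A m W f" "multilinear K A m W g"
  shows "multilinear K A m W (\<lambda>xs. f xs \<oplus>\<^bsub>W\<^esub> g xs)"
proof -
  interpret module K W by fact
  show ?thesis using assms unfolding multilinear_def by (auto intro!: linear_maps_plus)
qed

lemma multilinear_scale:
  assumes "module K W" "multilinear K A m W f" "c \<in> carrier K"
  shows "multilinear K A m W (\<lambda>xs. c \<odot>\<^bsub>W\<^esub> f xs)"
proof -
  interpret module K W by fact
  show ?thesis using assms unfolding multilinear_def by (auto intro!: linear_maps_scale)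
qed

lemma multilinear_finsum:
  assumes "module K W" "\<And>i. i \<in> I \<Longrightarrow> multilinear K A m W (f i)"
  shows "multilinear K A m W (\<lambda>xs. \<Oplus>\<^bsub>W\<^esub>i\<in>I. f i xs)"
proof -
  interpret module K W by fact
  show ?thesis using assms unfolding multilinear_def
    by (auto intro!: linear_maps_finsum M.finsum_closed)
qed

section \<open>The universal property of tensor powers\<close>

context module
begin

lemma tensor_rels_closed: "tensor_rels R M m \<subseteq> carrier (free_module R (tuples M m))"
proof -
  interpret F: module R "free_module R (tuples M m)" by (rule free_module_is_module)
  show ?thesis
    unfolding tensor_rels_def Let_def
    by (auto intro!: free_gen_closed tuples_update)
qed

lemma tensor_null_submodule: "submodule (tensor_null R M m) R (free_module R (tuples M m))"
  unfolding tensor_null_def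
  by (rule module.submodule_generated_submodule[OF free_module_is_module tensor_rels_closed])

lemma tensor_power_is_module: "module R (tensor_power R M m)"
  unfolding tensor_power_def
  by (rule module.quot_module_is_module[OF free_module_is_module tensor_null_submodule])

lemma pure_tensor_eq: "xs \<in> tuples M m \<Longrightarrow> pure_tensor R M xs =
    tensor_null R M m +>\<^bsub>free_module R (tuples M m)\<^esub> free_gen R (tuples M m) xs"
  by (simp add: pure_tensor_def tuples_length)

lemma tensor_null_rel: "r \<in> tensor_rels R M m \<Longrightarrow> r \<in> tensor_null R M m"
  by (auto simp: tensor_null_def submodule_generated_def)

lemma pure_tensor_multilinear: "multilinear R M m (tensor_power R M m) (pure_tensor R M)"
proof -
  let ?F = "free_module R (tuples M m)" and ?g = "free_gen R (tuples M m)"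
  interpret F: module R ?F by (rule free_module_is_module)
  note proj = F.quot_proj_linear[OF tensor_null_submodule[of m], folded tensor_power_def]
  note cl = free_gen_closed tuples_update
  show ?thesis
    unfolding multilinear_def
  proof (intro conjI ballI allI impI)
    show "pure_tensor R M \<in> tuples M m \<rightarrow> carrier (tensor_power R M m)"
      using linear_maps_closed[OF proj] by (auto simp: pure_tensor_eq cl)
    fix xs i assume xs: "xs \<in> tuples M m" and i: "i < m"
    note pure = pure_tensor_eq[OF tuples_update[OF xs]]
    show "(\<lambda>a. pure_tensor R M (xs[i := a])) \<in> linear_maps R M (tensor_power R M m)"
    proof (rule linear_mapsI)
      fix a assume a: "a \<in> carrier M"
      show "pure_tensor R M (xs[i := a]) \<in> carrier (tensor_power R M m)"
        using xs a by (simp add: linear_maps_closed[OF proj] pure cl)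
      show "pure_tensor R M (xs[i := c \<odot>\<^bsub>M\<^esub> a]) = c \<odot>\<^bsub>tensor_power R M m\<^esub> pure_tensor R M (xs[i := a])"
        if c: "c \<in> carrier R" for c
      proof -
        have "?g (xs[i := c \<odot>\<^bsub>M\<^esub> a]) \<ominus>\<^bsub>?F\<^esub> (c \<odot>\<^bsub>?F\<^esub> ?g (xs[i := a])) \<in> tensor_null R M m"
          using xs i a c by (intro tensor_null_rel) (auto simp: tensor_rels_def Let_def)
        then show ?thesis
          using xs a c
          by (simp add: pure cl F.coset_eq_iff[OF tensor_null_submodule]
            flip: linear_maps_smult[OF proj])
      qed
      fix b assume b: "b \<in> carrier M"
      have "?g (xs[i := a \<oplus>\<^bsub>M\<^esub> b]) \<ominus>\<^bsub>?F\<^esub> (?g (xs[i := a]) \<oplus>\<^bsub>?F\<^esub> ?g (xs[i := b])) \<in> tensor_null R M m"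
        using xs i a b by (intro tensor_null_rel) (auto simp: tensor_rels_def Let_def)
      then show "pure_tensor R M (xs[i := a \<oplus>\<^bsub>M\<^esub> b]) =
          pure_tensor R M (xs[i := a]) \<oplus>\<^bsub>tensor_power R M m\<^esub> pure_tensor R M (xs[i := b])"
        using xs a b
        by (simp add: pure cl F.coset_eq_iff[OF tensor_null_submodule]
          flip: linear_maps_add[OF proj])
    qed
  qed
qed

lemma tensor_power_ext:
  assumes W: "module R W" and f: "f \<in> linear_maps R (tensor_power R M m) W"
    and g: "g \<in> linear_maps R (tensor_power R M m) W"
    and eq: "\<And>xs. xs \<in> tuples M m \<Longrightarrow> f (pure_tensor R M xs) = g (pure_tensor R M xs)"
    and x: "x \<in> carrier (tensor_power R M m)"
  shows "f x = g x"
proof -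
  let ?F = "free_module R (tuples M m)"
  interpret F: module R ?F by (rule free_module_is_module)
  interpret W: module R W by (rule W)
  let ?\<pi> = "\<lambda>y. tensor_null R M m +>\<^bsub>?F\<^esub> y"
  note proj = F.quot_proj_linear[OF tensor_null_submodule[of m], folded tensor_power_def]
  note fc = linear_maps_closed[OF f] and gc = linear_maps_closed[OF g]
  \<comment> \<open>The difference of the two maps, pulled back to the free module; its kernel is a
    submodule that contains all generators.\<close>
  interpret h: linear_map R ?F W "\<lambda>y. f (?\<pi> y) \<oplus>\<^bsub>W\<^esub> \<ominus>\<^bsub>W\<^esub> g (?\<pi> y)"
    by (intro linear_map.intro linear_map_axioms.intro F.module_axioms W linear_maps_plus
      linear_maps_neg linear_maps_comp[OF proj] f g)
  obtain y where y: "y \<in> carrier ?F" "x = ?\<pi> y"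
    using x unfolding tensor_power_def by (auto simp: F.carrier_quot_module)
  have "y \<in> {y \<in> carrier ?F. f (?\<pi> y) \<oplus>\<^bsub>W\<^esub> \<ominus>\<^bsub>W\<^esub> g (?\<pi> y) \<in> {\<zero>\<^bsub>W\<^esub>}}"
  proof (rule free_module_induct[OF h.preimage_submodule[OF W.zero_submodule] _ y(1)])
    fix xs assume xs: "xs \<in> tuples M m"
    then show "free_gen R (tuples M m) xs \<in> {y \<in> carrier ?F. f (?\<pi> y) \<oplus>\<^bsub>W\<^esub> \<ominus>\<^bsub>W\<^esub> g (?\<pi> y) \<in> {\<zero>\<^bsub>W\<^esub>}}"
      using eq[OF xs] gc multilinear_closed[OF pure_tensor_multilinear xs]
      by (simp add: free_gen_closed W.M.r_neg flip: pure_tensor_eq)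
  qed
  then have "f x \<oplus>\<^bsub>W\<^esub> \<ominus>\<^bsub>W\<^esub> g x = \<zero>\<^bsub>W\<^esub>" by (simp add: y(2))
  then show ?thesis
    using fc[OF x] gc[OF x] W.M.minus_equality[of "f x" "\<ominus>\<^bsub>W\<^esub> g x"] by simp
qed

text \<open>Shows that the definite description in \<open>tensor_lift\<close> denotes: existence by
  descending from the free module, uniqueness by \<open>tensor_power_ext\<close>.\<close>

lemma tensor_lift:
  assumes W: "module R W" and f: "multilinear R M m W f"
  shows tensor_lift_linear: "tensor_lift R M m W f \<in> linear_maps R (tensor_power R M m) W"
    and tensor_lift_pure: "\<And>xs. xs \<in> tuples M m \<Longrightarrow> tensor_lift R M m W f (pure_tensor R M xs) = f xs"
proof -
  let ?F = "free_module R (tuples M m)" and ?T = "tensor_power R M m"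
  interpret F: module R ?F by (rule free_module_is_module)
  interpret T: module R ?T by (rule tensor_power_is_module)
  interpret W: module R W by (rule W)
  have W_diff: "w \<ominus>\<^bsub>W\<^esub> w = \<zero>\<^bsub>W\<^esub>" if "w \<in> carrier W" for w
    using that by (simp add: a_minus_def W.M.r_neg)
  have fc: "f \<in> tuples M m \<rightarrow> carrier W" using f by (simp add: multilinear_def)
  have fl: "(\<lambda>a. f (xs[i := a])) \<in> linear_maps R M W" if "xs \<in> tuples M m" "i < m" for xs i
    using f that by (simp add: multilinear_def)
  obtain g where g: "g \<in> linear_maps R ?F W" "\<And>xs. xs \<in> tuples M m \<Longrightarrow> g (free_gen R (tuples M m) xs) = f xs"
    using free_module_lift[OF W fc] by blast
  interpret g: linear_map R ?F W g
    by (intro linear_map.intro linear_map_axioms.intro F.module_axioms W g)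
  \<comment> \<open>Multilinearity of \<open>f\<close> says that \<open>g\<close> kills the
    relations; its kernel is a submodule and so contains all they generate.\<close>
  have "tensor_rels R M m \<subseteq> {y \<in> carrier ?F. g y \<in> {\<zero>\<^bsub>W\<^esub>}}"
  proof (intro subsetI)
    fix r assume r: "r \<in> tensor_rels R M m"
    then have "r \<in> carrier ?F" using tensor_rels_closed by blast
    moreover from r have "g r = \<zero>\<^bsub>W\<^esub>"
      unfolding tensor_rels_def Let_def
      using linear_maps_closed[OF fl]
      by (auto simp: g.minus g.add g.smult g(2) free_gen_closed tuples_update
        linear_maps_add[OF fl] linear_maps_smult[OF fl] W_diff)
    ultimately show "r \<in> {y \<in> carrier ?F. g y \<in> {\<zero>\<^bsub>W\<^esub>}}" by simp
  qed
  then have "tensor_null R M m \<subseteq> {y \<in> carrier ?F. g y \<in> {\<zero>\<^bsub>W\<^esub>}}"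
    using g.preimage_submodule[OF W.zero_submodule]
    unfolding tensor_null_def submodule_generated_def by blast
  then obtain h where h: "h \<in> linear_maps R ?T W"
      "\<And>x. x \<in> carrier ?F \<Longrightarrow> h (tensor_null R M m +>\<^bsub>?F\<^esub> x) = g x"
    using F.quot_module_lift[OF tensor_null_submodule[of m] W g(1), folded tensor_power_def]
    by (metis (no_types, lifting) mem_Collect_eq singletonD subsetD)
  let ?P = "\<lambda>h. h \<in> linear_maps R ?T W \<and> h \<in> extensional (carrier ?T) \<and>
    (\<forall>xs\<in>tuples M m. h (pure_tensor R M xs) = f xs)"
  \<comment> \<open>Restriction fixes the values outside the carrier, where linearity says nothing;
    without it the description would not be unique.\<close>
  have "?P (restrict h (carrier ?T))"
  proof (intro conjI ballI)
    show "restrict h (carrier ?T) \<in> linear_maps R ?T W"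
      using linear_maps_cong[OF h(1)] T.module_axioms by simp
    fix xs assume xs: "xs \<in> tuples M m"
    then show "restrict h (carrier ?T) (pure_tensor R M xs) = f xs"
      using multilinear_closed[OF pure_tensor_multilinear xs]
      by (simp add: pure_tensor_eq h(2) free_gen_closed g(2))
  qed simp
  moreover have "h1 = h2" if "?P h1" "?P h2" for h1 h2
    using that tensor_power_ext[OF W, of h1 m h2] by (intro extensionalityI[of h1 "carrier ?T"]) auto
  ultimately have "\<exists>!h. ?P h" by blast
  then have "?P (tensor_lift R M m W f)"
    unfolding tensor_lift_def by (rule theI')
  then show "tensor_lift R M m W f \<in> linear_maps R ?T W"
    "\<And>xs. xs \<in> tuples M m \<Longrightarrow> tensor_lift R M m W f (pure_tensor R M xs) = f xs"
    by blast+
qed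

end

section \<open>The cyclic operators of a Hom-associative algebra\<close>

text \<open>The concrete vertical differentials are known to agree with the abstract ones only on
  the carriers, so they cannot be exchanged by rewriting.\<close>

lemma bicomplex_cong_vertical:
  assumes "bicomplex K D dh dv"
    and eq: "\<And>p q x. x \<in> carrier (D (p, Suc q)) \<Longrightarrow> dv' p (Suc q) x = dv p (Suc q) x"
  shows "bicomplex K D dh dv'"
proof -
  interpret bicomplex K D dh dv by fact
  show ?thesis
  proof (intro bicomplex.intro bicomplex_axioms.intro is_cring D dh)
    show "dv' p (Suc q) \<in> linear_maps K (D (p, Suc q)) (D (p, q))" for p q
      by (rule linear_maps_cong[OF dv eq D])
  qed (simp_all add: eq dh_dv exact)
qed

text \<open>The witness is the image of 1 / (n + 1): the embedding sends n + 1 to the sum of n + 1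
  ones.\<close>

lemma contains_rationals_inverse:
  assumes "cring K" "contains_rationals K"
  shows "\<exists>c\<in>carrier K. c \<otimes>\<^bsub>K\<^esub> (\<Oplus>\<^bsub>K\<^esub>i\<in>{..n :: nat}. \<one>\<^bsub>K\<^esub>) = \<one>\<^bsub>K\<^esub>"
proof -
  interpret cring K by fact
  obtain h where h: "h \<in> ring_hom rat_field K" using assms by (auto simp: contains_rationals_def)
  have hc: "h r \<in> carrier K" and ha: "h (r + s) = h r \<oplus>\<^bsub>K\<^esub> h s"
    and hm: "h (r * s) = h r \<otimes>\<^bsub>K\<^esub> h s" and h1: "h 1 = \<one>\<^bsub>K\<^esub>" for r s
    using ring_hom_memE[OF h] by (simp_all add: rat_field_def)
  have "h (rat_of_nat (Suc n)) = (\<Oplus>\<^bsub>K\<^esub>i\<in>{..n}. \<one>\<^bsub>K\<^esub>)"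
  proof (induction n)
    case (Suc n)
    have "h (rat_of_nat (Suc (Suc n))) = h 1 \<oplus>\<^bsub>K\<^esub> h (rat_of_nat (Suc n))"
      by (simp flip: ha)
    also have "\<dots> = (\<Oplus>\<^bsub>K\<^esub>i\<in>{..Suc n}. \<one>\<^bsub>K\<^esub>)"
      unfolding Suc h1 by (subst finsum_Suc) auto
    finally show ?case .
  qed (simp add: h1)
  moreover have "h (1 / rat_of_nat (Suc n)) \<otimes>\<^bsub>K\<^esub> h (rat_of_nat (Suc n)) = h 1"
    by (simp del: of_nat_Suc flip: hm)
  ultimately show ?thesis using hc h1 by metis
qed

text \<open>Turns sign scalars into a case distinction on parity, so that sign identities between
  operators become parity checks.\<close>

lemma (in module) alt_sign_smult:
  "x \<in> carrier M \<Longrightarrow> alt_sign R i \<odot>\<^bsub>M\<^esub> x = (if even i then x else \<ominus>\<^bsub>M\<^esub> x)"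
  by (induction i) (simp_all add: alt_sign_def smult_assoc1 smult_l_minus smult_r_minus)

lemma (in cring) alt_sign_closed: "alt_sign R i \<in> carrier R"
  by (simp add: alt_sign_def)

section \<open>Rotations and faces of tuples\<close>

definition rot :: "'a list \<Rightarrow> 'a list"
  where "rot xs = last xs # butlast xs"

lemma length_rot [simp]: "length (rot xs) = Suc (length xs - 1)"
  by (simp add: rot_def)

lemma rot_nth: "k < length xs \<Longrightarrow> rot xs ! k = (if k = 0 then xs ! (length xs - 1) else xs ! (k - 1))"
  by (cases k) (auto simp: rot_def last_conv_nth nth_butlast)

text \<open>On nonempty lists \<open>rotate1\<close> undoes \<open>rot\<close>, so
  \<open>rotate k\<close> undoes \<open>k\<close> rotations, and for \<open>k\<close> the length
  \<open>rotate k\<close> is the identity.\<close>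

lemma rot_funpow_length:
  assumes "xs \<noteq> []"
  shows "(rot ^^ length xs) xs = xs"
proof -
  have inv: "rotate1 (rot ys) = ys" if "ys \<noteq> []" for ys :: "'a list"
    using that by (simp add: rot_def)
  have "(rot ^^ k) xs \<noteq> [] \<and> rotate k ((rot ^^ k) xs) = xs" for k
  proof (induction k)
    case (Suc k)
    have "rotate (Suc k) ((rot ^^ Suc k) xs) = rotate k (rotate1 (rot ((rot ^^ k) xs)))"
      by (simp add: rotate1_rotate_swap)
    then show ?case using Suc inv by (simp add: rot_def[of "(rot ^^ k) xs"])
  qed (use assms in simp)
  moreover have "length ((rot ^^ k) xs) = length xs" for k
    using assms by (induction k) (auto simp: rot_def)
  ultimately show ?thesis by (metis rotate_id mod_self)
qed

lemma length_inner_face [simp]: "Suc i < length xs \<Longrightarrow> length (inner_face \<mu> \<alpha> i xs) = length xs - 1"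
  by (simp add: inner_face_def)

lemma inner_face_nth:
  "\<lbrakk>Suc i < length xs; k < length xs - 1\<rbrakk> \<Longrightarrow> inner_face \<mu> \<alpha> i xs ! k =
    (if k < i then \<alpha> (xs ! k) else if k = i then \<mu> (xs ! i) (xs ! Suc i) else \<alpha> (xs ! Suc k))"
  by (auto simp: inner_face_def nth_append nth_Cons' Suc_diff_Suc)

lemma length_last_face [simp]: "2 \<le> length xs \<Longrightarrow> length (last_face \<mu> \<alpha> xs) = length xs - 1"
  by (simp add: last_face_def)

lemma last_face_nth:
  "\<lbrakk>2 \<le> length xs; k < length xs - 1\<rbrakk> \<Longrightarrow> last_face \<mu> \<alpha> xs ! k =
    (if k = 0 then \<mu> (xs ! (length xs - 1)) (xs ! 0) else \<alpha> (xs ! k))"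
  by (cases xs rule: list.exhaust; cases k)
    (auto simp: last_face_def last_conv_nth nth_butlast hd_conv_nth)

text \<open>This lemma and the next two are \<open>face_t\<close> and \<open>face_zero_t\<close> on
  tuples: rotation shifts each product by one slot, and brings the last entry in front of the
  first.\<close>

lemma inner_face_rot_Suc:
  assumes "Suc (Suc i) < length xs"
  shows "inner_face \<mu> \<alpha> (Suc i) (rot xs) = rot (inner_face \<mu> \<alpha> i xs)"
proof -
  have "xs \<noteq> []" using assms by auto
  then show ?thesis
    using assms by (intro nth_equalityI) (auto simp: inner_face_nth rot_nth Suc_diff_Suc)
qed

lemma inner_face_rot_zero:
  assumes "2 \<le> length xs"
  shows "inner_face \<mu> \<alpha> 0 (rot xs) = last_face \<mu> \<alpha> xs"
proof -
  have "xs \<noteq> []" using assms by auto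
  then show ?thesis
    using assms by (intro nth_equalityI) (auto simp: inner_face_nth last_face_nth rot_nth)
qed

lemma last_face_rot:
  "length xs = Suc (Suc n) \<Longrightarrow> last_face \<mu> \<alpha> (rot xs) = rot (inner_face \<mu> \<alpha> n xs)"
  by (rule nth_equalityI) (auto simp: inner_face_nth last_face_nth rot_nth)

section \<open>Multilinearity of the operators\<close>

context hom_assoc_algebra
begin

lemma mu_closed: "\<lbrakk>a \<in> carrier A; b \<in> carrier A\<rbrakk> \<Longrightarrow> \<mu> a b \<in> carrier A"
  by (rule linear_maps_closed[OF mu_linear_right])

lemma alpha_closed: "a \<in> carrier A \<Longrightarrow> \<alpha> a \<in> carrier A"
  by (rule linear_maps_closed[OF alpha_linear])

lemma slotwise_rot: "slotwise_linear K A (Suc m) (Suc m) rot"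
  unfolding slotwise_linear_def
proof (intro conjI ballI allI impI)
  show "rot \<in> tuples A (Suc m) \<rightarrow> tuples A (Suc m)"
    by (auto intro!: tuplesI simp: tuples_length rot_nth tuples_nth)
  fix xs i assume xs: "xs \<in> tuples A (Suc m)" "i < Suc m"
  then show "\<exists>j<Suc m. \<exists>\<phi>\<in>linear_maps K A A. \<forall>a\<in>carrier A. rot (xs[i := a]) = (rot xs)[j := \<phi> a]"
    by (intro exI[of _ "if i = m then 0 else Suc i"] conjI bexI[OF _ linear_maps_id] ballI nth_equalityI)
      (auto simp: tuples_length rot_nth nth_list_update)
qed

lemma slotwise_inner_face:
  assumes "i < m"
  shows "slotwise_linear K A (Suc m) m (inner_face \<mu> \<alpha> i)"
  unfolding slotwise_linear_def
proof (intro conjI ballI allI impI)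
  show "inner_face \<mu> \<alpha> i \<in> tuples A (Suc m) \<rightarrow> tuples A m"
    using assms
    by (auto intro!: tuplesI simp: tuples_length inner_face_nth tuples_nth mu_closed alpha_closed)
  fix xs j assume xs: "xs \<in> tuples A (Suc m)" "j < Suc m"
  have eq: "\<exists>k<m. \<exists>\<phi>\<in>linear_maps K A A. \<forall>a\<in>carrier A.
      inner_face \<mu> \<alpha> i (xs[j := a]) = (inner_face \<mu> \<alpha> i xs)[k := \<phi> a]"
    if "k < m" "\<phi> \<in> linear_maps K A A"
      "\<And>a l. l < m \<Longrightarrow> inner_face \<mu> \<alpha> i (xs[j := a]) ! l = (if l = k then \<phi> a else inner_face \<mu> \<alpha> i xs ! l)"
    for k \<phi>
    using that xs assms
    by (intro exI[of _ k] conjI bexI[of _ \<phi>] ballI nth_equalityI) (auto simp: tuples_length nth_list_update)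
  \<comment> \<open>Entry \<open>j\<close> stays in its slot under \<open>\<alpha>\<close>, enters
    the product in slot \<open>i\<close> as left or right factor, or moves down by one slot under
    \<open>\<alpha>\<close>.\<close>
  consider "j < i" | "j = i" | "j = Suc i" | "Suc i < j" by linarith
  then show "\<exists>k<m. \<exists>\<phi>\<in>linear_maps K A A. \<forall>a\<in>carrier A.
      inner_face \<mu> \<alpha> i (xs[j := a]) = (inner_face \<mu> \<alpha> i xs)[k := \<phi> a]"
  proof cases
    case 1
    then show ?thesis using xs assms
      by (intro eq[of j \<alpha>] alpha_linear) (auto simp: tuples_length inner_face_nth nth_list_update)
  next
    case 2
    then show ?thesis using xs assms
      by (intro eq[of i "\<lambda>a. \<mu> a (xs ! Suc i)"] mu_linear_left)
        (auto simp: tuples_length tuples_nth inner_face_nth nth_list_update)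
  next
    case 3
    then show ?thesis using xs assms
      by (intro eq[of i "\<lambda>a. \<mu> (xs ! i) a"] mu_linear_right)
        (auto simp: tuples_length tuples_nth inner_face_nth nth_list_update)
  next
    case 4
    then show ?thesis using xs assms
      by (intro eq[of "j - 1" \<alpha>] alpha_linear) (auto simp: tuples_length inner_face_nth nth_list_update)
  qed
qed

lemma slotwise_last_face:
  assumes "0 < m"
  shows "slotwise_linear K A (Suc m) m (last_face \<mu> \<alpha>)"
  unfolding slotwise_linear_def
proof (intro conjI ballI allI impI)
  show "last_face \<mu> \<alpha> \<in> tuples A (Suc m) \<rightarrow> tuples A m"
    using assms
    by (auto intro!: tuplesI simp: tuples_length last_face_nth tuples_nth mu_closed alpha_closed)
  fix xs j assume xs: "xs \<in> tuples A (Suc m)" "j < Suc m"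
  have eq: "\<exists>k<m. \<exists>\<phi>\<in>linear_maps K A A. \<forall>a\<in>carrier A.
      last_face \<mu> \<alpha> (xs[j := a]) = (last_face \<mu> \<alpha> xs)[k := \<phi> a]"
    if "k < m" "\<phi> \<in> linear_maps K A A"
      "\<And>a l. l < m \<Longrightarrow> last_face \<mu> \<alpha> (xs[j := a]) ! l = (if l = k then \<phi> a else last_face \<mu> \<alpha> xs ! l)"
    for k \<phi>
    using that xs assms
    by (intro exI[of _ k] conjI bexI[of _ \<phi>] ballI nth_equalityI) (auto simp: tuples_length nth_list_update)
  \<comment> \<open>The first and the last entry both go to slot 0, as right and left factor of the
    product; all others keep their slot.\<close>
  consider "j = 0" | "j = m" | "0 < j" "j < m" using xs by linarith
  then show "\<exists>k<m. \<exists>\<phi>\<in>linear_maps K A A. \<forall>a\<in>carrier A.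
      last_face \<mu> \<alpha> (xs[j := a]) = (last_face \<mu> \<alpha> xs)[k := \<phi> a]"
  proof cases
    case 1
    then show ?thesis using xs assms
      by (intro eq[of 0 "\<lambda>a. \<mu> (xs ! m) a"] mu_linear_right)
        (auto simp: tuples_length tuples_nth last_face_nth nth_list_update)
  next
    case 2
    then show ?thesis using xs assms
      by (intro eq[of 0 "\<lambda>a. \<mu> a (xs ! 0)"] mu_linear_left)
        (auto simp: tuples_length tuples_nth last_face_nth nth_list_update)
  next
    case 3
    then show ?thesis using xs assms
      by (intro eq[of j \<alpha>] alpha_linear) (auto simp: tuples_length last_face_nth nth_list_update)
  qed
qed

text \<open>Every index above \<open>n\<close> stands for the last face, so the linearity lemmas
  hold without a bound on \<open>i\<close>.\<close>

definition face_tuple :: "nat \<Rightarrow> nat \<Rightarrow> 'a list \<Rightarrow> 'a list"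
  where "face_tuple n i = (if i \<le> n then inner_face \<mu> \<alpha> i else last_face \<mu> \<alpha>)"

definition signed_face :: "nat \<Rightarrow> nat \<Rightarrow> ('a list \<Rightarrow> 'k) set \<Rightarrow> ('a list \<Rightarrow> 'k) set"
  where "signed_face n i = tensor_lift K A (Suc (Suc n)) (hom_chains K A n)
    (\<lambda>xs. alt_sign K i \<odot>\<^bsub>hom_chains K A n\<^esub> pure_tensor K A (face_tuple n i xs))"

lemma hom_chains_module: "module K (hom_chains K A n)"
  unfolding hom_chains_def by (rule tensor_power_is_module)

lemma pure_multilinear: "multilinear K A (Suc n) (hom_chains K A n) (pure_tensor K A)"
  using pure_tensor_multilinear[of "Suc n"] by (simp add: hom_chains_def)

lemma pure_closed: "xs \<in> tuples A (Suc n) \<Longrightarrow> pure_tensor K A xs \<in> carrier (hom_chains K A n)"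
  by (rule multilinear_closed[OF pure_multilinear])

lemma chains_ext:
  assumes "module K W" "f \<in> linear_maps K (hom_chains K A n) W" "g \<in> linear_maps K (hom_chains K A n) W"
    "\<And>xs. xs \<in> tuples A (Suc n) \<Longrightarrow> f (pure_tensor K A xs) = g (pure_tensor K A xs)"
    "x \<in> carrier (hom_chains K A n)"
  shows "f x = g x"
  using tensor_power_ext[of W f "Suc n" g x] assms by (simp add: hom_chains_def)

lemma chains_lift:
  assumes "module K W" "multilinear K A (Suc n) W f"
  shows "tensor_lift K A (Suc n) W f \<in> linear_maps K (hom_chains K A n) W"
  using tensor_lift_linear[OF assms] by (simp add: hom_chains_def)

lemma slotwise_face: "slotwise_linear K A (Suc (Suc n)) (Suc n) (face_tuple n i)"
  by (simp add: face_tuple_def slotwise_inner_face slotwise_last_face)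

lemma face_tuple_closed: "xs \<in> tuples A (Suc (Suc n)) \<Longrightarrow> face_tuple n i xs \<in> tuples A (Suc n)"
  using slotwise_face by (auto simp: slotwise_linear_def)

lemma rot_closed: "xs \<in> tuples A (Suc n) \<Longrightarrow> rot xs \<in> tuples A (Suc n)"
  using slotwise_rot by (auto simp: slotwise_linear_def)

lemma pure_slotwise_multilinear:
  assumes "slotwise_linear K A m (Suc n) F"
  shows "multilinear K A m (hom_chains K A n)
    (\<lambda>xs. alt_sign K i \<odot>\<^bsub>hom_chains K A n\<^esub> pure_tensor K A (F xs))"
  by (intro multilinear_scale hom_chains_module alt_sign_closed
      multilinear_slotwise[OF module_axioms pure_multilinear assms])

lemma signed_face_linear: "signed_face n i \<in> linear_maps K (hom_chains K A (Suc n)) (hom_chains K A n)"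
  unfolding signed_face_def
  by (intro chains_lift hom_chains_module pure_slotwise_multilinear slotwise_face)

lemma signed_face_pure:
  assumes "xs \<in> tuples A (Suc (Suc n))"
  shows "signed_face n i (pure_tensor K A xs) =
    (if even i then pure_tensor K A (face_tuple n i xs)
     else \<ominus>\<^bsub>hom_chains K A n\<^esub> pure_tensor K A (face_tuple n i xs))"
proof -
  interpret C: module K "hom_chains K A n" by (rule hom_chains_module)
  show ?thesis
    unfolding signed_face_def
      tensor_lift_pure[OF hom_chains_module pure_slotwise_multilinear[OF slotwise_face] assms]
    by (rule C.alt_sign_smult[OF pure_closed[OF face_tuple_closed[OF assms]]])
qed

lemma hom_t_eq: "hom_t K A n = tensor_lift K A (Suc n) (hom_chains K A n)
    (\<lambda>xs. alt_sign K n \<odot>\<^bsub>hom_chains K A n\<^esub> pure_tensor K A (rot xs))"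
  by (simp add: hom_t_def rot_def Let_def)

lemma hom_t_linear: "hom_t K A n \<in> linear_maps K (hom_chains K A n) (hom_chains K A n)"
  unfolding hom_t_eq
  by (intro chains_lift hom_chains_module pure_slotwise_multilinear slotwise_rot)

lemma hom_t_pure:
  assumes "xs \<in> tuples A (Suc n)"
  shows "hom_t K A n (pure_tensor K A xs) =
    (if even n then pure_tensor K A (rot xs) else \<ominus>\<^bsub>hom_chains K A n\<^esub> pure_tensor K A (rot xs))"
proof -
  interpret C: module K "hom_chains K A n" by (rule hom_chains_module)
  show ?thesis
    unfolding hom_t_eq
      tensor_lift_pure[OF hom_chains_module pure_slotwise_multilinear[OF slotwise_rot] assms]
    by (rule C.alt_sign_smult[OF pure_closed[OF rot_closed[OF assms]]])
qed

lemma hom_t_map: "linear_map K (hom_chains K A n) (hom_chains K A n) (hom_t K A n)"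
  and signed_face_map: "linear_map K (hom_chains K A (Suc n)) (hom_chains K A n) (signed_face n i)"
  by (intro linear_map.intro linear_map_axioms.intro hom_chains_module hom_t_linear signed_face_linear)+

lemmas hom_t_neg = linear_map.neg[OF hom_t_map]
  and signed_face_neg = linear_map.neg[OF signed_face_map]

lemma hom_b'_linear: "hom_b' K A \<mu> \<alpha> (Suc n) \<in> linear_maps K (hom_chains K A (Suc n)) (hom_chains K A n)"
  and hom_b'_eq: "x \<in> carrier (hom_chains K A (Suc n)) \<Longrightarrow>
    hom_b' K A \<mu> \<alpha> (Suc n) x = (\<Oplus>\<^bsub>hom_chains K A n\<^esub>i\<in>{..<Suc n}. signed_face n i x)"
proof -
  let ?C = "hom_chains K A n"
  interpret C: module K ?C by (rule hom_chains_module)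
  let ?f = "\<lambda>xs. \<Oplus>\<^bsub>?C\<^esub>i\<in>{..<Suc n}. alt_sign K i \<odot>\<^bsub>?C\<^esub> pure_tensor K A (inner_face \<mu> \<alpha> i xs)"
  have b': "hom_b' K A \<mu> \<alpha> (Suc n) = tensor_lift K A (Suc (Suc n)) ?C ?f"
    by (simp add: hom_b'_def Let_def)
  have ml: "multilinear K A (Suc (Suc n)) ?C ?f"
    by (intro multilinear_finsum hom_chains_module pure_slotwise_multilinear slotwise_inner_face) simp
  show lin: "hom_b' K A \<mu> \<alpha> (Suc n) \<in> linear_maps K (hom_chains K A (Suc n)) ?C"
    unfolding b' by (rule chains_lift[OF hom_chains_module ml])
  have pure: "hom_b' K A \<mu> \<alpha> (Suc n) (pure_tensor K A xs) =
      (\<Oplus>\<^bsub>?C\<^esub>i\<in>{..<Suc n}. signed_face n i (pure_tensor K A xs))"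
    if "xs \<in> tuples A (Suc (Suc n))" for xs
    unfolding b' tensor_lift_pure[OF hom_chains_module ml that]
  proof (rule C.M.finsum_cong'[OF refl])
    show "(\<lambda>i. signed_face n i (pure_tensor K A xs)) \<in> {..<Suc n} \<rightarrow> carrier ?C"
      using linear_maps_closed[OF signed_face_linear pure_closed[OF that]] by auto
    fix i assume "i \<in> {..<Suc n}"
    then show "alt_sign K i \<odot>\<^bsub>?C\<^esub> pure_tensor K A (inner_face \<mu> \<alpha> i xs) = signed_face n i (pure_tensor K A xs)"
      using C.alt_sign_smult[OF pure_closed[OF face_tuple_closed[OF that, of i]]]
      by (simp add: signed_face_pure[OF that] face_tuple_def)
  qed
  \<comment> \<open>A lift of a sum against a sum of lifts: both are linear, and they agree on pure
    tensors.\<close>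
  show "hom_b' K A \<mu> \<alpha> (Suc n) x = (\<Oplus>\<^bsub>?C\<^esub>i\<in>{..<Suc n}. signed_face n i x)"
    if "x \<in> carrier (hom_chains K A (Suc n))"
    by (rule chains_ext[OF hom_chains_module lin linear_maps_finsum[OF hom_chains_module signed_face_linear] pure that])
qed

lemma hom_b_eq:
  assumes x: "x \<in> carrier (hom_chains K A (Suc n))"
  shows "hom_b K A \<mu> \<alpha> (Suc n) x = hom_b' K A \<mu> \<alpha> (Suc n) x \<oplus>\<^bsub>hom_chains K A n\<^esub> signed_face n (Suc n) x"
proof -
  let ?C = "hom_chains K A n"
  interpret C: module K ?C by (rule hom_chains_module)
  let ?f = "\<lambda>xs. hom_b' K A \<mu> \<alpha> (Suc n) (pure_tensor K A xs) \<oplus>\<^bsub>?C\<^esub>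
    alt_sign K (Suc n) \<odot>\<^bsub>?C\<^esub> pure_tensor K A (last_face \<mu> \<alpha> xs)"
  have b: "hom_b K A \<mu> \<alpha> (Suc n) = tensor_lift K A (Suc (Suc n)) ?C ?f"
    by (simp add: hom_b_def Let_def)
  have ml: "multilinear K A (Suc (Suc n)) ?C ?f"
    by (intro multilinear_plus hom_chains_module pure_slotwise_multilinear slotwise_last_face
        multilinear_comp[OF pure_multilinear hom_b'_linear]) simp
  show ?thesis
  proof (rule chains_ext[OF hom_chains_module _ _ _ x])
    show "hom_b K A \<mu> \<alpha> (Suc n) \<in> linear_maps K (hom_chains K A (Suc n)) ?C"
      unfolding b by (rule chains_lift[OF hom_chains_module ml])
    show "(\<lambda>x. hom_b' K A \<mu> \<alpha> (Suc n) x \<oplus>\<^bsub>?C\<^esub> signed_face n (Suc n) x)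
        \<in> linear_maps K (hom_chains K A (Suc n)) ?C"
      by (rule linear_maps_plus[OF hom_chains_module hom_b'_linear signed_face_linear])
    fix xs assume xs: "xs \<in> tuples A (Suc (Suc n))"
    show "hom_b K A \<mu> \<alpha> (Suc n) (pure_tensor K A xs) =
        hom_b' K A \<mu> \<alpha> (Suc n) (pure_tensor K A xs) \<oplus>\<^bsub>?C\<^esub> signed_face n (Suc n) (pure_tensor K A xs)"
      unfolding b tensor_lift_pure[OF hom_chains_module ml xs] signed_face_pure[OF xs]
      using C.alt_sign_smult[OF pure_closed[OF face_tuple_closed[OF xs, of "Suc n"]], of "Suc n"]
      by (simp add: face_tuple_def)
  qed
qed

text \<open>Each rotation contributes the sign (-1)^n. For \<open>j = Suc n\<close> the exponent n
  (n + 1) is even, so no sign remains after a full turn.\<close>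

lemma hom_t_funpow_pure:
  assumes xs: "xs \<in> tuples A (Suc n)"
  shows "(rot ^^ j) xs \<in> tuples A (Suc n) \<and> (hom_t K A n ^^ j) (pure_tensor K A xs) =
    (if even (n * j) then pure_tensor K A ((rot ^^ j) xs)
     else \<ominus>\<^bsub>hom_chains K A n\<^esub> pure_tensor K A ((rot ^^ j) xs))"
proof (induction j)
  case (Suc j)
  interpret C: module K "hom_chains K A n" by (rule hom_chains_module)
  show ?case
    using Suc by (auto simp: hom_t_pure hom_t_neg rot_closed pure_closed)
qed (use xs in simp)

end

section \<open>The cyclic relations\<close>

context multiplicative_hom_assoc_algebra
begin

text \<open>For \<open>j = Suc i\<close> the two sides differ only in the triple product, which is
  Hom-associativity. For \<open>Suc i < j\<close> each product formed by the first face has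
  \<open>\<alpha>\<close> applied to it by the second, which is \<open>alpha_mult\<close>.\<close>

lemma inner_face_inner_face:
  assumes "i < j" "j \<le> Suc n" and xs: "xs \<in> tuples A (Suc (Suc (Suc n)))"
  shows "inner_face \<mu> \<alpha> i (inner_face \<mu> \<alpha> j xs) = inner_face \<mu> \<alpha> (j - 1) (inner_face \<mu> \<alpha> i xs)"
proof (rule nth_equalityI)
  have len: "length xs = Suc (Suc (Suc n))" using xs by (rule tuples_length)
  have c: "k < Suc (Suc (Suc n)) \<Longrightarrow> xs ! k \<in> carrier A" for k using xs by (rule tuples_nth)
  show "length (inner_face \<mu> \<alpha> i (inner_face \<mu> \<alpha> j xs)) =
      length (inner_face \<mu> \<alpha> (j - 1) (inner_face \<mu> \<alpha> i xs))"
    using assms(1,2) len by simp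
  fix k assume "k < length (inner_face \<mu> \<alpha> i (inner_face \<mu> \<alpha> j xs))"
  then have k: "k < Suc n" using assms(1,2) len by simp
  consider "j = Suc i" | "Suc i < j" using assms(1) by linarith
  then show "inner_face \<mu> \<alpha> i (inner_face \<mu> \<alpha> j xs) ! k = inner_face \<mu> \<alpha> (j - 1) (inner_face \<mu> \<alpha> i xs) ! k"
    using assms(1,2) len k
    by cases (auto simp: inner_face_nth hom_assoc alpha_mult c)
qed

lemma cyclic_operators:
  assumes "contains_rationals K"
  shows "cyclic_operators K (hom_chains K A) signed_face (hom_t K A)"
proof (intro cyclic_operators.intro cyclic_operators_axioms.intro is_cring hom_chains_module
    signed_face_linear hom_t_linear contains_rationals_inverse assms)
  fix n i x
  note cl = face_tuple_closed rot_closed pure_closed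
  interpret C: module K "hom_chains K A n" by (rule hom_chains_module)
  show "signed_face n i (signed_face (Suc n) j x) =
      \<ominus>\<^bsub>hom_chains K A n\<^esub> signed_face n (j - 1) (signed_face (Suc n) i x)"
    if ij: "i < j" "j \<le> Suc n" and x: "x \<in> carrier (hom_chains K A (Suc (Suc n)))" for j
  proof (rule chains_ext[OF hom_chains_module _ _ _ x])
    show "(\<lambda>x. signed_face n i (signed_face (Suc n) j x))
        \<in> linear_maps K (hom_chains K A (Suc (Suc n))) (hom_chains K A n)"
      by (rule linear_maps_comp[OF signed_face_linear signed_face_linear])
    show "(\<lambda>x. \<ominus>\<^bsub>hom_chains K A n\<^esub> signed_face n (j - 1) (signed_face (Suc n) i x))
        \<in> linear_maps K (hom_chains K A (Suc (Suc n))) (hom_chains K A n)"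
      by (rule linear_maps_neg[OF hom_chains_module linear_maps_comp[OF signed_face_linear signed_face_linear]])
    fix xs assume xs: "xs \<in> tuples A (Suc (Suc (Suc n)))"
    have "face_tuple n i (face_tuple (Suc n) j xs) = face_tuple n (j - 1) (face_tuple (Suc n) i xs)"
    proof -
      \<comment> \<open>As \<open>j \<le> Suc n\<close>, all four faces are inner ones. The signs on
        the two sides have exponents i + j and i + j - 1, which gives the minus sign.\<close>
      have "i \<le> n" "i \<le> Suc n" "j - 1 \<le> n" using ij by auto
      then show ?thesis
        unfolding face_tuple_def using ij(2) by (simp only: inner_face_inner_face[OF ij xs] if_True)
    qed
    then show "signed_face n i (signed_face (Suc n) j (pure_tensor K A xs)) =
        \<ominus>\<^bsub>hom_chains K A n\<^esub> signed_face n (j - 1) (signed_face (Suc n) i (pure_tensor K A xs))"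
      using xs ij by (auto simp: signed_face_pure signed_face_neg cl)
  qed
  show "signed_face n (Suc i) (hom_t K A (Suc n) x) = hom_t K A n (signed_face n i x)"
    if i: "i \<le> n" and x: "x \<in> carrier (hom_chains K A (Suc n))"
  proof (rule chains_ext[OF hom_chains_module _ _ _ x])
    show "(\<lambda>x. signed_face n (Suc i) (hom_t K A (Suc n) x))
        \<in> linear_maps K (hom_chains K A (Suc n)) (hom_chains K A n)"
      by (rule linear_maps_comp[OF hom_t_linear signed_face_linear])
    show "(\<lambda>x. hom_t K A n (signed_face n i x)) \<in> linear_maps K (hom_chains K A (Suc n)) (hom_chains K A n)"
      by (rule linear_maps_comp[OF signed_face_linear hom_t_linear])
    fix xs assume xs: "xs \<in> tuples A (Suc (Suc n))"
    \<comment> \<open>For \<open>i = n\<close> the face on the left is the last one. The sign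
      exponents, i + 1 + n + 1 and i + n, have the same parity.\<close>
    have "face_tuple n (Suc i) (rot xs) = rot (face_tuple n i xs)"
      using i tuples_length[OF xs]
      by (cases "i = n") (auto simp: face_tuple_def inner_face_rot_Suc last_face_rot)
    then show "signed_face n (Suc i) (hom_t K A (Suc n) (pure_tensor K A xs)) =
        hom_t K A n (signed_face n i (pure_tensor K A xs))"
      using xs by (auto simp: signed_face_pure signed_face_neg hom_t_pure hom_t_neg cl)
  qed
  show "signed_face n 0 (hom_t K A (Suc n) x) = signed_face n (Suc n) x"
    if x: "x \<in> carrier (hom_chains K A (Suc n))"
  proof (rule chains_ext[OF hom_chains_module _ signed_face_linear _ x])
    show "(\<lambda>x. signed_face n 0 (hom_t K A (Suc n) x))
        \<in> linear_maps K (hom_chains K A (Suc n)) (hom_chains K A n)"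
      by (rule linear_maps_comp[OF hom_t_linear signed_face_linear])
    fix xs assume xs: "xs \<in> tuples A (Suc (Suc n))"
    \<comment> \<open>The sign (-1)^(n + 1) of the rotation is the sign of the last face.\<close>
    have "face_tuple n 0 (rot xs) = face_tuple n (Suc n) xs"
      using tuples_length[OF xs] by (simp add: face_tuple_def inner_face_rot_zero)
    then show "signed_face n 0 (hom_t K A (Suc n) (pure_tensor K A xs)) =
        signed_face n (Suc n) (pure_tensor K A xs)"
      using xs by (auto simp: signed_face_pure signed_face_neg hom_t_pure cl)
  qed
  show "(hom_t K A n ^^ Suc n) x = x" if x: "x \<in> carrier (hom_chains K A n)"
  proof (rule chains_ext[OF hom_chains_module _ linear_maps_id _ x])
    show "hom_t K A n ^^ Suc n \<in> linear_maps K (hom_chains K A n) (hom_chains K A n)"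
      by (rule linear_maps_funpow[OF hom_t_linear])
    fix xs assume xs: "xs \<in> tuples A (Suc n)"
    have len: "length xs = Suc n" using xs by (rule tuples_length)
    then have "xs \<noteq> []" by auto
    from rot_funpow_length[OF this] show "(hom_t K A n ^^ Suc n) (pure_tensor K A xs) = pure_tensor K A xs"
      using hom_t_funpow_pure[OF xs, of "Suc n"] by (simp add: len del: funpow.simps)
  qed
qed

end

theorem proposition3p14:
  fixes K :: "('k, 'r) ring_scheme" and A :: "('k, 'a, 'm) module_scheme"
    and \<mu> :: "'a \<Rightarrow> 'a \<Rightarrow> 'a" and \<alpha> :: "'a \<Rightarrow> 'a" and n :: nat
  assumes "contains_rationals K"
    and "multiplicative_hom_assoc_algebra K A \<mu> \<alpha>"
  shows "linearly_isomorphic K (HC K A \<mu> \<alpha> n) (HC_lambda K A \<mu> \<alpha> n)"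
proof -
  interpret multiplicative_hom_assoc_algebra K A \<mu> \<alpha> by fact
  interpret c: cyclic_operators K "hom_chains K A" signed_face "hom_t K A"
    by (rule cyclic_operators[OF assms(1)])
  have CC: "CC K A = (\<lambda>(p, q). hom_chains K A q)"
    by (simp add: CC_def hom_chains_def)
  have b': "hom_b' K A \<mu> \<alpha> (Suc q) x = c.b' (Suc q) x" if "x \<in> carrier (hom_chains K A (Suc q))" for q x
    using that by (simp add: hom_b'_eq c.b'_def)
  have b: "hom_b K A \<mu> \<alpha> (Suc q) x = c.b (Suc q) x" if "x \<in> carrier (hom_chains K A (Suc q))" for q x
    using that by (simp add: hom_b_eq b' c.b_def)
  \<comment> \<open>The horizontal maps agree as functions, by unfolding; the vertical ones only on
    the carriers, whence \<open>bicomplex_cong_vertical\<close> below.\<close>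
  have horiz: "CC_horiz K A = (\<lambda>p q x. if odd p then c.id_minus_t q x else c.N q x)"
    by (simp add: CC_horiz_def hom_id_minus_t_def c.id_minus_t_def hom_N_def c.N_def fun_eq_iff)
  interpret B: bicomplex K "CC K A" "CC_horiz K A" "CC_vert K A \<mu> \<alpha>"
    unfolding horiz CC
    by (rule bicomplex_cong_vertical[OF c.bicomplex]) (simp add: CC_vert_def CC b b')
  have total: "B.total = Tot K A" "B.total_d = Tot_d K A \<mu> \<alpha>"
    by (simp_all add: B.total_def Tot_def B.total_d_def Tot_d_def fun_eq_iff)
  have vert: "CC_vert K A \<mu> \<alpha> 0 = hom_b K A \<mu> \<alpha>"
    by (simp add: CC_vert_def fun_eq_iff)
  have null: "B.null = cyclic_null K A"
    unfolding fun_eq_iff B.null_def cyclic_null_def by (simp add: CC CC_horiz_def)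
  have coker: "B.coker = lambda_chains K A" "B.coker_d = lambda_b K A \<mu> \<alpha>"
    unfolding fun_eq_iff B.coker_def lambda_chains_def B.coker_d_def lambda_b_def null vert
    by (simp_all add: CC)
  show ?thesis
    using B.total_coker_isomorphic[of n] unfolding HC_def HC_lambda_def total coker .
qed

end
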